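(* Let $\mu$ and $\nu$ be compactly supported probability measures on $\mathbb{R}$, and let $\mu\boxplus_s\nu$ denote their s-free convolution. Then $$K_{\mu\boxplus_s\nu}(z)=\lim_{m\to\infty}K_{\mu\vdash_m\nu}(z),$$ where the convergence is uniform on compact subsets of $\mathbb{C}^+$.
   Context: $\mathbb{C}^+$ is the open upper half-plane. For a probability measure $\mu$ on $\mathbb{R}$: $G_\mu(z)=\int\frac{\mu(dx)}{z-x}$, $F_\mu=1/G_\mu$, $K_\mu(z)=z-F_\mu(z)$ for $z\in\mathbb{C}^+$. Orthogonal convolution: $\mu\vdash\nu$ is the unique probability measure with $F_{\mu\vdash\nu}(z)=F_\mu(F_\nu(z))-F_\nu(z)+z$ on $\mathbb{C}^+$ (equivalently $K_{\mu\vdash\nu}(z)=K_\mu(z-K_\nu(z))$). Recursively, $\mu\vdash_1\nu=\mu\vdash\nu$ and $\mu\vdash_n\nu=\mu\vdash(\nu\vdash_{n-1}\mu)$ for $n\ge2$. Free product of Hilbert spaces: for Hilbert spaces with unit vectors $(\mathcal H_1,\xi_1),(\mathcal H_2,\xi_2)$ put $\mathcal H_i^0=\mathcal H_i\ominus\mathbb{C}\xi_i$ and $\mathcal H=\mathbb{C}\xi\oplus\bigoplus_{n\ge1}\bigoplus_{i_1\ne\cdots\ne i_n}\mathcal H_{i_1}^0\otimes\cdots\otimes\mathcal H_{i_n}^0$ (indices in $\{1,2\}$, $\xi$ a unit vector). For $j\in\{1,2\}$ let $\bar j$ be the other index, $\mathcal H^{(0)}(j)=\mathbb{C}\xi$,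 and for $n\ge1$ let $\mathcal H^{(n)}(j)$ be the sum of those $\mathcal H_{i_1}^0\otimes\cdots\otimes\mathcal H_{i_n}^0$ with $i_1\ne\cdots\ne i_n$ and $i_1\neq j$. Let $\mathcal H(j)=\bigoplus_{n\ge1}\mathcal H^{(n)}(j)$. The free product representation $\lambda_j:\mathcal B(\mathcal H_j)\to\mathcal B(\mathcal H)$ is $\lambda_j(a)(h_1\otimes h)=(ah_1)^0\otimes h+\langle ah_1,\xi_j\rangle h$ for $h_1\in\mathcal H_j$, $h\in\mathbb{C}\xi\oplus\mathcal H(j)$, where $v^0$ is the projection of $v$ onto $\mathcal H_j^0$ and one identifies $\xi_j\otimes h\equiv h$, $h_1\otimes\xi\equiv h_1$. Let $P_j(n)$ be the orthogonal projection onto $\mathcal H^{(n-1)}(j)\oplus\mathcal H^{(n)}(\bar j)$ and $a(n)=P_j(n)\lambda_j(a)P_j(n)$ for $a\in\mathcal B(\mathcal H_j)$. s-free convolution (written here $\boxplus_s$): let $x_1\in\mathcal B(\mathcal H_1)$, $x_2\in\mathcal B(\mathcal H_2)$ be self-adjoint with distributions $\mu$, $\nu$ in the vector states of $\xi_1$, $\xi_2$ (e.g. multiplication by the variable on $L^2(\mathbb{R},\mu)$, $L^2(\mathbb{R},\nu)$ with $\xi_i=1$). Then $\mu\boxplus_s\nu$ is the (compactly supported) distribution, in the vector state of $\xi$, of the bounded self-adjoint operator $\sum_{r\ge0}x_1(2r+1)+\sum_{r\ge1}x_2(2r)$ (strongly convergent series). *)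

theory Defs
  imports "HOL-Probability.Probability"
begin

section \<open>Transforms of probability measures and the orthogonal convolution\<close>

definition upper_half_plane :: "complex set" where
  "upper_half_plane = {z. 0 < Im z}"

definition compactly_supported :: "real measure \<Rightarrow> bool" where
  "compactly_supported \<mu> \<longleftrightarrow> (\<exists>S. compact S \<and> measure \<mu> S = 1)"

definition G_transform :: "real measure \<Rightarrow> complex \<Rightarrow> complex" where
  "G_transform \<mu> z = (\<integral>x. 1 / (z - complex_of_real x) \<partial>\<mu>)"

definition F_transform :: "real measure \<Rightarrow> complex \<Rightarrow> complex" where
  "F_transform \<mu> z = 1 / G_transform \<mu> z"

definition K_transform :: "real measure \<Rightarrow> complex \<Rightarrow> complex" where
  "K_transform \<mu> z = z - F_transform \<mu> z"

definition orth_conv :: "real measure \<Rightarrow> real measure \<Rightarrow> real measure" where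
  "orth_conv \<mu> \<nu> = (THE \<rho>. real_distribution \<rho> \<and>
     (\<forall>z\<in>upper_half_plane.
        F_transform \<rho> z = F_transform \<mu> (F_transform \<nu> z) - F_transform \<nu> z + z))"

text \<open>
  The \<open>m\<close>-fold iteration is meant for \<open>m \<ge> 1\<close>.  The value at \<open>m = 0\<close> is a convention chosen so that
  the recursion step also produces the correct initial value, see \<open>orth_conv_iter_1\<close>.
\<close>

primrec orth_conv_iter :: "nat \<Rightarrow> real measure \<Rightarrow> real measure \<Rightarrow> real measure" where
  "orth_conv_iter 0 \<mu> \<nu> = \<mu>"
| "orth_conv_iter (Suc m) \<mu> \<nu> = orth_conv \<mu> (orth_conv_iter m \<nu> \<mu>)"

lemma orth_conv_iter_1: "orth_conv_iter 1 \<mu> \<nu> = orth_conv \<mu> \<nu>"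
  by simp


section \<open>The complex Hilbert space of square-summable families\<close>

typedef 'a ell2 = "{f :: 'a \<Rightarrow> complex. (\<lambda>i. (cmod (f i))\<^sup>2) summable_on UNIV}"
  morphisms coord Abs_ell2
  by (rule exI[of _ "\<lambda>_. 0"]) simp

setup_lifting type_definition_ell2

lemma ell2_bound:
  fixes f :: "'a \<Rightarrow> complex"
  assumes "(\<lambda>i. (cmod (f i))\<^sup>2) summable_on UNIV" "finite A"
  shows "L2_set (\<lambda>i. cmod (f i)) A \<le> sqrt (\<Sum>\<^sub>\<infinity>i. (cmod (f i))\<^sup>2)"
  unfolding L2_set_def
  by (rule real_sqrt_le_mono, rule finite_sum_le_infsum) (use assms in auto)

lemma ell2_add_aux:
  fixes f g :: "'a \<Rightarrow> complex"
  assumes f: "(\<lambda>i. (cmod (f i))\<^sup>2) summable_on UNIV"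
    and g: "(\<lambda>i. (cmod (g i))\<^sup>2) summable_on UNIV"
  shows "(\<lambda>i. (cmod (f i + g i))\<^sup>2) summable_on UNIV"
    and "sqrt (\<Sum>\<^sub>\<infinity>i. (cmod (f i + g i))\<^sup>2)
           \<le> sqrt (\<Sum>\<^sub>\<infinity>i. (cmod (f i))\<^sup>2) + sqrt (\<Sum>\<^sub>\<infinity>i. (cmod (g i))\<^sup>2)"
proof -
  let ?B = "sqrt (\<Sum>\<^sub>\<infinity>i. (cmod (f i))\<^sup>2) + sqrt (\<Sum>\<^sub>\<infinity>i. (cmod (g i))\<^sup>2)"
  have B0: "?B \<ge> 0"
    by (intro add_nonneg_nonneg real_sqrt_ge_zero infsum_nonneg) auto
  have *: "(\<Sum>i\<in>A. (cmod (f i + g i))\<^sup>2) \<le> ?B\<^sup>2" if "finite A" for A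
  proof -
    have "L2_set (\<lambda>i. cmod (f i + g i)) A \<le> L2_set (\<lambda>i. cmod (f i) + cmod (g i)) A"
      by (rule L2_set_mono) (auto intro: norm_triangle_ineq)
    also have "\<dots> \<le> L2_set (\<lambda>i. cmod (f i)) A + L2_set (\<lambda>i. cmod (g i)) A"
      by (rule L2_set_triangle_ineq)
    also have "\<dots> \<le> ?B"
      using ell2_bound[OF f that] ell2_bound[OF g that] by linarith
    finally have "sqrt (\<Sum>i\<in>A. (cmod (f i + g i))\<^sup>2) \<le> ?B"
      unfolding L2_set_def .
    then show ?thesis
      by (rule sqrt_le_D)
  qed
  show s: "(\<lambda>i. (cmod (f i + g i))\<^sup>2) summable_on UNIV"
    by (rule nonneg_bdd_above_summable_on) (auto intro!: bdd_aboveI2[where M = "?B\<^sup>2"] *)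
  have "(\<Sum>\<^sub>\<infinity>i. (cmod (f i + g i))\<^sup>2) \<le> ?B\<^sup>2"
    by (rule infsum_le_finite_sums[OF s]) (use * in auto)
  then show "sqrt (\<Sum>\<^sub>\<infinity>i. (cmod (f i + g i))\<^sup>2) \<le> ?B"
    using B0 by (intro real_le_lsqrt)
qed

lift_definition scaleC_ell2 :: "complex \<Rightarrow> 'a ell2 \<Rightarrow> 'a ell2" (infixr "*\<^sub>C" 75)
  is "\<lambda>c f i. c * f i"
  by (auto simp: norm_mult power_mult_distrib intro: summable_on_cmult_right)

instantiation ell2 :: (type) real_vector
begin

lift_definition zero_ell2 :: "'a ell2" is "\<lambda>_. 0" by simp
lift_definition plus_ell2 :: "'a ell2 \<Rightarrow> 'a ell2 \<Rightarrow> 'a ell2" is "\<lambda>f g i. f i + g i"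
  by (rule ell2_add_aux(1))
lift_definition uminus_ell2 :: "'a ell2 \<Rightarrow> 'a ell2" is "\<lambda>f i. - f i" by simp
definition minus_ell2 :: "'a ell2 \<Rightarrow> 'a ell2 \<Rightarrow> 'a ell2" where "minus_ell2 f g = f + - g"
definition scaleR_ell2 :: "real \<Rightarrow> 'a ell2 \<Rightarrow> 'a ell2" where
  "scaleR_ell2 r f = complex_of_real r *\<^sub>C f"

instance
proof
  fix x y z :: "'a ell2" and a b :: real
  show "x + y + z = x + (y + z)" by transfer (simp add: add.assoc)
  show "x + y = y + x" by transfer (simp add: add.commute)
  show "0 + x = x" by transfer simp
  show "- x + x = 0" by transfer simp
  show "x - y = x + - y" by (simp add: minus_ell2_def)
  show "a *\<^sub>R (x + y) = a *\<^sub>R x + a *\<^sub>R y"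
    unfolding scaleR_ell2_def by transfer (simp add: algebra_simps)
  show "(a + b) *\<^sub>R x = a *\<^sub>R x + b *\<^sub>R x"
    unfolding scaleR_ell2_def by transfer (simp add: algebra_simps)
  show "a *\<^sub>R b *\<^sub>R x = (a * b) *\<^sub>R x"
    unfolding scaleR_ell2_def by transfer (simp add: algebra_simps)
  show "1 *\<^sub>R x = x"
    unfolding scaleR_ell2_def by transfer simp
qed

end

instantiation ell2 :: (type) real_normed_vector
begin

lift_definition norm_ell2 :: "'a ell2 \<Rightarrow> real" is "\<lambda>f. sqrt (\<Sum>\<^sub>\<infinity>i. (cmod (f i))\<^sup>2)" .
definition sgn_ell2 :: "'a ell2 \<Rightarrow> 'a ell2" where "sgn_ell2 f = f /\<^sub>R norm f"
definition dist_ell2 :: "'a ell2 \<Rightarrow> 'a ell2 \<Rightarrow> real" where "dist_ell2 f g = norm (f - g)"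
definition uniformity_ell2 :: "('a ell2 \<times> 'a ell2) filter" where
  "uniformity_ell2 = (INF e\<in>{0<..}. principal {(x, y). dist x y < e})"
definition open_ell2 :: "'a ell2 set \<Rightarrow> bool" where
  "open_ell2 U \<longleftrightarrow> (\<forall>x\<in>U. \<forall>\<^sub>F (x', y) in uniformity. x' = x \<longrightarrow> y \<in> U)"

instance
proof
  fix x y :: "'a ell2" and a :: real
  show "dist x y = norm (x - y)" by (simp add: dist_ell2_def)
  show "sgn x = x /\<^sub>R norm x" by (simp add: sgn_ell2_def)
  show "uniformity = (INF e\<in>{0<..}. principal {(x, y :: 'a ell2). dist x y < e})"
    by (simp add: uniformity_ell2_def)
  show "open U \<longleftrightarrow> (\<forall>x\<in>U. \<forall>\<^sub>F (x', y) in uniformity. x' = x \<longrightarrow> y \<in> U)" for U :: "'a ell2 set"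
    by (simp add: open_ell2_def)
  show "norm (x + y) \<le> norm x + norm y"
    by transfer (rule ell2_add_aux(2))
  show "norm (a *\<^sub>R x) = \<bar>a\<bar> * norm x"
    unfolding scaleR_ell2_def
    by transfer (simp add: norm_mult power_mult_distrib infsum_cmult_right' real_sqrt_mult)
  show "norm x = 0 \<longleftrightarrow> x = 0"
  proof transfer
    fix f :: "'a \<Rightarrow> complex"
    assume f: "(\<lambda>i. (cmod (f i))\<^sup>2) summable_on UNIV"
    show "sqrt (\<Sum>\<^sub>\<infinity>i. (cmod (f i))\<^sup>2) = 0 \<longleftrightarrow> f = (\<lambda>_. 0)"
    proof
      assume "sqrt (\<Sum>\<^sub>\<infinity>i. (cmod (f i))\<^sup>2) = 0"
      then have "(cmod (f i))\<^sup>2 = 0" for i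
        by (intro nonneg_infsum_le_0D[OF _ f]) auto
      then show "f = (\<lambda>_. 0)" by auto
    qed simp
  qed
qed

end

text \<open>The inner product is linear in the first argument.\<close>

lift_definition cinner :: "'a ell2 \<Rightarrow> 'a ell2 \<Rightarrow> complex"
  is "\<lambda>f g. \<Sum>\<^sub>\<infinity>i. f i * cnj (g i)" .

lift_definition ket :: "'a \<Rightarrow> 'a ell2" is "\<lambda>i k. if k = i then 1 else 0"
  by (rule finite_nonzero_values_imp_summable_on) (auto simp: if_distrib cong: if_cong)

definition bounded_clinear :: "('a ell2 \<Rightarrow> 'b ell2) \<Rightarrow> bool" where
  "bounded_clinear A \<longleftrightarrow> bounded_linear A \<and> (\<forall>c v. A (c *\<^sub>C v) = c *\<^sub>C A v)"

definition selfadjoint :: "('a ell2 \<Rightarrow> 'a ell2) \<Rightarrow> bool" where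
  "selfadjoint A \<longleftrightarrow> bounded_clinear A \<and> (\<forall>u v. cinner (A u) v = cinner u (A v))"

definition orth_proj :: "'a ell2 set \<Rightarrow> 'a ell2 \<Rightarrow> 'a ell2" where
  "orth_proj S v = (THE u. u \<in> S \<and> (\<forall>s\<in>S. cinner (v - u) s = 0))"

text \<open>
  The distribution of a bounded self-adjoint operator \<open>A\<close> in the vector state of a unit vector
  \<open>v\<close> is the unique compactly supported probability measure with moments \<open>\<langle>A\<^sup>n v, v\<rangle>\<close>.
\<close>

definition has_distribution :: "('a ell2 \<Rightarrow> 'a ell2) \<Rightarrow> 'a ell2 \<Rightarrow> real measure \<Rightarrow> bool" where
  "has_distribution A v \<mu> \<longleftrightarrow> real_distribution \<mu> \<and> compactly_supported \<mu> \<and>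
     (\<forall>n. complex_of_real (\<integral>x. x ^ n \<partial>\<mu>) = cinner ((A ^^ n) v) v)"


section \<open>The free product of Hilbert spaces\<close>

text \<open>
  A Hilbert space with a distinguished unit vector is, after the choice of an orthonormal basis
  containing that vector, of the form \<open>(\<ell>\<^sup>2('a option), ket None)\<close>, and then the orthogonal
  complement of the unit vector is \<open>\<ell>\<^sup>2('a)\<close>.  Both factors of the free product are taken of
  this form.  A basis vector of the factor with index \<open>j\<close> that is orthogonal to the unit vector is
  the letter \<open>(j, i)\<close>.  As \<open>\<ell>\<^sup>2(A) \<otimes> \<ell>\<^sup>2(B) = \<ell>\<^sup>2(A \<times> B)\<close>, the free product is the space of the
  square-summable families indexed by the words in which the indices of neighbouring letters
  differ: the word \<open>[(i\<^sub>1, b\<^sub>1), \<dots>, (i\<^sub>n, b\<^sub>n)]\<close> stands for the tensor product of the basis vectors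
  \<open>b\<^sub>1, \<dots>, b\<^sub>n\<close>, and the empty word for the unit vector \<open>\<xi>\<close>.  It is realised as a subspace of the
  square-summable families indexed by all words.
\<close>

datatype side = First | Second

primrec other :: "side \<Rightarrow> side" where
  "other First = Second"
| "other Second = First"

type_synonym 'a word = "(side \<times> 'a) list"

definition alternating :: "'a word \<Rightarrow> bool" where
  "alternating w \<longleftrightarrow> successively (\<lambda>p q. fst p \<noteq> fst q) w"

definition starts_with :: "side \<Rightarrow> 'a word \<Rightarrow> bool" where
  "starts_with j w \<longleftrightarrow> w \<noteq> [] \<and> fst (hd w) = j"

definition vacuum :: "'a word ell2" where
  "vacuum = ket []"

text \<open>
  \<open>level n j\<close> is \<open>\<H>\<^sup>(\<^sup>n\<^sup>)(j)\<close>, and \<open>not_from j\<close> is \<open>\<complex>\<xi> \<oplus> \<H>(j)\<close>.  Both consist of tensors that do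
  not start in the factor \<open>j\<close>.
\<close>

definition level :: "nat \<Rightarrow> side \<Rightarrow> 'a word ell2 set" where
  "level n j = {f. \<forall>w. coord f w \<noteq> 0 \<longrightarrow> alternating w \<and> length w = n \<and> \<not> starts_with j w}"

definition not_from :: "side \<Rightarrow> 'a word ell2 set" where
  "not_from j = {f. \<forall>w. coord f w \<noteq> 0 \<longrightarrow> alternating w \<and> \<not> starts_with j w}"

text \<open>
  For \<open>w\<close> not starting in \<open>j\<close>, \<open>glue_word j k w\<close> is the word of the tensor product of the
  basis vector \<open>k\<close> of the factor \<open>j\<close> with \<open>w\<close>, where the unit vector of the factor (\<open>k = None\<close>) is absorbed.
  \<open>split_word j\<close> is the inverse of this operation.
\<close>

primrec glue_word :: "side \<Rightarrow> 'a option \<Rightarrow> 'a word \<Rightarrow> 'a word" where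
  "glue_word j None w = w"
| "glue_word j (Some i) w = (j, i) # w"

fun split_word :: "side \<Rightarrow> 'a word \<Rightarrow> 'a option \<times> 'a word" where
  "split_word j [] = (None, [])"
| "split_word j ((k, i) # w) = (if k = j then (Some i, w) else (None, (k, i) # w))"

lemma split_glue: "\<not> starts_with j w \<Longrightarrow> split_word j (glue_word j k w) = (k, w)"
  by (cases k; cases w) (auto simp: starts_with_def)

lemma glue_split: "glue_word j (fst (split_word j w)) (snd (split_word j w)) = w"
  by (induction j w rule: split_word.induct) auto

lemma not_starts_with_split: "alternating w \<Longrightarrow> \<not> starts_with j (snd (split_word j w))"
  by (induction j w rule: split_word.induct)
    (auto simp: starts_with_def alternating_def neq_Nil_conv)

lemma alternating_split: "alternating w \<Longrightarrow> alternating (snd (split_word j w))"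
  by (induction j w rule: split_word.induct) (auto simp: alternating_def successively_Cons)

text \<open>The product \<open>h\<^sub>1 \<otimes> h\<close> for \<open>h\<^sub>1\<close> in the factor \<open>j\<close> and \<open>h \<in> not_from j\<close>.\<close>

definition tensor :: "side \<Rightarrow> 'a option ell2 \<Rightarrow> 'a word ell2 \<Rightarrow> 'a word ell2" where
  "tensor j h1 h = Abs_ell2 (\<lambda>w. if alternating w
     then coord h1 (fst (split_word j w)) * coord h (snd (split_word j w)) else 0)"

text \<open>
  The free product representation.  By \<open>glue_word\<close>, the free product is the tensor product of the
  factor \<open>j\<close> with \<open>not_from j\<close>; the representation lets \<open>a\<close> act on the first component, that
  is, on each slice \<open>k \<mapsto> f (glue_word j k w)\<close> with \<open>w\<close> not starting in \<open>j\<close>.  Its values on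
  tensors \<open>h\<^sub>1 \<otimes> h\<close> are given by \<open>free_rep_tensor\<close> below.
\<close>

lift_definition slice :: "side \<Rightarrow> 'a word ell2 \<Rightarrow> 'a word \<Rightarrow> 'a option ell2"
  is "\<lambda>j f w k. f (glue_word j k w)"
proof -
  fix j w and f :: "'a word \<Rightarrow> complex"
  assume "(\<lambda>i. (cmod (f i))\<^sup>2) summable_on UNIV"
  then have "(\<lambda>i. (cmod (f i))\<^sup>2) summable_on range (\<lambda>k. glue_word j k w)"
    by (rule summable_on_subset_banach) simp
  moreover have "inj (\<lambda>k. glue_word j k w)"
  proof (rule injI)
    show "k = l" if "glue_word j k w = glue_word j l w" for k l
      using that by (cases k; cases l) auto
  qed
  ultimately show "(\<lambda>k. (cmod (f (glue_word j k w)))\<^sup>2) summable_on UNIV"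
    by (subst (asm) summable_on_reindex) (auto simp: o_def)
qed

definition free_rep ::
  "side \<Rightarrow> ('a option ell2 \<Rightarrow> 'a option ell2) \<Rightarrow> 'a word ell2 \<Rightarrow> 'a word ell2" where
  "free_rep j a f = Abs_ell2 (\<lambda>w. if alternating w
     then coord (a (slice j f (snd (split_word j w)))) (fst (split_word j w)) else 0)"

lemma norm_ell2_sum_le:
  assumes "finite A"
  shows "(\<Sum>i\<in>A. (cmod (coord f i))\<^sup>2) \<le> (norm f)\<^sup>2"
proof -
  have "L2_set (\<lambda>i. cmod (coord f i)) A \<le> norm f"
    unfolding norm_ell2.rep_eq using coord assms by (intro ell2_bound) auto
  then show ?thesis
    unfolding L2_set_def by (rule sqrt_le_D)
qed

lemma norm_ell2_squared: "(norm f)\<^sup>2 = (\<Sum>\<^sub>\<infinity>i. (cmod (coord f i))\<^sup>2)"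
  unfolding norm_ell2.rep_eq by (simp add: infsum_nonneg)

lemma summable_ell2: "(\<lambda>i. (cmod (coord f i))\<^sup>2) summable_on UNIV"
  using coord[of f] by simp

lemma inj_on_split: "inj (split_word j)"
proof (rule injI)
  fix v w :: "'a word"
  assume "split_word j v = split_word j w"
  then have "glue_word j (fst (split_word j v)) (snd (split_word j v))
      = glue_word j (fst (split_word j w)) (snd (split_word j w))"
    by simp
  then show "v = w"
    unfolding glue_split .
qed

lemma slices_bound:
  assumes "finite V" and V: "\<And>w. w \<in> V \<Longrightarrow> \<not> starts_with j w"
  shows "(\<Sum>w\<in>V. (norm (slice j f w))\<^sup>2) \<le> (norm f)\<^sup>2"
proof -
  have inj: "inj_on (\<lambda>(w, k). glue_word j k w) (V \<times> UNIV)"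
  proof (rule inj_onI)
    fix p q
    assume pq: "p \<in> V \<times> UNIV" "q \<in> V \<times> UNIV"
      "(case p of (w, k) \<Rightarrow> glue_word j k w) = (case q of (w, k) \<Rightarrow> glue_word j k w)"
    obtain w k w' k' where [simp]: "p = (w, k)" "q = (w', k')" by (metis surj_pair)
    have "split_word j (glue_word j k w) = (k, w)" "split_word j (glue_word j k' w') = (k', w')"
      using pq(1,2) by (simp_all add: split_glue V)
    moreover have "split_word j (glue_word j k w) = split_word j (glue_word j k' w')"
      using arg_cong[OF pq(3), of "split_word j"] by simp
    ultimately have "(k, w) = (k', w')" by (simp only:)
    then show "p = q" by simp
  qed
  have S: "(\<lambda>w. (cmod (coord f w))\<^sup>2) summable_on (\<lambda>(w, k). glue_word j k w) ` (V \<times> UNIV)"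
    by (rule summable_on_subset_banach[OF summable_ell2]) simp
  then have S': "(\<lambda>(w, k). (cmod (coord f (glue_word j k w)))\<^sup>2) summable_on (V \<times> UNIV)"
    by (subst (asm) summable_on_reindex[OF inj]) (simp add: o_def case_prod_unfold)
  have "(\<Sum>w\<in>V. (norm (slice j f w))\<^sup>2) = (\<Sum>\<^sub>\<infinity>w\<in>V. \<Sum>\<^sub>\<infinity>k. (cmod (coord f (glue_word j k w)))\<^sup>2)"
    using assms(1) by (simp add: norm_ell2_squared slice.rep_eq)
  also have "\<dots> = (\<Sum>\<^sub>\<infinity>(w, k)\<in>V \<times> UNIV. (cmod (coord f (glue_word j k w)))\<^sup>2)"
    using infsum_Sigma'_banach[OF S'] by simp
  also have "\<dots> = (\<Sum>\<^sub>\<infinity>w\<in>(\<lambda>(w, k). glue_word j k w) ` (V \<times> UNIV). (cmod (coord f w))\<^sup>2)"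
    by (subst infsum_reindex[OF inj]) (simp add: o_def case_prod_unfold)
  also have "\<dots> \<le> (\<Sum>\<^sub>\<infinity>w. (cmod (coord f w))\<^sup>2)"
    by (rule infsum_mono_neutral[OF S summable_ell2]) auto
  finally show ?thesis
    unfolding norm_ell2_squared .
qed

lemma summable_split:
  fixes g :: "'a word \<Rightarrow> 'a option ell2" and B :: real
  assumes B: "\<And>V. finite V \<Longrightarrow> (\<And>w. w \<in> V \<Longrightarrow> \<not> starts_with j w) \<Longrightarrow> (\<Sum>w\<in>V. (norm (g w))\<^sup>2) \<le> B"
  shows "(\<lambda>w. (cmod (if alternating w then coord (g (snd (split_word j w))) (fst (split_word j w)) else 0))\<^sup>2)
           summable_on UNIV"
proof (rule nonneg_bdd_above_summable_on)
  let ?F = "\<lambda>w. (cmod (if alternating w then coord (g (snd (split_word j w))) (fst (split_word j w)) else 0))\<^sup>2"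
  have "sum ?F A \<le> B" if A: "finite A" for A
  proof -
    define A' where "A' = {w \<in> A. alternating w}"
    have A': "finite A'" using A by (simp add: A'_def)
    let ?K = "fst ` split_word j ` A'" and ?V = "snd ` split_word j ` A'"
    have "sum ?F A = (\<Sum>w\<in>A'. (cmod (coord (g (snd (split_word j w))) (fst (split_word j w))))\<^sup>2)"
      unfolding A'_def using A by (intro sum.mono_neutral_cong_right) auto
    also have "\<dots> = (\<Sum>(k, w)\<in>split_word j ` A'. (cmod (coord (g w) k))\<^sup>2)"
      by (subst sum.reindex) (auto simp: case_prod_unfold intro: inj_on_subset[OF inj_on_split])
    also have "\<dots> \<le> (\<Sum>(k, w)\<in>?K \<times> ?V. (cmod (coord (g w) k))\<^sup>2)"
      by (rule sum_mono2[OF _ subset_fst_snd]) (use A' in auto)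
    also have "\<dots> = (\<Sum>w\<in>?V. \<Sum>k\<in>?K. (cmod (coord (g w) k))\<^sup>2)"
      by (subst sum.swap) (simp add: sum.cartesian_product)
    also have "\<dots> \<le> (\<Sum>w\<in>?V. (norm (g w))\<^sup>2)"
      using A' by (intro sum_mono norm_ell2_sum_le) auto
    also have "\<dots> \<le> B"
      using A' by (intro B) (auto simp: A'_def not_starts_with_split)
    finally show ?thesis .
  qed
  then show "bdd_above (sum ?F ` {F. F \<subseteq> UNIV \<and> finite F})"
    by (auto intro!: bdd_aboveI2[where M = B])
qed simp

lemma coord_free_rep:
  assumes "bounded_clinear a"
  shows "coord (free_rep j a f) w =
    (if alternating w then coord (a (slice j f (snd (split_word j w)))) (fst (split_word j w)) else 0)"
proof -
  obtain C where C: "\<And>v. norm (a v) \<le> norm v * C"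
    using assms bounded_linear.bounded[of a] by (auto simp: bounded_clinear_def)
  have "(\<Sum>w\<in>V. (norm (a (slice j f w)))\<^sup>2) \<le> (norm f)\<^sup>2 * C\<^sup>2"
    if V: "finite V" "\<And>w. w \<in> V \<Longrightarrow> \<not> starts_with j w" for V
  proof -
    have "(\<Sum>w\<in>V. (norm (a (slice j f w)))\<^sup>2) \<le> (\<Sum>w\<in>V. (norm (slice j f w))\<^sup>2 * C\<^sup>2)"
      unfolding power_mult_distrib[symmetric] by (intro sum_mono power_mono C) auto
    also have "\<dots> \<le> (norm f)\<^sup>2 * C\<^sup>2"
      unfolding sum_distrib_right[symmetric] by (intro mult_right_mono slices_bound V) auto
    finally show ?thesis .
  qed
  from summable_split[of j "\<lambda>v. a (slice j f v)", OF this] show ?thesis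
    unfolding free_rep_def by (subst Abs_ell2_inverse) auto
qed

lemma norm_scaleC_ell2: "norm (c *\<^sub>C f) = cmod c * norm f"
  by transfer (simp add: norm_mult power_mult_distrib infsum_cmult_right' real_sqrt_mult)

lemma coord_tensor:
  "coord (tensor j h1 h) w =
    (if alternating w then coord h1 (fst (split_word j w)) * coord h (snd (split_word j w)) else 0)"
proof -
  have "(\<Sum>w\<in>V. (norm (coord h w *\<^sub>C h1))\<^sup>2) \<le> (norm h)\<^sup>2 * (norm h1)\<^sup>2" if "finite V" for V
    unfolding norm_scaleC_ell2 power_mult_distrib sum_distrib_right[symmetric]
    by (intro mult_right_mono norm_ell2_sum_le that) auto
  from summable_split[of j "\<lambda>v. coord h v *\<^sub>C h1", OF this] show ?thesis
    unfolding tensor_def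
    by (subst Abs_ell2_inverse) (auto simp: scaleC_ell2.rep_eq mult.commute cong: if_cong)
qed

lemma cinner_ket: "cinner f (ket i) = coord f i"
proof transfer
  fix f :: "'a \<Rightarrow> complex" and i
  have "(\<Sum>\<^sub>\<infinity>k. f k * cnj (if k = i then 1 else 0)) = (\<Sum>\<^sub>\<infinity>k\<in>{i}. f k * cnj (if k = i then 1 else 0))"
    by (rule infsum_cong_neutral) auto
  then show "(\<Sum>\<^sub>\<infinity>k. f k * cnj (if k = i then 1 else 0)) = f i" by simp
qed

lemma ell2_eqI: "(\<And>i. coord f i = coord g i) \<Longrightarrow> f = g"
  by (rule coord_inject[THEN iffD1], rule ext)

text \<open>
  \<open>\<lambda>\<^sub>j(a)(h\<^sub>1 \<otimes> h) = (a h\<^sub>1)\<^sup>0 \<otimes> h + \<langle>a h\<^sub>1, \<xi>\<^sub>j\<rangle> h\<close>, where \<open>v\<^sup>0 = v - \<langle>v, \<xi>\<^sub>j\<rangle> \<xi>\<^sub>j\<close>.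
\<close>

lemma free_rep_tensor:
  fixes h1 :: "'a option ell2" and h :: "'a word ell2"
  assumes a: "bounded_clinear a" and h: "h \<in> not_from j"
  defines "v \<equiv> a h1"
  shows "free_rep j a (tensor j h1 h) =
    tensor j (v - cinner v (ket None) *\<^sub>C ket None) h + cinner v (ket None) *\<^sub>C h"
proof (rule ell2_eqI)
  fix w
  have coord_minus: "coord (f - g) i = coord f i - coord g i" for f g :: "'b ell2" and i
    unfolding minus_ell2_def plus_ell2.rep_eq uminus_ell2.rep_eq by simp
  have slice: "slice j (tensor j h1 h) u = coord h u *\<^sub>C h1" if "\<not> starts_with j u" "alternating u" for u
  proof (rule ell2_eqI)
    fix k
    have "alternating (glue_word j k u)"
      using that by (cases k; cases u) (auto simp: alternating_def starts_with_def)
    then show "coord (slice j (tensor j h1 h) u) k = coord (coord h u *\<^sub>C h1) k"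
      using that by (simp add: slice.rep_eq coord_tensor split_glue scaleC_ell2.rep_eq)
  qed
  have aC: "a (c *\<^sub>C u) = c *\<^sub>C a u" for c u
    using a by (simp add: bounded_clinear_def)
  have h0: "coord h u = 0" if "\<not> alternating u \<or> starts_with j u" for u
    using h that by (auto simp: not_from_def)
  show "coord (free_rep j a (tensor j h1 h)) w = coord (tensor j (v - cinner v (ket None) *\<^sub>C ket None) h
          + cinner v (ket None) *\<^sub>C h) w"
  proof (cases "alternating w")
    case False
    then show ?thesis
      by (simp add: coord_free_rep[OF a] plus_ell2.rep_eq coord_tensor scaleC_ell2.rep_eq h0)
  next
    case True
    let ?k = "fst (split_word j w)" and ?u = "snd (split_word j w)"
    have 1: "coord (free_rep j a (tensor j h1 h)) w = coord h ?u * coord v ?k"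
      using True
      by (simp add: coord_free_rep[OF a] slice[OF not_starts_with_split alternating_split] aC
          scaleC_ell2.rep_eq v_def)
    have 2: "coord (tensor j (v - cinner v (ket None) *\<^sub>C ket None) h) w
             = (coord v ?k - coord v None * (if ?k = None then 1 else 0)) * coord h ?u"
      using True by (simp add: coord_tensor coord_minus scaleC_ell2.rep_eq cinner_ket ket.rep_eq)
    show ?thesis
    proof (cases "starts_with j w")
      case True
      then have "?k \<noteq> None" by (cases w) (auto simp: starts_with_def)
      then show ?thesis
        using True by (auto simp: plus_ell2.rep_eq 1 2 scaleC_ell2.rep_eq h0)
    next
      case False
      then have "split_word j w = (None, w)"
        using split_glue[of j w None] by simp
      then show ?thesis
        by (simp add: plus_ell2.rep_eq 1 2[unfolded cinner_ket] scaleC_ell2.rep_eq cinner_ket)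
    qed
  qed
qed


section \<open>The s-free convolution\<close>

definition P_proj :: "side \<Rightarrow> nat \<Rightarrow> 'a word ell2 \<Rightarrow> 'a word ell2" where
  "P_proj j n = orth_proj {u + v | u v. u \<in> level (n - 1) j \<and> v \<in> level n (other j)}"

definition compression ::
  "side \<Rightarrow> ('a option ell2 \<Rightarrow> 'a option ell2) \<Rightarrow> nat \<Rightarrow> 'a word ell2 \<Rightarrow> 'a word ell2" where
  "compression j a n = P_proj j n \<circ> free_rep j a \<circ> P_proj j n"

definition sfree_op ::
  "('a option ell2 \<Rightarrow> 'a option ell2) \<Rightarrow> ('a option ell2 \<Rightarrow> 'a option ell2)
     \<Rightarrow> 'a word ell2 \<Rightarrow> 'a word ell2" where
  "sfree_op x1 x2 v =
     (\<Sum>r. compression First x1 (2 * r + 1) v) + (\<Sum>r. compression Second x2 (2 * Suc r) v)"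

text \<open>
  The result does not depend on the realisations \<open>x1\<close> and \<open>x2\<close> of the given distributions.  Every
  compactly supported distribution is realised on the separable space \<open>\<ell>\<^sup>2(nat option)\<close>: the
  cyclic subspace generated by the unit vector has a countable orthonormal basis.
\<close>

definition sfree_conv :: "real measure \<Rightarrow> real measure \<Rightarrow> real measure" where
  "sfree_conv \<mu> \<nu> = (THE \<rho>. \<exists>x1 x2 :: nat option ell2 \<Rightarrow> nat option ell2.
     selfadjoint x1 \<and> has_distribution x1 (ket None) \<mu> \<and>
     selfadjoint x2 \<and> has_distribution x2 (ket None) \<nu> \<and>
     has_distribution (sfree_op x1 x2) vacuum \<rho>)"

end

(*
  Let T be the operator defining the s-free convolution.  For large Im z the equation
  (z - T) u = c xi has an explicit solution u that is a product over the letters of a word, built from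
  resolvent vectors of x1 and x2 at points z - l and z - k; it exists precisely when
  k = K_mu(z - l) and l = K_nu(z - k), and then K(z) = k for the s-free convolution.  The same
  construction with T cut off after two levels realises the orthogonal convolution, whose transform is
  K_mu(z - K_nu(z)).  So the iterates K_m satisfy K_m+1 = K_mu(z - K_m'), where the prime exchanges
  mu and nu, which is the iteration of a contraction with fixed point (k, l) when Im z is large.  As
  |G(z)| <= 1 / Im z for every probability measure, Vitali's argument carries the convergence of the
  Cauchy transforms G_m, hence that of K_m = z - 1 / G_m, to the whole upper half-plane.
*)

theory Submission
  imports Defs "HOL-Real_Asymp.Real_Asymp" "HOL-Complex_Analysis.Complex_Analysis"
begin

text \<open>Both convolutions are definite descriptions, so they become usable only after a measure
  has been exhibited and shown to be unique. Existence is a matter of moments: a bounded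
  self-adjoint operator gets its distribution from the Hausdorff moment theorem, which takes the
  role of the spectral theorem. Conversely, a given measure is realised on \<open>nat option\<close>
  by the Jacobi matrix of its orthogonal polynomials. Uniqueness is Stieltjes inversion combined
  with the identity theorem, so transforms have to be known only for large Im z. The product
  solution must be square-summable. Each resolvent vector is normalised to coordinate 1 at the unit
  vector, which makes the product compatible with absorbing that vector; its other coordinates then
  have square sum at most 1/2, so all words of length n together carry at most 2^-n. The thresholds
  come from three facts, with R bounding the supports and C the operators: |K| <= 2R if |w| >= 4R,
  |K'| <= 1/2 if Im w >= 8R, and the resolvent estimate if |w| >= 12C.\<close>

lemma coord_simps [simp]:
  "coord 0 i = 0" "coord (f + g) i = coord f i + coord g i" "coord (- f) i = - coord f i"
  "coord (f - g) i = coord f i - coord g i" "coord (c *\<^sub>C f) i = c * coord f i"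
  "coord (r *\<^sub>R f) i = complex_of_real r * coord f i"
  unfolding zero_ell2.rep_eq plus_ell2.rep_eq uminus_ell2.rep_eq minus_ell2_def
    scaleC_ell2.rep_eq scaleR_ell2_def by simp_all

lemma coord_ket: "coord (ket i) k = (if k = i then 1 else 0)"
  by (simp add: ket.rep_eq)

lemma coord_sum [simp]: "coord (sum f A) i = (\<Sum>a\<in>A. coord (f a) i)"
  by (induction A rule: infinite_finite_induct) auto

lemma norm_coord_le: "cmod (coord f i) \<le> norm f"
  using norm_ell2_sum_le[of "{i}" f] by (simp add: power2_le_iff_abs_le)

lemma norm_ell2_leI:
  assumes "0 \<le> B" "\<And>A. finite A \<Longrightarrow> (\<Sum>i\<in>A. (cmod (coord f i))\<^sup>2) \<le> B\<^sup>2"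
  shows "norm f \<le> B"
proof (rule power2_le_imp_le)
  show "(norm f)\<^sup>2 \<le> B\<^sup>2"
    unfolding norm_ell2_squared by (rule infsum_le_finite_sums[OF summable_ell2]) (use assms in auto)
qed fact

text \<open>Membership in the type is reduced to a bound on finite sums, the form in which all
  operators and vectors below are estimated.\<close>

lemma coord_Abs_ell2:
  assumes "\<And>A. finite A \<Longrightarrow> (\<Sum>i\<in>A. (cmod (f i))\<^sup>2) \<le> (B::real)"
  shows "coord (Abs_ell2 f) = f"
proof (rule Abs_ell2_inverse)
  have "(\<lambda>i. (cmod (f i))\<^sup>2) summable_on UNIV"
    by (rule nonneg_bdd_above_summable_on) (auto intro!: bdd_aboveI2[where M = B] assms)
  then show "f \<in> {f. (\<lambda>i. (cmod (f i))\<^sup>2) summable_on UNIV}" by simp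
qed

lemma cinner_summable: "(\<lambda>i. coord f i * cnj (coord g i)) summable_on UNIV"
proof -
  have "(\<lambda>i. (cmod (coord f i))\<^sup>2 + (cmod (coord g i))\<^sup>2) summable_on UNIV"
    by (intro summable_on_add summable_ell2)
  then have "(\<lambda>i. norm (coord f i * cnj (coord g i))) summable_on UNIV"
  proof (rule Infinite_Sum.abs_summable_on_comparison_test')
    fix i
    show "norm (coord f i * cnj (coord g i)) \<le> (cmod (coord f i))\<^sup>2 + (cmod (coord g i))\<^sup>2"
      using sum_squares_bound[of "cmod (coord f i)" "cmod (coord g i)"]
        mult_nonneg_nonneg[OF norm_ge_zero norm_ge_zero, of "coord f i" "coord g i"]
      unfolding norm_mult complex_mod_cnj by linarith
  qed
  then show ?thesis by (rule abs_summable_summable)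
qed

lemma cinner_commute: "cinner g f = cnj (cinner f g)"
  unfolding cinner.rep_eq by (subst infsum_cnj[symmetric]) (simp add: mult.commute)

lemma cinner_add_left: "cinner (f + g) h = cinner f h + cinner g h"
  unfolding cinner.rep_eq
  by (simp add: distrib_right infsum_add cinner_summable)

lemma cinner_add_right: "cinner f (g + h) = cinner f g + cinner f h"
  by (subst (1 2 3) cinner_commute) (simp add: cinner_add_left)

lemma cinner_scaleC_left: "cinner (c *\<^sub>C f) h = c * cinner f h"
  unfolding cinner.rep_eq by (simp add: mult.assoc infsum_cmult_right')

lemma cinner_self: "cinner f f = complex_of_real ((norm f)\<^sup>2)"
proof -
  have "cinner f f = (\<Sum>\<^sub>\<infinity>i. complex_of_real ((cmod (coord f i))\<^sup>2))"
    unfolding cinner.rep_eq by (simp only: complex_norm_square)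
  also have "\<dots> = complex_of_real ((norm f)\<^sup>2)"
    unfolding norm_ell2_squared
    by (intro infsumI has_sum_of_real has_sum_infsum summable_ell2)
  finally show ?thesis .
qed

lemma norm_ket: "norm (ket i) = (1::real)"
proof -
  have "norm (ket i) ^ 2 = (1::real)"
    using cinner_ket[of "ket i" i] unfolding cinner_self by (simp add: coord_ket flip: of_real_power)
  then have "norm (ket i) = (1::real) \<or> norm (ket i) = (-1::real)" by (simp add: power2_eq_1_iff)
  then show ?thesis using norm_ge_zero[of "ket i"] by linarith
qed

text \<open>The real part of \<open>cinner\<close> induces the same norm; this makes Cauchy-Schwarz
  and the moment theorem for real inner product spaces applicable.\<close>

instantiation ell2 :: (type) real_inner
begin
definition inner_ell2 :: "'a ell2 \<Rightarrow> 'a ell2 \<Rightarrow> real" where "inner_ell2 f g = Re (cinner f g)"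
instance
proof
  fix x y z :: "'a ell2" and r :: real
  show "inner x y = inner y x"
    unfolding inner_ell2_def by (subst cinner_commute) simp
  show "inner (x + y) z = inner x z + inner y z"
    by (simp add: inner_ell2_def cinner_add_left)
  show "inner (r *\<^sub>R x) y = r * inner x y"
    by (simp add: inner_ell2_def scaleR_ell2_def cinner_scaleC_left)
  show "0 \<le> inner x x" "inner x x = 0 \<longleftrightarrow> x = 0" "norm x = sqrt (inner x x)"
    by (simp_all only: inner_ell2_def cinner_self Re_complex_of_real zero_le_power2 zero_eq_power2 norm_eq_zero real_sqrt_abs abs_norm_cancel)
qed
end

text \<open>Completeness is what makes the Neumann series in \<open>resolvent_vector\<close>
  converge.\<close>

instance ell2 :: (type) banach
proof
  fix X :: "nat \<Rightarrow> 'a ell2"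
  assume C: "Cauchy X"
  have "Cauchy (\<lambda>n. coord (X n) i)" for i
  proof (rule metric_CauchyI)
    fix e :: real assume "e > 0"
    then obtain M where "\<forall>m\<ge>M. \<forall>n\<ge>M. dist (X m) (X n) < e" using metric_CauchyD[OF C] by blast
    moreover have "dist (coord (X m) i) (coord (X n) i) \<le> dist (X m) (X n)" for m n
      using norm_coord_le[of "X m - X n" i] by (simp add: dist_norm)
    ultimately show "\<exists>M. \<forall>m\<ge>M. \<forall>n\<ge>M. dist (coord (X m) i) (coord (X n) i) < e"
      by (meson le_less_trans)
  qed
  then have "\<exists>l. (\<lambda>n. coord (X n) i) \<longlonglongrightarrow> l" for i
    using Cauchy_convergent convergent_def by blast
  then obtain l where l: "\<And>i. (\<lambda>n. coord (X n) i) \<longlonglongrightarrow> l i" by metis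
  have close: "\<exists>N. \<forall>n\<ge>N. \<forall>A. finite A \<longrightarrow> (\<Sum>i\<in>A. (cmod (coord (X n) i - l i))\<^sup>2) \<le> e\<^sup>2"
    if e0: "e > 0" for e
  proof -
    obtain N where N: "\<And>m n. m \<ge> N \<Longrightarrow> n \<ge> N \<Longrightarrow> dist (X m) (X n) < e"
      using metric_CauchyD[OF C e0] by blast
    have "(\<Sum>i\<in>A. (cmod (coord (X n) i - l i))\<^sup>2) \<le> e\<^sup>2" if "n \<ge> N" "finite A" for n A
    proof (rule Lim_bounded[of _ _ N])
      show "(\<lambda>m. \<Sum>i\<in>A. (cmod (coord (X n) i - coord (X m) i))\<^sup>2) \<longlonglongrightarrow> (\<Sum>i\<in>A. (cmod (coord (X n) i - l i))\<^sup>2)"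
        by (intro tendsto_intros l)
      show "\<forall>m\<ge>N. (\<Sum>i\<in>A. (cmod (coord (X n) i - coord (X m) i))\<^sup>2) \<le> e\<^sup>2"
      proof (intro allI impI)
        fix m assume "m \<ge> N"
        have "(\<Sum>i\<in>A. (cmod (coord (X n - X m) i))\<^sup>2) \<le> (norm (X n - X m))\<^sup>2"
          by (rule norm_ell2_sum_le[OF that(2)])
        also have "\<dots> \<le> e\<^sup>2"
          using N[OF \<open>n \<ge> N\<close> \<open>m \<ge> N\<close>] by (intro power_mono) (auto simp: dist_norm)
        finally show "(\<Sum>i\<in>A. (cmod (coord (X n) i - coord (X m) i))\<^sup>2) \<le> e\<^sup>2" by simp
      qed
    qed
    then show ?thesis by blast
  qed
  obtain N0 where N0: "\<And>A. finite A \<Longrightarrow> (\<Sum>i\<in>A. (cmod (coord (X N0) i - l i))\<^sup>2) \<le> 1"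
    using close[of 1] by auto
  \<comment> \<open>By \<open>close\<close>, it is the difference of \<open>X N0\<close> and the
    coordinatewise limit that is visibly square-summable; the limit itself is then recovered as
    \<open>X N0 - D\<close>.\<close>
  define D where "D = Abs_ell2 (\<lambda>i. coord (X N0) i - l i)"
  have D: "coord D = (\<lambda>i. coord (X N0) i - l i)"
    unfolding D_def by (rule coord_Abs_ell2[OF N0])
  have "X \<longlonglongrightarrow> X N0 - D"
  proof (rule metric_LIMSEQ_I)
    fix e :: real assume "e > 0"
    obtain N where N: "\<And>n A. n \<ge> N \<Longrightarrow> finite A \<Longrightarrow> (\<Sum>i\<in>A. (cmod (coord (X n) i - l i))\<^sup>2) \<le> (e/2)\<^sup>2"
      using close[of "e/2"] \<open>e > 0\<close> by auto
    have "norm (X n - (X N0 - D)) \<le> e/2" if "n \<ge> N" for n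
      by (rule norm_ell2_leI) (use \<open>e > 0\<close> N[OF that] in \<open>auto simp: D\<close>)
    then show "\<exists>no. \<forall>n\<ge>no. dist (X n) (X N0 - D) < e"
      using \<open>e > 0\<close> by (force simp: dist_norm)
  qed
  then show "convergent X" by (auto simp: convergent_def)
qed

section \<open>The Hausdorff moment problem\<close>

text \<open>An identity of polynomials, because a linear functional on polynomials is going to be
  applied to it. Rewriting the product of binomial coefficients turns it into the binomial theorem
  for \<open>x + (1 - x)\<close>.\<close>

lemma binomial_moment:
  fixes x :: "real poly"
  assumes "j \<le> n"
  shows "(\<Sum>k\<le>n. of_nat (n choose k) * of_nat (k choose j) * x ^ k * (1 - x) ^ (n - k))
    = of_nat (n choose j) * x ^ j"
proof -
  have "(\<Sum>k\<le>n. of_nat (n choose k) * of_nat (k choose j) * x ^ k * (1 - x) ^ (n - k))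
     = (\<Sum>k\<in>{j..n}. of_nat (n choose k) * of_nat (k choose j) * x ^ k * (1 - x) ^ (n - k))"
    by (rule sum.mono_neutral_right) auto
  also have "\<dots> = (\<Sum>k\<in>{j..n}. of_nat (n choose j) * of_nat ((n - j) choose (k - j)) * x ^ k * (1 - x) ^ (n - k))"
  proof (rule sum.cong[OF refl])
    fix k assume "k \<in> {j..n}"
    then have "(n choose k) * (k choose j) = (n choose j) * ((n - j) choose (k - j))"
      using choose_mult[of j k n] by simp
    then show "of_nat (n choose k) * of_nat (k choose j) * x ^ k * (1 - x) ^ (n - k)
       = of_nat (n choose j) * of_nat ((n - j) choose (k - j)) * x ^ k * (1 - x) ^ (n - k)"
      by (metis of_nat_mult)
  qed
  also have "\<dots> = (\<Sum>i\<le>n - j. of_nat (n choose j) * of_nat ((n - j) choose i) * x ^ (i + j) * (1 - x) ^ (n - j - i))"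
    by (rule sum.reindex_bij_witness[of _ "\<lambda>i. i + j" "\<lambda>k. k - j"]) (use assms in auto)
  also have "\<dots> = of_nat (n choose j) * x ^ j * (\<Sum>i\<le>n - j. of_nat ((n - j) choose i) * x ^ i * (1 - x) ^ (n - j - i))"
    by (simp add: sum_distrib_left power_add mult_ac)
  also have "(\<Sum>i\<le>n - j. of_nat ((n - j) choose i) * x ^ i * (1 - x) ^ (n - j - i)) = (x + (1 - x)) ^ (n - j)"
    by (rule binomial_ring[symmetric])
  finally show ?thesis by simp
qed

text \<open>The ratio is the product of \<open>(k - i) / (n - i)\<close> over \<open>i < j\<close>.
  Each factor differs from \<open>k / n\<close> by at most \<open>j / (n - j)\<close>, and since the
  partial products and \<open>k / n\<close> are bounded by 1, the errors add up. This trades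
  factorial moments for powers.\<close>

lemma falling_ratio_close:
  assumes "j < n" "k \<le> n"
  shows "\<bar>real (k choose j) / real (n choose j) - (real k / real n) ^ j\<bar> \<le> real j * (real j / (real n - real j))"
  using assms(1)
proof (induction j)
  case (Suc j)
  let ?a = "\<lambda>j. real (k choose j) / real (n choose j)" and ?t = "real k / real n"
  have jn: "j < n" "0 < real n - real j" "0 < real n - real (Suc j)" using Suc.prems by auto
  have rec: "?a (Suc j) = ?a j * ((real k - real j) / (real n - real j))"
  proof (cases "j \<le> k")
    case True
    have 1: "real (Suc j) * real (m choose Suc j) = real (m choose j) * (real m - real j)" if "j \<le> m" for m
    proof -
      have "Suc j * (m choose Suc j) = (m choose j) * (m - j)"
        by (metis binomial_absorb_comp binomial_absorption mult.commute)
      then have "real (Suc j * (m choose Suc j)) = real ((m choose j) * (m - j))" by (rule arg_cong)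
      then show ?thesis using that by (simp only: of_nat_mult of_nat_diff)
    qed
    have "?a (Suc j) = (real (Suc j) * real (k choose Suc j)) / (real (Suc j) * real (n choose Suc j))"
      by simp
    also have "\<dots> = ?a j * ((real k - real j) / (real n - real j))"
      using jn unfolding 1[OF True] 1[OF less_imp_le[OF jn(1)]] by simp
    finally show ?thesis .
  qed (auto simp: binomial_eq_0)
  have d: "\<bar>(real k - real j) / (real n - real j) - ?t\<bar> \<le> real j / (real n - real j)"
  proof -
    have "(real k - real j) / (real n - real j) - ?t = - (real j / (real n - real j)) * ((real n - real k) / real n)"
      using jn by (simp add: field_simps)
    moreover have "\<bar>(real n - real k) / real n\<bar> \<le> 1" using assms(2) jn by simp
    ultimately show ?thesis using jn
      mult_left_le[of "\<bar>(real n - real k) / real n\<bar>" "real j / (real n - real j)"]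
      by (simp only: abs_mult abs_minus_cancel) (simp add: abs_mult)
  qed
  have a1: "\<bar>?a j\<bar> \<le> 1"
    using assms(2) jn by (simp add: binomial_right_mono divide_le_eq_1)
  have t1: "\<bar>?t\<bar> \<le> 1" using assms(2) jn by simp
  have "?a (Suc j) - ?t ^ Suc j = ?a j * ((real k - real j) / (real n - real j) - ?t) + (?a j - ?t ^ j) * ?t"
    unfolding rec by (simp add: algebra_simps)
  then have "\<bar>?a (Suc j) - ?t ^ Suc j\<bar> \<le> \<bar>?a j\<bar> * \<bar>(real k - real j) / (real n - real j) - ?t\<bar> + \<bar>?a j - ?t ^ j\<bar> * \<bar>?t\<bar>"
    by (metis abs_mult abs_triangle_ineq)
  also have "\<dots> \<le> 1 * (real j / (real n - real j)) + (real j * (real j / (real n - real j))) * 1"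
    using a1 t1 d Suc.IH[OF jn(1)] jn by (intro add_mono mult_mono) auto
  also have "\<dots> = real (Suc j) * (real j / (real n - real j))" by (simp add: algebra_simps add_divide_distrib)
  also have "\<dots> \<le> real (Suc j) * (real (Suc j) / (real n - real (Suc j)))"
    using jn by (intro mult_left_mono frac_le) auto
  finally show ?case .
qed simp

text \<open>Weak convergence is tested on bounded continuous functions. Clamping turns powers into
  such functions and changes nothing on [0, 1], where all the measures live.\<close>

definition clamp01 :: "real \<Rightarrow> real" where "clamp01 x = max 0 (min 1 x)"

text \<open>
  The measure is a weak limit of Bernstein measures, with weight \<open>(n choose k) L(x\<^sup>k(1 - x)\<^sup>n\<^sup>-\<^sup>k)\<close>
  at \<open>k / n\<close>: their factorial moments are exact by \<open>binomial_moment\<close>.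
\<close>

theorem hausdorff_moments:
  fixes L :: "real poly \<Rightarrow> real"
  assumes add: "\<And>p q. L (p + q) = L p + L q" and smult: "\<And>c p. L (smult c p) = c * L p"
    and L1: "L 1 = 1"
    and pos: "\<And>a b. 0 \<le> L ([:0, 1:] ^ a * (1 - [:0, 1:]) ^ b)"
  shows "\<exists>\<mu>. real_distribution \<mu> \<and> (AE x in \<mu>. x \<in> {0..1}) \<and> (\<forall>j. (\<integral>x. x ^ j \<partial>\<mu>) = L ([:0, 1:] ^ j))"
proof -
  let ?X = "[:0, 1:] :: real poly"
  have sum: "L (sum f A) = (\<Sum>a\<in>A. L (f a))" if "finite A" for f and A :: "nat set"
    using that smult[of 0 0] by (induction A) (auto simp: add)
  define wt where "wt n k = (if k \<le> n then real (n choose k) * L (?X ^ k * (1 - ?X) ^ (n - k)) else 0)" for n k :: nat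
  have wt0: "0 \<le> wt n k" for n k by (simp add: wt_def pos)
  have mom: "(\<Sum>k\<le>n. wt n k * real (k choose j)) = real (n choose j) * L (?X ^ j)" if "j \<le> n" for n j
  proof -
    have "(\<Sum>k\<le>n. wt n k * real (k choose j)) = (\<Sum>k\<le>n. L (smult (real (n choose k) * real (k choose j)) (?X ^ k * (1 - ?X) ^ (n - k))))"
      by (intro sum.cong) (auto simp: wt_def smult)
    also have "\<dots> = L (\<Sum>k\<le>n. of_nat (n choose k) * of_nat (k choose j) * ?X ^ k * (1 - ?X) ^ (n - k))"
      by (subst sum) (auto simp: of_nat_poly mult_ac)
    also have "\<dots> = L (smult (real (n choose j)) (?X ^ j))"
      unfolding binomial_moment[OF that] by (simp add: of_nat_poly)
    finally show ?thesis by (simp add: smult)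
  qed
  have wt1: "(\<Sum>k\<le>n. wt n k) = 1" for n
    using mom[of 0 n] L1 by (simp add: one_pCons[symmetric])
  have nn: "(\<integral>\<^sup>+ k. ennreal (wt n k) \<partial>count_space UNIV) = 1" for n
  proof -
    have "(\<integral>\<^sup>+ k. ennreal (wt n k) \<partial>count_space UNIV) = (\<integral>\<^sup>+ k. ennreal (wt n k) \<partial>count_space {..n})"
      by (rule nn_integral_count_space_eq) (auto simp: wt_def)
    also have "\<dots> = (\<Sum>k\<le>n. ennreal (wt n k))" by (simp add: nn_integral_count_space_finite)
    also have "\<dots> = 1" using wt1[of n] wt0 by (simp add: )
    finally show ?thesis .
  qed
  define p where "p n = embed_pmf (wt n)" for n
  have pmf_p: "pmf (p n) k = wt n k" for n k
    unfolding p_def by (rule pmf_embed_pmf[OF wt0 nn])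
  have set_p: "set_pmf (p n) \<subseteq> {..n}" for n
    by (auto simp: set_pmf_eq pmf_p wt_def)
  define \<mu> where "\<mu> n = distr (measure_pmf (p n)) borel (\<lambda>k. real k / real n)" for n
  have rd: "real_distribution (\<mu> n)" for n
    unfolding \<mu>_def by (intro real_distribution.intro prob_space.prob_space_distr measure_pmf.prob_space_axioms real_distribution_axioms.intro) auto
  have int: "integral\<^sup>L (\<mu> n) f = (\<Sum>k\<le>n. wt n k * f (real k / real n))"
    if [measurable]: "f \<in> borel_measurable borel" for n and f :: "real \<Rightarrow> real"
    unfolding \<mu>_def by (subst integral_distr, simp, simp, subst integral_measure_pmf_real[of "{..n}"])
      (use set_p[of n] in \<open>auto simp: pmf_p mult.commute\<close>)
  have AE01: "AE x in \<mu> n. x \<in> {0..1}" for n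
    unfolding \<mu>_def using set_p[of n] by (subst AE_distr_iff) (auto simp: AE_measure_pmf_iff divide_le_eq_1)
  have tight: "tight \<mu>"
    unfolding tight_def
  proof (intro conjI allI impI rd)
    fix e :: real assume "e > 0"
    have "measure (\<mu> n) {-1<..1} > 1 - e" for n
    proof -
      interpret real_distribution "\<mu> n" by (rule rd)
      have "measure (\<mu> n) {-1<..1} = 1"
        using AE01[of n] by (subst prob_eq_1) (auto elim!: eventually_mono)
      then show ?thesis using \<open>e > 0\<close> by simp
    qed
    then show "\<exists>a b. a < b \<and> (\<forall>n. 1 - e < measure (\<mu> n) {a<..b})"
      by (intro exI[of _ "-1"] exI[of _ 1]) auto
  qed
  obtain r M where r: "strict_mono r" and M: "real_distribution M" and w: "weak_conv_m (\<mu> \<circ> id \<circ> r) M"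
    using tight_imp_convergent_subsubsequence[OF tight strict_mono_id] by blast
  interpret M: real_distribution M by fact
  have lim: "(\<lambda>n. integral\<^sup>L (\<mu> (r n)) f) \<longlonglongrightarrow> integral\<^sup>L M f"
    if "\<And>x. isCont f x" "\<And>x. \<bar>f x\<bar> \<le> 1" for f :: "real \<Rightarrow> real"
    using weak_conv_imp_integral_bdd_continuous_conv[of "\<mu> \<circ> id \<circ> r" M f 1] that w rd M by (simp add: o_def)
  have cc: "isCont clamp01 x" for x
    unfolding clamp01_def by (intro continuous_intros)
  have clm[measurable]: "clamp01 \<in> borel_measurable borel"
    unfolding clamp01_def by measurable
  have c01: "\<bar>clamp01 x\<bar> \<le> 1" for x by (auto simp: clamp01_def)
  have cid: "clamp01 x = x" if "x \<in> {0..1}" for x using that by (auto simp: clamp01_def)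
  have cid': "clamp01 (real k / real n) = real k / real n" if "k \<le> n" for k n
    using that by (intro cid) (auto simp: divide_le_eq_1)
  \<comment> \<open>A continuous function bounded by 1 whose zero set is [0, 1]. Its integrals
    against the Bernstein measures are 0, hence also the one against the limit, which puts
    \<open>M\<close> on [0, 1].\<close>
  define g where "g x = min 1 \<bar>x - clamp01 x\<bar>" for x
  have gm[measurable]: "g \<in> borel_measurable borel" unfolding g_def by measurable
  have "isCont g x" for x
    unfolding g_def[abs_def] clamp01_def by (intro continuous_intros)
  then have "(\<lambda>n. integral\<^sup>L (\<mu> (r n)) g) \<longlonglongrightarrow> integral\<^sup>L M g"
    by (rule lim) (auto simp: g_def)
  moreover have "integral\<^sup>L (\<mu> n) g = 0" for n
    unfolding int[OF gm] by (intro sum.neutral) (auto simp: g_def cid')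
  ultimately have "integral\<^sup>L M g = 0"
    by (simp add: LIMSEQ_const_iff)
  moreover have "integrable M g"
    by (rule M.integrable_const_bound[of _ 1]) (auto simp: g_def)
  ultimately have "AE x in M. g x = 0"
    by (subst (asm) integral_nonneg_eq_0_iff_AE) (auto simp: g_def)
  then have AEM: "AE x in M. x \<in> {0..1}"
    by eventually_elim (auto simp: g_def clamp01_def min_def max_def split: if_splits)
  have "(\<integral>x. x ^ j \<partial>M) = L (?X ^ j)" for j
  proof -
    have jm[measurable]: "(\<lambda>x. clamp01 x ^ j) \<in> borel_measurable borel" by measurable
    have "(\<lambda>n. \<integral>x. clamp01 x ^ j \<partial>\<mu> (r n)) \<longlonglongrightarrow> (\<integral>x. clamp01 x ^ j \<partial>M)"
      by (rule lim) (auto intro!: isCont_power cc power_le_one simp: power_abs c01)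
    moreover have "(\<integral>x. clamp01 x ^ j \<partial>M) = (\<integral>x. x ^ j \<partial>M)"
    proof (rule integral_cong_AE)
      show "AE x in M. clamp01 x ^ j = x ^ j" using AEM by eventually_elim (simp only: cid)
    qed auto
    \<comment> \<open>\<open>L (?X ^ j)\<close> is the exact mean of the binomial ratios and the
      integral is the mean of \<open>(k / n) ^ j\<close>, so \<open>falling_ratio_close\<close>
      bounds their distance.\<close>
    moreover have "(\<lambda>n. \<integral>x. clamp01 x ^ j \<partial>\<mu> n) \<longlonglongrightarrow> L (?X ^ j)"
    proof (rule Lim_transform2[OF tendsto_const], rule Lim_null_comparison)
      show "\<forall>\<^sub>F n in sequentially. norm (L (?X ^ j) - (\<integral>x. clamp01 x ^ j \<partial>\<mu> n)) \<le> real j * (real j / (real n - real j))"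
        using eventually_gt_at_top[of j]
      proof eventually_elim
        case (elim n)
        have "L (?X ^ j) = (\<Sum>k\<le>n. wt n k * (real (k choose j) / real (n choose j)))"
          using mom[of j n] elim by (simp add: sum_divide_distrib[symmetric] field_simps)
        moreover have "(\<integral>x. clamp01 x ^ j \<partial>\<mu> n) = (\<Sum>k\<le>n. wt n k * (real k / real n) ^ j)"
          unfolding int[OF jm] by (intro sum.cong) (auto simp: cid')
        ultimately have "norm (L (?X ^ j) - (\<integral>x. clamp01 x ^ j \<partial>\<mu> n))
            = \<bar>\<Sum>k\<le>n. wt n k * (real (k choose j) / real (n choose j) - (real k / real n) ^ j)\<bar>"
          by (simp add: sum_subtractf right_diff_distrib)
        also have "\<dots> \<le> (\<Sum>k\<le>n. wt n k * (real j * (real j / (real n - real j))))"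
          by (rule order_trans[OF sum_abs], intro sum_mono)
            (simp only: abs_mult abs_of_nonneg[OF wt0] atMost_iff, intro mult_left_mono falling_ratio_close elim wt0)
        also have "\<dots> = real j * (real j / (real n - real j))"
          unfolding sum_distrib_right[symmetric] wt1 by simp
        finally show ?case .
      qed
      show "(\<lambda>n. real j * (real j / (real n - real j))) \<longlonglongrightarrow> 0"
        by real_asymp
    qed
    then have "(\<lambda>n. \<integral>x. clamp01 x ^ j \<partial>\<mu> (r n)) \<longlonglongrightarrow> L (?X ^ j)"
      using LIMSEQ_subseq_LIMSEQ[OF _ r] by (fastforce simp: o_def)
    ultimately show ?thesis using LIMSEQ_unique by metis
  qed
  then show ?thesis using M AEM by blast
qed

section \<open>Distributions of self-adjoint operators\<close>

lemma selfadjoint_bounded_linear: "selfadjoint A \<Longrightarrow> bounded_linear A"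
  by (simp add: selfadjoint_def bounded_clinear_def)

lemma selfadjoint_inner: "selfadjoint A \<Longrightarrow> inner (A u) v = inner u (A v)"
  by (simp add: selfadjoint_def inner_ell2_def)

lemma selfadjoint_cinner_funpow: "selfadjoint A \<Longrightarrow> cinner ((A ^^ n) u) v = cinner u ((A ^^ n) v)"
  by (induction n arbitrary: u v) (simp_all add: selfadjoint_def funpow_swap1)

lemma selfadjoint_cinner_real:
  assumes "selfadjoint A"
  shows "complex_of_real (inner ((A ^^ n) v) v) = cinner ((A ^^ n) v) v"
proof -
  have "cinner ((A ^^ n) v) v = cnj (cinner ((A ^^ n) v) v)"
    using selfadjoint_cinner_funpow[OF assms, of n v v] cinner_commute by metis
  then show ?thesis
    by (simp add: inner_ell2_def complex_eq_iff)
qed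

text \<open>The vector \<open>p(S) v\<close>, in Horner form so that induction over
  \<open>pCons\<close> unfolds it.\<close>

definition poly_act :: "('a::real_vector \<Rightarrow> 'a) \<Rightarrow> real poly \<Rightarrow> 'a \<Rightarrow> 'a" where
  "poly_act S p v = fold_coeffs (\<lambda>a r. a *\<^sub>R v + S r) p 0"

locale bounded_selfadjoint =
  fixes S :: "'a::real_inner \<Rightarrow> 'a"
  assumes linear: "linear S" and sym: "inner (S u) v = inner u (S v)"
begin

lemma act_0 [simp]: "poly_act S 0 v = 0"
  by (simp add: poly_act_def)

lemma act_pCons [simp]: "poly_act S (pCons a p) v = a *\<^sub>R v + S (poly_act S p v)"
  by (cases "p = 0 \<and> a = 0") (auto simp: poly_act_def linear_0[OF linear])

lemma act_add: "poly_act S (p + q) v = poly_act S p v + poly_act S q v"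
  by (induction p q rule: poly_induct2) (simp_all add: linear_add[OF linear] algebra_simps)

lemma act_smult: "poly_act S (smult c p) v = c *\<^sub>R poly_act S p v"
  by (induction p) (simp_all add: linear_scale[OF linear] algebra_simps)

lemma act_mult: "poly_act S (p * q) v = poly_act S p (poly_act S q v)"
  by (induction p) (simp_all add: act_add act_smult)

lemma act_1 [simp]: "poly_act S 1 v = v"
  by (simp add: one_pCons linear_0[OF linear])

lemma act_X_power: "poly_act S ([:0, 1:] ^ n) v = (S ^^ n) v"
  by (induction n) (simp_all add: act_mult linear_0[OF linear])

lemma act_commute: "poly_act S p (S v) = S (poly_act S p v)"
  by (induction p) (simp_all add: linear_add[OF linear] linear_scale[OF linear] linear_0[OF linear])

lemma act_sym: "inner (poly_act S p u) v = inner u (poly_act S p v)"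
proof (induction p arbitrary: v)
  case (pCons a p)
  have "inner (S (poly_act S p u)) v = inner u (poly_act S p (S v))"
    using pCons.IH by (simp add: sym)
  then show ?case by (simp add: inner_simps act_commute)
qed simp

lemma act_square_pos: "0 \<le> inner (poly_act S (p * p) v) v"
  unfolding act_mult by (subst act_sym) simp

end

text \<open>The functional \<open>p \<mapsto> \<langle>p(S) v, v\<rangle>\<close> is nonnegative on
  \<open>X^a (1 - X)^b\<close>: splitting off even powers leaves a square \<open>q * q\<close> times
  one of 1, X, 1 - X, X(1 - X), and \<open>0 \<le> S \<le> 1\<close> covers the factors X and 1 -
  X.\<close>

theorem bounded_selfadjoint_01_moments:
  fixes S :: "'a::real_inner \<Rightarrow> 'a"
  assumes "bounded_selfadjoint S" and v: "norm v = 1"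
    and pos: "\<And>u. 0 \<le> inner (S u) u" "\<And>u. inner (S u) u \<le> inner u u"
  shows "\<exists>\<mu>. real_distribution \<mu> \<and> (AE x in \<mu>. x \<in> {0..1}) \<and>
    (\<forall>j. (\<integral>x. x ^ j \<partial>\<mu>) = inner ((S ^^ j) v) v)"
proof -
  interpret bounded_selfadjoint S by fact
  let ?X = "[:0, 1:] :: real poly"
  define L where "L p = inner (poly_act S p v) v" for p
  have X: "poly_act S ?X u = S u" for u by (simp add: linear_0[OF linear])
  have X_pos: "0 \<le> L (p * p * ?X)" for p
  proof -
    have "L (p * p * ?X) = L (p * (?X * p))" by (simp only: mult_ac)
    also have "\<dots> = inner (S (poly_act S p v)) (poly_act S p v)"
      unfolding L_def act_mult X by (subst act_sym) simp
    finally show ?thesis using pos(1) by simp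
  qed
  have one_minus_X_pos: "0 \<le> L (p * p * (1 - ?X))" for p
  proof -
    have "p * p * (1 - ?X) + p * p * ?X = p * p" by (simp add: algebra_simps)
    then have "L (p * p * (1 - ?X)) + L (p * p * ?X) = L (p * p)"
      unfolding L_def by (simp only: act_add[symmetric] inner_add_left[symmetric])
    moreover have "L (p * p * ?X) = inner (S (poly_act S p v)) (poly_act S p v)"
    proof -
      have "L (p * p * ?X) = L (p * (?X * p))" by (simp only: mult_ac)
      also have "\<dots> = inner (S (poly_act S p v)) (poly_act S p v)"
        unfolding L_def act_mult X by (subst act_sym) simp
      finally show ?thesis .
    qed
    moreover have "L (p * p) = inner (poly_act S p v) (poly_act S p v)"
      unfolding L_def act_mult by (subst act_sym) simp
    ultimately show ?thesis using pos(2)[of "poly_act S p v"] by simp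
  qed
  have add: "L (p + q) = L p + L q" for p q
    by (simp add: L_def act_add inner_add_left)
  have main: "0 \<le> L (?X ^ a * (1 - ?X) ^ b)" for a b
  proof -
    define q where "q = ?X ^ (a div 2) * (1 - ?X) ^ (b div 2)"
    have "?X ^ a = ?X ^ (2 * (a div 2) + a mod 2)" "(1 - ?X) ^ b = (1 - ?X) ^ (2 * (b div 2) + b mod 2)"
      by simp_all
    then have eq: "?X ^ a * (1 - ?X) ^ b = q * q * (?X ^ (a mod 2) * (1 - ?X) ^ (b mod 2))"
      unfolding q_def power_add power_mult power2_eq_square by (simp only: power_mult_distrib mult_ac)
    \<comment> \<open>The one case that is not a square times X or 1 - X: X(1 - X) = X^2 (1 - X) +
      (1 - X)^2 X writes it as a sum of two that are.\<close>
    have Y: "q * q * (?X * (1 - ?X)) = (q * ?X) * (q * ?X) * (1 - ?X) + (q * (1 - ?X)) * (q * (1 - ?X)) * ?X"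
      by algebra
    consider "a mod 2 = 0" "b mod 2 = 0" | "a mod 2 = 0" "b mod 2 = 1" | "a mod 2 = 1" "b mod 2 = 0"
      | "a mod 2 = 1" "b mod 2 = 1" by linarith
    then show ?thesis
    proof cases
      case 1 then show ?thesis unfolding eq using act_square_pos[of q v] by (simp add: L_def)
    next
      case 2 then show ?thesis unfolding eq using one_minus_X_pos[of q] by simp
    next
      case 3 then show ?thesis unfolding eq using X_pos[of q] by simp
    next
      case 4
      then have "L (?X ^ a * (1 - ?X) ^ b) = L ((q * ?X) * (q * ?X) * (1 - ?X)) + L ((q * (1 - ?X)) * (q * (1 - ?X)) * ?X)"
        unfolding eq by (simp only: power_one_right Y add)
      then show ?thesis using one_minus_X_pos[of "q * ?X"] X_pos[of "q * (1 - ?X)"] by linarith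
    qed
  qed
  have "L 1 = 1" using v by (simp add: L_def dot_square_norm)
  moreover have "L (smult c p) = c * L p" for c p by (simp add: L_def act_smult)
  ultimately obtain \<mu> where "real_distribution \<mu>" "AE x in \<mu>. x \<in> {0..1}"
    "\<And>j. (\<integral>x. x ^ j \<partial>\<mu>) = L (?X ^ j)"
    using hausdorff_moments[of L, OF add _ _ main] by blast
  then show ?thesis unfolding L_def act_X_power by blast
qed

text \<open>With \<open>c\<close> a bound for the operator, (1 + A/c)/2 lies between 0 and 1 as a
  quadratic form. The moment theorem gives its distribution on [0, 1], and an affine image of that
  measure serves A.\<close>

theorem has_distribution_exists:
  fixes A :: "'a ell2 \<Rightarrow> 'a ell2"
  assumes A: "selfadjoint A" and v: "norm v = 1"
  shows "\<exists>\<rho>. has_distribution A v \<rho>"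
proof -
  obtain c where c: "0 < c" "\<And>u. norm (A u) \<le> norm u * c"
    using bounded_linear.pos_bounded[OF selfadjoint_bounded_linear[OF A]] by blast
  define S where "S u = (1/2) *\<^sub>R u + (1 / (2 * c)) *\<^sub>R A u" for u
  have lA: "linear A" using selfadjoint_bounded_linear[OF A] by (rule bounded_linear.linear)
  have S: "bounded_selfadjoint S"
  proof (rule bounded_selfadjoint.intro)
    show "linear S"
      by (rule linearI) (simp_all add: S_def linear_add[OF lA] linear_scale[OF lA] algebra_simps)
    show "inner (S u) w = inner u (S w)" for u w
      by (simp add: S_def inner_simps selfadjoint_inner[OF A])
  qed
  interpret bounded_selfadjoint S by (rule S)
  have "\<bar>inner (A u) u\<bar> \<le> c * inner u u" for u
  proof -
    have "\<bar>inner (A u) u\<bar> \<le> norm (A u) * norm u" by (rule Cauchy_Schwarz_ineq2)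
    also have "\<dots> \<le> (norm u * c) * norm u" by (intro mult_right_mono c) auto
    finally show ?thesis by (simp add: dot_square_norm power2_eq_square mult_ac)
  qed
  then have *: "- inner (A u) u \<le> c * inner u u" "inner (A u) u \<le> c * inner u u" for u
    by (simp_all add: abs_le_iff minus_le_iff)
  have "0 \<le> inner (S u) u" "inner (S u) u \<le> inner u u" for u
    using *[of u] c(1) by (simp_all add: S_def inner_simps field_simps)
  from bounded_selfadjoint_01_moments[OF S v this]
  obtain \<mu> where rd: "real_distribution \<mu>" and AE: "AE x in \<mu>. x \<in> {0..1}"
    and mom: "\<And>j. (\<integral>x. x ^ j \<partial>\<mu>) = inner ((S ^^ j) v) v" by blast
  interpret \<mu>: real_distribution \<mu> by fact
  have int: "integrable \<mu> (\<lambda>x. poly p x)" for p :: "real poly"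
  proof -
    have "integrable \<mu> (\<lambda>x. x ^ n)" for n
    proof (rule \<mu>.integrable_const_bound[of _ 1])
      show "AE x in \<mu>. norm (x ^ n) \<le> 1" using AE by eventually_elim (auto simp: power_le_one)
    qed auto
    then show ?thesis unfolding poly_altdef by auto
  qed
  have mom_poly: "(\<integral>x. poly p x \<partial>\<mu>) = inner (poly_act S p v) v" for p
  proof -
    have xi: "integrable \<mu> (\<lambda>x. x ^ n)" for n using int[of "monom 1 n"] by (simp add: poly_monom)
    have s: "poly_act S (sum f B) v = (\<Sum>b\<in>B. poly_act S (f b) v)" for f and B :: "nat set"
      by (induction B rule: infinite_finite_induct) (auto simp: act_add)
    have "(\<integral>x. poly p x \<partial>\<mu>) = (\<Sum>i\<le>degree p. coeff p i * inner ((S ^^ i) v) v)"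
      unfolding poly_altdef using xi by (simp add: mom)
    also have "\<dots> = inner (poly_act S (\<Sum>i\<le>degree p. monom (coeff p i) i) v) v"
      by (simp add: s inner_sum_left monom_altdef act_smult act_X_power)
    finally show ?thesis by (simp add: poly_as_sum_of_monoms)
  qed
  \<comment> \<open>The inverse of the rescaling, A = 2cS - c; it maps [0, 1] onto [-c, c].\<close>
  let ?q = "[:-c, 2 * c:]"
  define \<rho> where "\<rho> = distr \<mu> borel (poly ?q)"
  have q[measurable]: "poly ?q \<in> borel_measurable \<mu>"
    unfolding measurable_cong_sets[OF \<mu>.events_eq_borel refl]
    by (intro borel_measurable_continuous_onI continuous_intros)
  have "poly_act S ?q u = A u" for u
    using c(1) by (simp add: linear_0[OF linear] linear_scale[OF linear]) (simp add: S_def algebra_simps)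
  then have "poly_act S (?q ^ n) v = (A ^^ n) v" for n
    by (induction n) (simp, simp only: power_Suc act_mult funpow.simps o_apply)
  then have "(\<integral>x. poly ?q x ^ n \<partial>\<mu>) = inner ((A ^^ n) v) v" for n
    using mom_poly[of "?q ^ n"] by (simp only: poly_power)
  then have mr: "(\<integral>x. x ^ n \<partial>\<rho>) = inner ((A ^^ n) v) v" for n
    unfolding \<rho>_def by (subst integral_distr[OF q]) simp_all
  have rr: "real_distribution \<rho>"
    unfolding \<rho>_def by (intro real_distribution.intro \<mu>.prob_space_distr real_distribution_axioms.intro) auto
  interpret \<rho>: real_distribution \<rho> by (rule rr)
  have "AE x in \<rho>. x \<in> {-c..c}"
  proof -
    have "AE x in \<mu>. poly ?q x \<in> {-c..c}"
      using AE by eventually_elim (use c(1) in \<open>auto simp: mult_left_le_one_le\<close>)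
    then show ?thesis
      unfolding \<rho>_def by (subst AE_distr_iff) auto
  qed
  then have "measure \<rho> {-c..c} = 1"
    by (subst \<rho>.prob_eq_1) auto
  then have "compactly_supported \<rho>"
    unfolding compactly_supported_def by (intro exI[of _ "{-c..c}"]) auto
  then show ?thesis
    unfolding has_distribution_def using rr mr selfadjoint_cinner_real[OF A] by auto
qed

section \<open>Realisation of a distribution by a Jacobi operator\<close>

text \<open>A weighted composition operator, the common form of the diagonal and the two shifts of a
  Jacobi matrix. Boundedness requires \<open>\<pi>\<close> to be injective only where the weight is
  nonzero, which admits the downward shift although it sends two indices to 0.\<close>

definition wcomp :: "('a \<Rightarrow> real) \<Rightarrow> ('a \<Rightarrow> 'b) \<Rightarrow> 'b ell2 \<Rightarrow> 'a ell2" where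
  "wcomp c \<pi> f = Abs_ell2 (\<lambda>k. complex_of_real (c k) * coord f (\<pi> k))"

lemma wcomp_sum_le:
  assumes "inj_on \<pi> {k. c k \<noteq> 0}" "\<And>k. \<bar>c k\<bar> \<le> C" "finite A"
  shows "(\<Sum>k\<in>A. (cmod (complex_of_real (c k) * coord f (\<pi> k)))\<^sup>2) \<le> (C * norm f)\<^sup>2"
proof -
  let ?A = "{k \<in> A. c k \<noteq> 0}"
  have "(\<Sum>k\<in>A. (cmod (complex_of_real (c k) * coord f (\<pi> k)))\<^sup>2)
      = (\<Sum>k\<in>?A. (cmod (complex_of_real (c k) * coord f (\<pi> k)))\<^sup>2)"
    by (rule sum.mono_neutral_right) (use assms(3) in auto)
  also have "\<dots> \<le> (\<Sum>k\<in>?A. C\<^sup>2 * (cmod (coord f (\<pi> k)))\<^sup>2)"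
    using power_mono[OF assms(2) abs_ge_zero, where n = 2, unfolded power2_abs]
    by (intro sum_mono) (auto simp: norm_mult power_mult_distrib intro!: mult_right_mono)
  also have "\<dots> = C\<^sup>2 * (\<Sum>l\<in>\<pi> ` ?A. (cmod (coord f l))\<^sup>2)"
    by (subst sum.reindex) (auto simp: sum_distrib_left intro: inj_on_subset[OF assms(1)])
  also have "\<dots> \<le> C\<^sup>2 * (norm f)\<^sup>2"
    using assms(3) by (intro mult_left_mono norm_ell2_sum_le) auto
  finally show ?thesis by (simp add: power_mult_distrib)
qed

lemma coord_wcomp:
  assumes "inj_on \<pi> {k. c k \<noteq> 0}" "\<And>k. \<bar>c k\<bar> \<le> C"
  shows "coord (wcomp c \<pi> f) k = complex_of_real (c k) * coord f (\<pi> k)"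
  unfolding wcomp_def by (subst coord_Abs_ell2[OF wcomp_sum_le[OF assms]]) auto

lemma bounded_clinearI:
  assumes "\<And>u v. A (u + v) = A u + A v" "\<And>c v. A (c *\<^sub>C v) = c *\<^sub>C A v" "\<And>v. norm (A v) \<le> norm v * C"
  shows "bounded_clinear A"
  unfolding bounded_clinear_def using assms
  by (auto intro!: bounded_linear_intro[where K = C] simp: scaleR_ell2_def)

lemma bounded_clinear_wcomp:
  assumes "inj_on \<pi> {k. c k \<noteq> 0}" "\<And>k. \<bar>c k\<bar> \<le> C" "0 \<le> C"
  shows "bounded_clinear (wcomp c \<pi>)"
proof (rule bounded_clinearI[where C = C])
  note * = coord_wcomp[OF assms(1,2)]
  show "wcomp c \<pi> (u + v) = wcomp c \<pi> u + wcomp c \<pi> v" for u v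
    by (rule ell2_eqI) (simp add: * distrib_left)
  show "wcomp c \<pi> (r *\<^sub>C v) = r *\<^sub>C wcomp c \<pi> v" for r v
    by (rule ell2_eqI) (simp add: * mult_ac)
  show "norm (wcomp c \<pi> f) \<le> norm f * C" for f
    using wcomp_sum_le[OF assms(1,2)] assms(3)
    by (intro norm_ell2_leI) (auto simp: * mult.commute)
qed

lemma bounded_clinear_add: "bounded_clinear A \<Longrightarrow> bounded_clinear B \<Longrightarrow> bounded_clinear (\<lambda>v. A v + B v)"
  unfolding bounded_clinear_def
  by (auto intro: bounded_linear_add intro!: ell2_eqI simp: distrib_left)

lemma selfadjoint_zero: "selfadjoint (\<lambda>_. 0)"
  by (auto simp: selfadjoint_def bounded_clinear_def cinner.rep_eq intro!: ell2_eqI)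

lemma selfadjoint_add: "selfadjoint A \<Longrightarrow> selfadjoint B \<Longrightarrow> selfadjoint (\<lambda>v. A v + B v)"
  unfolding selfadjoint_def by (simp add: bounded_clinear_add cinner_add_left cinner_add_right)

text \<open>The adjoint composes with the inverse bijection and carries the weight along: reindexing
  the sum by \<open>\<pi>\<close> moves the operator to the other argument.\<close>

lemma cinner_wcomp:
  assumes "bij_betw \<pi> {k. c k \<noteq> 0} {l. d l \<noteq> 0}" "\<And>k. c k \<noteq> 0 \<Longrightarrow> \<sigma> (\<pi> k) = k \<and> d (\<pi> k) = c k"
    and "\<And>k. \<bar>c k\<bar> \<le> C" "\<And>k. \<bar>d k\<bar> \<le> C"
  shows "cinner (wcomp c \<pi> f) g = cinner f (wcomp d \<sigma> g)"
proof -
  have \<sigma>: "inj_on \<sigma> {l. d l \<noteq> 0}"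
  proof -
    have "inj_on \<sigma> (\<pi> ` {k. c k \<noteq> 0})" using assms(2) by (auto intro!: inj_onI)
    then show ?thesis using assms(1) by (simp add: bij_betw_def)
  qed
  have 1: "inj_on \<pi> {k. c k \<noteq> 0}" using assms(1) by (simp add: bij_betw_def)
  have "cinner (wcomp c \<pi> f) g = (\<Sum>\<^sub>\<infinity>k\<in>{k. c k \<noteq> 0}. complex_of_real (c k) * coord f (\<pi> k) * cnj (coord g k))"
    unfolding cinner.rep_eq coord_wcomp[OF 1 assms(3)] by (rule infsum_cong_neutral) auto
  also have "\<dots> = (\<Sum>\<^sub>\<infinity>k\<in>{k. c k \<noteq> 0}. complex_of_real (d (\<pi> k)) * coord f (\<pi> k) * cnj (coord g (\<sigma> (\<pi> k))))"
    by (rule infsum_cong) (use assms(2) in auto)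
  also have "\<dots> = (\<Sum>\<^sub>\<infinity>l\<in>{l. d l \<noteq> 0}. complex_of_real (d l) * coord f l * cnj (coord g (\<sigma> l)))"
    by (rule infsum_reindex_bij_betw[OF assms(1)])
  also have "\<dots> = cinner f (wcomp d \<sigma> g)"
    unfolding cinner.rep_eq coord_wcomp[OF \<sigma> assms(4)] by (rule infsum_cong_neutral) auto
  finally show ?thesis .
qed

primrec idx :: "nat option \<Rightarrow> nat" where
  "idx None = 0" | "idx (Some n) = Suc n"

definition unidx :: "nat \<Rightarrow> nat option" where
  "unidx n = (case n of 0 \<Rightarrow> None | Suc m \<Rightarrow> Some m)"

lemma unidx_simps [simp]: "unidx 0 = None" "unidx (Suc n) = Some n" "unidx (idx k) = k" "idx (unidx n) = n"
  by (auto simp: unidx_def split: nat.splits) (cases k; simp)+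

text \<open>The tridiagonal matrix with diagonal \<open>\<beta>\<close>, where
  \<open>\<alpha> n\<close> couples the indices \<open>n - 1\<close> and \<open>n\<close>. At index
  0 the truncated \<open>idx k - 1\<close> points back to 0; the convention
  \<open>\<alpha> 0 = 0\<close> removes this spurious term.\<close>

definition jacobi :: "(nat \<Rightarrow> real) \<Rightarrow> (nat \<Rightarrow> real) \<Rightarrow> nat option ell2 \<Rightarrow> nat option ell2" where
  "jacobi \<alpha> \<beta> f = wcomp (\<lambda>k. \<beta> (idx k)) id f +
     (wcomp (\<lambda>k. \<alpha> (Suc (idx k))) (\<lambda>k. unidx (Suc (idx k))) f +
      wcomp (\<lambda>k. \<alpha> (idx k)) (\<lambda>k. unidx (idx k - 1)) f)"

context
  fixes \<alpha> \<beta> :: "nat \<Rightarrow> real" and C :: real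
  assumes bound: "\<And>n. \<bar>\<alpha> n\<bar> \<le> C" "\<And>n. \<bar>\<beta> n\<bar> \<le> C" and \<alpha>0: "\<alpha> 0 = 0"
begin

lemma jacobi_idx_pos:
  assumes "\<alpha> (idx k) \<noteq> 0"
  obtains n where "k = Some n" "\<alpha> (Suc n) \<noteq> 0"
  using \<alpha>0 assms by (cases k) auto

lemma jacobi_inj_id: "inj_on id {k. \<beta> (idx k) \<noteq> 0}" by simp
lemma jacobi_inj_up: "inj_on (\<lambda>k. unidx (Suc (idx k))) {k. \<alpha> (Suc (idx k)) \<noteq> 0}"
  by (rule inj_onI) (metis option.inject unidx_simps(2,3))
lemma jacobi_inj_down: "inj_on (\<lambda>k. unidx (idx k - 1)) {k. \<alpha> (idx k) \<noteq> 0}"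
  by (rule inj_onI) (auto elim!: jacobi_idx_pos dest: arg_cong[of _ _ idx])

lemma coord_jacobi:
  "coord (jacobi \<alpha> \<beta> f) (unidx n) = \<beta> n * coord f (unidx n) + \<alpha> (Suc n) * coord f (unidx (Suc n))
     + \<alpha> n * coord f (unidx (n - 1))"
  unfolding jacobi_def
  by (simp add: coord_wcomp[OF jacobi_inj_id bound(2)] coord_wcomp[OF jacobi_inj_up bound(1)] coord_wcomp[OF jacobi_inj_down bound(1)]
      del: unidx_simps(2) One_nat_def)

lemma selfadjoint_jacobi: "selfadjoint (jacobi \<alpha> \<beta>)"
proof -
  have C: "0 \<le> C" using bound(1)[of 0] by linarith
  have "bounded_clinear (jacobi \<alpha> \<beta>)"
    unfolding jacobi_def[abs_def]
    by (intro bounded_clinear_add bounded_clinear_wcomp[OF jacobi_inj_id bound(2) C]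
        bounded_clinear_wcomp[OF jacobi_inj_up bound(1) C] bounded_clinear_wcomp[OF jacobi_inj_down bound(1) C])
  moreover have "cinner (jacobi \<alpha> \<beta> u) v = cinner u (jacobi \<alpha> \<beta> v)" for u v
  proof -
    have bij: "bij_betw (\<lambda>k. unidx (Suc (idx k))) {k. \<alpha> (Suc (idx k)) \<noteq> 0} {k. \<alpha> (idx k) \<noteq> 0}"
      by (rule bij_betwI[of _ _ _ "\<lambda>k. unidx (idx k - 1)"]) (auto elim!: jacobi_idx_pos)
    have bij': "bij_betw (\<lambda>k. unidx (idx k - 1)) {k. \<alpha> (idx k) \<noteq> 0} {k. \<alpha> (Suc (idx k)) \<noteq> 0}"
      by (rule bij_betwI[of _ _ _ "\<lambda>k. unidx (Suc (idx k))"]) (auto elim!: jacobi_idx_pos)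
    have "cinner (wcomp (\<lambda>k. \<beta> (idx k)) id u) v = cinner u (wcomp (\<lambda>k. \<beta> (idx k)) id v)"
      by (rule cinner_wcomp[where C = C]) (auto simp: bound)
    moreover have "cinner (wcomp (\<lambda>k. \<alpha> (Suc (idx k))) (\<lambda>k. unidx (Suc (idx k))) u) v
        = cinner u (wcomp (\<lambda>k. \<alpha> (idx k)) (\<lambda>k. unidx (idx k - 1)) v)"
      by (rule cinner_wcomp[OF bij, where C = C]) (auto simp: bound simp del: unidx_simps(2))
    moreover have "cinner (wcomp (\<lambda>k. \<alpha> (idx k)) (\<lambda>k. unidx (idx k - 1)) u) v
        = cinner u (wcomp (\<lambda>k. \<alpha> (Suc (idx k))) (\<lambda>k. unidx (Suc (idx k))) v)"
      by (rule cinner_wcomp[OF bij', where C = C]) (auto simp: bound elim!: jacobi_idx_pos)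
    ultimately show ?thesis
      unfolding jacobi_def by (simp add: cinner_add_left cinner_add_right)
  qed
  ultimately show ?thesis by (simp add: selfadjoint_def)
qed

end

section \<open>Orthogonal polynomials of a compactly supported measure\<close>

locale compact_distribution = real_distribution M for M +
  fixes R :: real
  assumes R_pos: "0 < R" and AE_R: "AE x in M. \<bar>x\<bar> \<le> R"
begin

lemma integrable_continuous:
  fixes f :: "real \<Rightarrow> 'b::euclidean_space"
  assumes "continuous_on UNIV f"
  shows "integrable M f"
proof -
  have "compact (f ` {-R..R})"
    by (intro compact_continuous_image continuous_on_subset[OF assms]) auto
  then have "bounded (f ` {-R..R})" by (rule compact_imp_bounded)
  then obtain B where B: "\<forall>y\<in>f ` {-R..R}. norm y \<le> B"
    unfolding bounded_iff by blast
  show ?thesis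
  proof (rule integrable_const_bound[of _ B])
    show "AE x in M. norm (f x) \<le> B" using AE_R by eventually_elim (auto intro!: B[rule_format] imageI simp: abs_le_iff)
    show "f \<in> borel_measurable M"
      unfolding measurable_cong_sets[OF events_eq_borel refl] by (rule borel_measurable_continuous_onI[OF assms])
  qed
qed

end

lemma compact_distributionI:
  assumes "real_distribution \<mu>" "compactly_supported \<mu>"
  obtains R where "compact_distribution \<mu> R"
proof -
  interpret real_distribution \<mu> by fact
  obtain S where S: "compact S" "measure \<mu> S = 1" using assms(2) by (auto simp: compactly_supported_def)
  obtain B where B: "0 < B" "\<And>x. x \<in> S \<Longrightarrow> norm x \<le> B"
    using compact_imp_bounded[OF S(1)] by (auto simp: bounded_pos)
  have "AE x in \<mu>. x \<in> S"
    using S by (subst prob_eq_1[symmetric]) (auto simp: borel_compact)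
  then have "AE x in \<mu>. \<bar>x\<bar> \<le> B" by eventually_elim (use B in auto)
  then have "compact_distribution \<mu> B"
    using B(1) by unfold_locales
  then show thesis by (rule that)
qed

text \<open>
  The state after \<open>n\<close> steps of the three-term recurrence is \<open>(P\<^sub>n\<^sub>-\<^sub>1, P\<^sub>n, \<alpha>\<^sub>n)\<close>.  If the support of the
  measure is finite, then some \<open>\<alpha>\<^sub>n\<close> vanishes, and as \<open>x / 0 = 0\<close> all later polynomials are \<open>0\<close>.
\<close>

primrec orth_poly_state :: "real measure \<Rightarrow> nat \<Rightarrow> (real \<Rightarrow> real) \<times> (real \<Rightarrow> real) \<times> real" where
  "orth_poly_state M 0 = (\<lambda>_. 0, \<lambda>_. 1, 0)"
| "orth_poly_state M (Suc n) = (case orth_poly_state M n of (u, p, a) \<Rightarrow>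
     let b = (\<integral>x. x * p x * p x \<partial>M); q = (\<lambda>x. x * p x - b * p x - a * u x); a' = sqrt (\<integral>x. q x * q x \<partial>M)
     in (p, \<lambda>x. q x / a', a'))"

context compact_distribution
begin

definition orth_poly :: "nat \<Rightarrow> real \<Rightarrow> real" where "orth_poly n = fst (snd (orth_poly_state M n))"
definition jacobi_off :: "nat \<Rightarrow> real" where "jacobi_off n = snd (snd (orth_poly_state M n))"
definition jacobi_diag :: "nat \<Rightarrow> real" where "jacobi_diag n = (\<integral>x. x * orth_poly n x * orth_poly n x \<partial>M)"
text \<open>At \<open>n = 0\<close> the predecessor \<open>n - 1\<close> is again 0, whereas
  \<open>orth_poly_state\<close> starts from the zero function. The two versions agree because
  \<open>jacobi_off 0 = 0\<close>.\<close>

definition orth_residual :: "nat \<Rightarrow> real \<Rightarrow> real" where "orth_residual n x = x * orth_poly n x - jacobi_diag n * orth_poly n x - jacobi_off n * orth_poly (n - 1) x"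
definition l2_ip :: "(real \<Rightarrow> real) \<Rightarrow> (real \<Rightarrow> real) \<Rightarrow> real" where "l2_ip f g = (\<integral>x. f x * g x \<partial>M)"

lemma orth_poly_0: "orth_poly 0 = (\<lambda>_. 1)" and jacobi_off_0: "jacobi_off 0 = 0"
  by (simp_all add: orth_poly_def jacobi_off_def)

lemma jacobi_off_Suc: "jacobi_off (Suc n) = sqrt (l2_ip (orth_residual n) (orth_residual n))" and orth_poly_Suc: "orth_poly (Suc n) = (\<lambda>x. orth_residual n x / jacobi_off (Suc n))"
proof -
  have prev: "jacobi_off n * fst (orth_poly_state M n) x = jacobi_off n * orth_poly (n - 1) x" for x
    by (cases n) (simp_all add: jacobi_off_0, simp add: orth_poly_def Let_def split: prod.splits)
  show 1: "jacobi_off (Suc n) = sqrt (l2_ip (orth_residual n) (orth_residual n))"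
    unfolding l2_ip_def orth_residual_def prev[symmetric] jacobi_diag_def unfolding jacobi_off_def orth_poly_def
    by (simp add: Let_def split_beta)
  show "orth_poly (Suc n) = (\<lambda>x. orth_residual n x / jacobi_off (Suc n))"
    unfolding orth_residual_def prev[symmetric] jacobi_diag_def unfolding jacobi_off_def orth_poly_def
    by (simp add: Let_def split_beta)
qed

lemma continuous_orth_poly: "continuous_on UNIV (orth_poly n)" and continuous_orth_residual: "continuous_on UNIV (orth_residual n)"
proof -
  have "\<forall>m\<le>n. continuous_on UNIV (orth_poly m)" for n
  proof (induction n)
    case (Suc n)
    have "continuous_on UNIV (orth_poly (Suc n))"
      unfolding orth_poly_Suc orth_residual_def divide_inverse using Suc by (intro continuous_intros) auto
    then show ?case using Suc le_Suc_eq by auto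
  qed (simp add: orth_poly_0)
  then show *: "continuous_on UNIV (orth_poly n)" for n by blast
  show "continuous_on UNIV (orth_residual n)"
    unfolding orth_residual_def[abs_def] by (intro continuous_intros *)
qed

lemma l2_ip_commute: "l2_ip f g = l2_ip g f"
  by (simp add: l2_ip_def mult.commute)

text \<open>Clear by definition if \<open>jacobi_off (Suc n)\<close> is nonzero. Otherwise the
  residual has norm 0, hence vanishes almost everywhere, and both sides are 0.\<close>

lemma l2_ip_residual:
  assumes g: "continuous_on UNIV g"
  shows "jacobi_off (Suc n) * l2_ip (orth_poly (Suc n)) g = l2_ip (orth_residual n) g"
proof (cases "jacobi_off (Suc n) = 0")
  case True
  then have "(\<integral>x. orth_residual n x * orth_residual n x \<partial>M) = 0" by (simp add: jacobi_off_Suc l2_ip_def)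
  then have "AE x in M. orth_residual n x = 0"
    by (subst (asm) integral_nonneg_eq_0_iff_AE)
      (auto intro!: integrable_continuous continuous_intros continuous_orth_residual)
  then have "AE x in M. orth_residual n x * g x = 0" by eventually_elim simp
  then have "l2_ip (orth_residual n) g = 0" unfolding l2_ip_def by (rule integral_eq_zero_AE)
  then show ?thesis using True by simp
next
  case False
  then show ?thesis by (simp add: orth_poly_Suc l2_ip_def)
qed

text \<open>The three-term recurrence in weak form. Paired with a continuous function it survives
  the breakdown \<open>jacobi_off (Suc n) = 0\<close>, where the residual is 0 only almost
  everywhere.\<close>

lemma l2_ip_mult_X:
  assumes g: "continuous_on UNIV g"
  shows "l2_ip (\<lambda>x. x * orth_poly n x) g = jacobi_off (Suc n) * l2_ip (orth_poly (Suc n)) g + jacobi_diag n * l2_ip (orth_poly n) g + jacobi_off n * l2_ip (orth_poly (n - 1)) g"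
proof -
  have i: "integrable M (\<lambda>x. x * orth_poly n x * g x)" "integrable M (\<lambda>x. jacobi_diag n * (orth_poly n x * g x))"
    "integrable M (\<lambda>x. jacobi_off n * (orth_poly (n - 1) x * g x))"
    by (intro integrable_continuous continuous_intros g continuous_orth_poly)+
  have "l2_ip (orth_residual n) g = l2_ip (\<lambda>x. x * orth_poly n x) g - jacobi_diag n * l2_ip (orth_poly n) g - jacobi_off n * l2_ip (orth_poly (n - 1)) g"
    unfolding l2_ip_def orth_residual_def left_diff_distrib mult.assoc[of "jacobi_diag n"] mult.assoc[of "jacobi_off n"]
      Bochner_Integration.integral_diff[OF Bochner_Integration.integrable_diff[OF i(1,2)] i(3)]
      Bochner_Integration.integral_diff[OF i(1,2)] by simp
  then show ?thesis by (simp add: l2_ip_residual[OF g])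
qed

lemma orth_poly_zero: "jacobi_off (Suc n) = 0 \<Longrightarrow> orth_poly (Suc n) = (\<lambda>_. 0)"
  by (simp add: orth_poly_Suc)

lemma l2_ip_zero [simp]: "l2_ip (\<lambda>_. 0) g = 0" "l2_ip g (\<lambda>_. 0) = 0"
  by (simp_all add: l2_ip_def)

lemma l2_ip_orth_poly_self: "l2_ip (orth_poly n) (orth_poly n) = (if n = 0 \<or> jacobi_off n \<noteq> 0 then 1 else 0)"
proof (cases n)
  case (Suc m)
  have nn: "0 \<le> l2_ip (orth_residual m) (orth_residual m)" unfolding l2_ip_def by (rule Bochner_Integration.integral_nonneg) simp
  show ?thesis
  proof (cases "jacobi_off n = 0")
    case False
    have "l2_ip (orth_poly n) (orth_poly n) = l2_ip (orth_residual m) (orth_residual m) / (jacobi_off n * jacobi_off n)"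
      by (simp add: Suc orth_poly_Suc l2_ip_def)
    also have "jacobi_off n * jacobi_off n = l2_ip (orth_residual m) (orth_residual m)" using nn by (simp add: Suc jacobi_off_Suc)
    finally show ?thesis using False nn by (auto simp: Suc jacobi_off_Suc)
  qed (simp add: Suc orth_poly_zero)
qed (simp add: orth_poly_0 l2_ip_def prob_space[unfolded space_eq_univ])

lemma l2_ip_mult_X_swap: "l2_ip (\<lambda>x. x * f x) g = l2_ip (\<lambda>x. x * g x) f"
  by (simp add: l2_ip_def mult_ac)

text \<open>Multiplication by x is symmetric, so in the product of \<open>x * orth_poly m x\<close>
  and \<open>orth_poly i\<close> the recurrence may be applied to \<open>i\<close> instead;
  orthogonality below \<open>n\<close> then leaves only the neighbour \<open>Suc i = m\<close> and
  the diagonal \<open>i = m\<close>.\<close>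

lemma orthogonal_orth_poly: "i < n \<Longrightarrow> l2_ip (orth_poly n) (orth_poly i) = 0"
proof (induction n arbitrary: i rule: less_induct)
  case (less n)
  then obtain m where n: "n = Suc m" by (cases n) auto
  show ?case
  proof (cases "jacobi_off (Suc m) = 0")
    case True then show ?thesis by (simp add: n orth_poly_zero)
  next
    case False
    have al1: "jacobi_off m * l2_ip (orth_poly (m - 1)) (orth_poly m) = 0"
      using less.IH[of m "m - 1"] by (cases m) (simp_all add: n jacobi_off_0 l2_ip_commute)
    have eq: "jacobi_off (Suc m) * l2_ip (orth_poly n) (orth_poly i) = l2_ip (\<lambda>x. x * orth_poly m x) (orth_poly i) - jacobi_diag m * l2_ip (orth_poly m) (orth_poly i) - jacobi_off m * l2_ip (orth_poly (m - 1)) (orth_poly i)"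
      using l2_ip_mult_X[OF continuous_orth_poly, of m i] by (simp add: n)
    have "jacobi_off (Suc m) * l2_ip (orth_poly n) (orth_poly i) = 0"
    proof (cases "i = m")
      case True
      have bm: "jacobi_diag m * l2_ip (orth_poly m) (orth_poly m) = jacobi_diag m"
      proof (cases "m = 0 \<or> jacobi_off m \<noteq> 0")
        case False
        then have "orth_poly m = (\<lambda>_. 0)" using orth_poly_zero by (cases m) auto
        then show ?thesis by (simp add: jacobi_diag_def)
      qed (simp add: l2_ip_orth_poly_self)
      have "l2_ip (\<lambda>x. x * orth_poly m x) (orth_poly m) = jacobi_diag m" by (simp add: l2_ip_def jacobi_diag_def)
      then show ?thesis unfolding True eq[unfolded True] bm al1 by simp
    next
      case False
      then have im: "i < m" using less.prems n by simp
      have mi: "l2_ip (orth_poly m) (orth_poly i) = 0" using less.IH[of m i] im n by simp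
      have i1: "jacobi_off i * l2_ip (orth_poly (i - 1)) (orth_poly m) = 0"
        using less.IH[of m "i - 1"] im n by (simp add: l2_ip_commute)
      have 1: "l2_ip (\<lambda>x. x * orth_poly m x) (orth_poly i) = jacobi_off (Suc i) * l2_ip (orth_poly (Suc i)) (orth_poly m)"
        unfolding l2_ip_mult_X_swap[of "orth_poly m"] l2_ip_mult_X[OF continuous_orth_poly] using mi i1 by (simp add: l2_ip_commute)
      show ?thesis
      proof (cases "Suc i = m")
        case False
        then have "l2_ip (orth_poly (Suc i)) (orth_poly m) = 0" "l2_ip (orth_poly (m - 1)) (orth_poly i) = 0"
          using less.IH[of m "Suc i"] less.IH[of "m - 1" i] im n by (auto simp: l2_ip_commute)
        then show ?thesis unfolding eq 1 mi by simp
      next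
        case True
        \<comment> \<open>Both norms are 1 unless the recurrence has broken down. If
          \<open>orth_poly i\<close> is 0, then so is \<open>orth_residual i\<close> and hence
          \<open>jacobi_off m\<close>, and both sides vanish.\<close>
        have "jacobi_off m * l2_ip (orth_poly m) (orth_poly m) = jacobi_off m * l2_ip (orth_poly i) (orth_poly i)"
        proof (cases "i = 0 \<or> jacobi_off i \<noteq> 0 \<or> jacobi_off m = 0")
          case True then show ?thesis using \<open>Suc i = m\<close> by (auto simp: l2_ip_orth_poly_self)
        next
          case False
          then have "orth_poly i = (\<lambda>_. 0)" using orth_poly_zero by (cases i) auto
          then have "orth_residual i = (\<lambda>_. 0)" using False by (auto simp: orth_residual_def)
          then have "jacobi_off m = 0" using \<open>Suc i = m\<close> jacobi_off_Suc[of i] by simp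
          then show ?thesis by simp
        qed
        then show ?thesis unfolding eq 1 mi using True by auto
      qed
    qed
    then show ?thesis using False by simp
  qed
qed

lemma jacobi_diag_bound: "\<bar>jacobi_diag n\<bar> \<le> R"
proof -
  have "\<bar>jacobi_diag n\<bar> \<le> (\<integral>x. \<bar>x * orth_poly n x * orth_poly n x\<bar> \<partial>M)"
    unfolding jacobi_diag_def by (rule integral_abs_bound)
  also have "\<dots> \<le> (\<integral>x. R * (orth_poly n x * orth_poly n x) \<partial>M)"
  proof (rule integral_mono_AE)
    show "AE x in M. \<bar>x * orth_poly n x * orth_poly n x\<bar> \<le> R * (orth_poly n x * orth_poly n x)"
      using AE_R by eventually_elim (auto simp: abs_mult mult.assoc intro!: mult_right_mono)
  qed (intro integrable_continuous continuous_intros continuous_orth_poly)+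
  also have "\<dots> = R * l2_ip (orth_poly n) (orth_poly n)" by (simp add: l2_ip_def)
  also have "\<dots> \<le> R" using R_pos by (simp add: l2_ip_orth_poly_self)
  finally show ?thesis .
qed

lemma jacobi_off_bound: "\<bar>jacobi_off n\<bar> \<le> R"
proof (cases "n = 0 \<or> jacobi_off n = 0")
  case True then show ?thesis using R_pos by (auto simp: jacobi_off_0)
next
  case False
  then obtain m where n: "n = Suc m" by (cases n) auto
  have o: "l2_ip (orth_poly m) (orth_poly n) = 0" "jacobi_off m * l2_ip (orth_poly (m - 1)) (orth_poly n) = 0"
    using orthogonal_orth_poly[of m n] orthogonal_orth_poly[of "m - 1" n] by (simp_all add: n l2_ip_commute)
  have e: "l2_ip (orth_poly n) (orth_poly n) = 1" "l2_ip (orth_poly m) (orth_poly m) \<le> 1" using False by (auto simp: l2_ip_orth_poly_self)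
  have "jacobi_off n = l2_ip (\<lambda>x. x * orth_poly m x) (orth_poly n)"
    using l2_ip_mult_X[OF continuous_orth_poly, of m n] o e by (simp add: n)
  then have "\<bar>jacobi_off n\<bar> \<le> (\<integral>x. \<bar>x * orth_poly m x * orth_poly n x\<bar> \<partial>M)"
    unfolding l2_ip_def by (simp add: integral_abs_bound)
  \<comment> \<open>The integrand is bounded by |pq| <= (p^2 + q^2)/2, and the two polynomials have
    norm at most 1.\<close>
  also have "\<dots> \<le> (\<integral>x. R / 2 * (orth_poly m x * orth_poly m x) + R / 2 * (orth_poly n x * orth_poly n x) \<partial>M)"
  proof (rule integral_mono_AE)
    show "AE x in M. \<bar>x * orth_poly m x * orth_poly n x\<bar> \<le> R / 2 * (orth_poly m x * orth_poly m x) + R / 2 * (orth_poly n x * orth_poly n x)"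
      using AE_R
    proof eventually_elim
      case (elim x)
      have "\<bar>x * orth_poly m x * orth_poly n x\<bar> \<le> R * (\<bar>orth_poly m x\<bar> * \<bar>orth_poly n x\<bar>)"
        using elim by (auto simp: abs_mult mult.assoc intro!: mult_right_mono)
      also have "\<dots> \<le> R * ((orth_poly m x * orth_poly m x + orth_poly n x * orth_poly n x) / 2)"
        using R_pos sum_squares_bound[of "\<bar>orth_poly m x\<bar>" "\<bar>orth_poly n x\<bar>"]
        by (intro mult_left_mono) (auto simp: power2_eq_square)
      finally show ?case by (simp add: algebra_simps add_divide_distrib)
    qed
  qed (intro integrable_continuous continuous_intros continuous_orth_poly)+
  also have "\<dots> = R / 2 * l2_ip (orth_poly m) (orth_poly m) + R / 2 * l2_ip (orth_poly n) (orth_poly n)"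
    unfolding l2_ip_def
    by (subst Bochner_Integration.integral_add) (auto intro!: integrable_continuous continuous_intros continuous_orth_poly)
  also have "\<dots> \<le> R / 2 * 1 + R / 2 * 1"
    using R_pos e by (intro add_mono mult_left_mono) auto
  finally show ?thesis by simp
qed

text \<open>Only \<open>n = 0\<close>, the k-th moment, is wanted; but the induction on
  \<open>k\<close> needs all coordinates, and for these it is exactly
  \<open>l2_ip_mult_X\<close>.\<close>

lemma coord_jacobi_power:
  "coord ((jacobi jacobi_off jacobi_diag ^^ k) (ket None)) (unidx n) = complex_of_real (l2_ip (orth_poly n) (\<lambda>x. x ^ k))"
proof (induction k arbitrary: n)
  case 0
  have "l2_ip (orth_poly n) (orth_poly 0) = (if n = 0 then 1 else 0)"
    using orthogonal_orth_poly[of 0 n] l2_ip_orth_poly_self[of 0] by auto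
  then show ?case
    by (cases n) (simp_all add: orth_poly_0 coord_ket)
next
  case (Suc k)
  have "l2_ip (orth_poly n) (\<lambda>x. x ^ Suc k) = l2_ip (\<lambda>x. x * orth_poly n x) (\<lambda>x. x ^ k)"
    by (simp add: l2_ip_def mult_ac)
  also have "\<dots> = jacobi_off (Suc n) * l2_ip (orth_poly (Suc n)) (\<lambda>x. x ^ k) + jacobi_diag n * l2_ip (orth_poly n) (\<lambda>x. x ^ k) + jacobi_off n * l2_ip (orth_poly (n - 1)) (\<lambda>x. x ^ k)"
    by (intro l2_ip_mult_X continuous_intros)
  finally have r: "l2_ip (orth_poly n) (\<lambda>x. x ^ Suc k) =
    jacobi_off (Suc n) * l2_ip (orth_poly (Suc n)) (\<lambda>x. x ^ k) + jacobi_diag n * l2_ip (orth_poly n) (\<lambda>x. x ^ k) + jacobi_off n * l2_ip (orth_poly (n - 1)) (\<lambda>x. x ^ k)" .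
  show ?case
    unfolding r funpow.simps o_apply coord_jacobi[where \<alpha> = jacobi_off and \<beta> = jacobi_diag and C = R, OF jacobi_off_bound jacobi_diag_bound jacobi_off_0] Suc.IH by simp
qed

theorem realisation:
  "selfadjoint (jacobi jacobi_off jacobi_diag) \<and> has_distribution (jacobi jacobi_off jacobi_diag) (ket None) M"
proof
  show "selfadjoint (jacobi jacobi_off jacobi_diag)"
    by (rule selfadjoint_jacobi[where \<alpha> = jacobi_off and \<beta> = jacobi_diag and C = R, OF jacobi_off_bound jacobi_diag_bound jacobi_off_0])
  have "measure M {-R..R} = 1"
    using AE_R by (subst prob_eq_1) (auto simp: abs_le_iff minus_le_iff)
  then have "compactly_supported M"
    unfolding compactly_supported_def by (intro exI[of _ "{-R..R}"]) auto
  moreover have "real_distribution M" by unfold_locales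
  moreover have "complex_of_real (\<integral>x. x ^ k \<partial>M) = cinner ((jacobi jacobi_off jacobi_diag ^^ k) (ket None)) (ket None)" for k
    using coord_jacobi_power[of k 0] unfolding cinner_ket by (simp add: orth_poly_0 l2_ip_def)
  ultimately show "has_distribution (jacobi jacobi_off jacobi_diag) (ket None) M"
    unfolding has_distribution_def by blast
qed

end

section \<open>Analytic properties of the transforms\<close>

lemma upper_half_planeD: "z \<in> upper_half_plane \<Longrightarrow> 0 < Im z"
  by (simp add: upper_half_plane_def)

lemma open_upper_half_plane: "open upper_half_plane"
  unfolding upper_half_plane_def by (rule open_halfspace_Im_gt)

lemma convex_upper_half_plane: "convex upper_half_plane"
  unfolding upper_half_plane_def by (rule convex_halfspace_Im_gt)

lemma Im_le_norm_diff: "Im z \<le> cmod (z - complex_of_real x)"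
  using abs_Im_le_cmod[of "z - complex_of_real x"] by simp

lemma diff_of_real_nonzero: "0 < Im z \<Longrightarrow> z - complex_of_real x \<noteq> 0"
  by (auto simp: complex_eq_iff)

lemma norm_inverse_diff_le: "0 < Im z \<Longrightarrow> cmod (1 / (z - complex_of_real x)) \<le> 1 / Im z"
  using Im_le_norm_diff[of z x] by (simp add: norm_divide divide_simps)

context real_distribution
begin

lemma integrable_Cauchy_kernel:
  assumes "0 < Im z"
  shows "integrable M (\<lambda>x. 1 / (z - complex_of_real x))"
  by (rule integrable_const_bound[of _ "1 / Im z"]) (use norm_inverse_diff_le[OF assms] in auto)

lemma norm_integral_le:
  fixes f :: "real \<Rightarrow> complex"
  assumes "AE x in M. norm (f x) \<le> B" "f \<in> borel_measurable M"
  shows "norm (integral\<^sup>L M f) \<le> B"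
proof -
  have "norm (integral\<^sup>L M f) \<le> (\<integral>x. norm (f x) \<partial>M)" by (rule integral_norm_bound)
  also have "\<dots> \<le> (\<integral>x. B \<partial>M)"
    using assms integrable_const_bound[OF assms] by (intro integral_mono_AE integrable_norm) auto
  also have "\<dots> = B" by (simp add: prob_space[unfolded space_eq_univ])
  finally show ?thesis .
qed

lemma norm_G_le: "0 < Im z \<Longrightarrow> cmod (G_transform M z) \<le> 1 / Im z"
  unfolding G_transform_def
  by (rule norm_integral_le) (auto intro: norm_inverse_diff_le)

lemma Im_Cauchy_kernel: "Im (1 / (z - complex_of_real x)) = - (Im z / (cmod (z - complex_of_real x))\<^sup>2)"
  by (simp add: Im_divide cmod_power2)

lemma Im_G_neg:
  assumes z: "0 < Im z"
  shows "Im (G_transform M z) < 0"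
proof -
  let ?f = "\<lambda>x. Im z / (cmod (z - complex_of_real x))\<^sup>2"
  have int: "integrable M (\<lambda>x. Im (1 / (z - complex_of_real x)))"
    using integrable_Cauchy_kernel[OF z] by (rule integrable_Im)
  have eq: "Im (G_transform M z) = - (\<integral>x. ?f x \<partial>M)"
    unfolding G_transform_def integral_Im[OF integrable_Cauchy_kernel[OF z], symmetric] Im_Cauchy_kernel by simp
  have i: "integrable M ?f"
    using integrable_minus[OF int] unfolding Im_Cauchy_kernel by simp
  have pos: "0 < ?f x" for x using z diff_of_real_nonzero[OF z, of x] by simp
  have "(\<integral>x. ?f x \<partial>M) \<noteq> 0"
  proof
    assume "(\<integral>x. ?f x \<partial>M) = 0"
    then have "AE x in M. ?f x = 0"
      using pos by (subst (asm) integral_nonneg_eq_0_iff_AE[OF i]) (auto intro: less_imp_le)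
    then have "AE x in M. False" by eventually_elim (use pos in \<open>metis less_irrefl\<close>)
    then show False by simp
  qed
  moreover have "0 \<le> (\<integral>x. ?f x \<partial>M)"
    using pos by (intro Bochner_Integration.integral_nonneg) (auto intro: less_imp_le)
  ultimately show ?thesis using eq by simp
qed

lemma G_nonzero: "0 < Im z \<Longrightarrow> G_transform M z \<noteq> 0"
  using Im_G_neg[of z] by auto

lemma Im_F_pos: "0 < Im z \<Longrightarrow> 0 < Im (F_transform M z)"
  using Im_G_neg[of z] G_nonzero[of z] unfolding F_transform_def
  by (simp add: Im_divide sum_power2_gt_zero_iff complex_eq_iff divide_less_0_iff)

lemma G_has_derivative:
  assumes z: "0 < Im z"
  shows "(G_transform M has_field_derivative - (\<integral>x. 1 / (z - complex_of_real x)\<^sup>2 \<partial>M)) (at z)"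
  unfolding has_field_derivative_iff
proof (rule Lim_transform2[OF tendsto_const], rule Lim_null_comparison)
  let ?y = "Im z"
  \<comment> \<open>The remainder of the kernel is \<open>w - z\<close> times two kernels at z and
    one at w. Points closer to z than y/2 have imaginary part above y/2, whence
    (1/y)(1/y)(2/y).\<close>
  let ?C = "2 / (?y * ?y * ?y)"
  have "\<forall>\<^sub>F w in at z. dist w z < ?y / 2 \<and> w \<noteq> z"
    using z by (auto simp: eventually_at intro!: exI[of _ "?y / 2"])
  then show "\<forall>\<^sub>F w in at z. norm (- (\<integral>x. 1 / (z - complex_of_real x)\<^sup>2 \<partial>M) - (G_transform M w - G_transform M z) / (w - z))
       \<le> ?C * norm (w - z)"
  proof eventually_elim
    case (elim w)
    have "\<bar>Im (w - z)\<bar> < ?y / 2"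
      using elim abs_Im_le_cmod[of "w - z"] by (simp add: dist_norm)
    then have w: "?y / 2 < Im w" "0 < Im w" using z unfolding minus_complex.sel by linarith+
    have i2: "integrable M (\<lambda>x. 1 / (z - complex_of_real x)\<^sup>2)"
    proof (rule integrable_const_bound[of _ "(1 / ?y)\<^sup>2"])
      show "AE x in M. norm (1 / (z - complex_of_real x)\<^sup>2) \<le> (1 / ?y)\<^sup>2"
        using power_mono[OF norm_inverse_diff_le[OF z] norm_ge_zero, of _ 2]
        by (simp add: norm_divide norm_power power_divide)
    qed auto
    have "- (\<integral>x. 1 / (z - complex_of_real x)\<^sup>2 \<partial>M) - (G_transform M w - G_transform M z) / (w - z)
        = - (\<integral>x. 1 / (z - complex_of_real x)\<^sup>2 \<partial>M) - (\<integral>x. (1 / (w - complex_of_real x) - 1 / (z - complex_of_real x)) / (w - z) \<partial>M)"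
      unfolding G_transform_def
      using integrable_Cauchy_kernel[OF z] integrable_Cauchy_kernel[OF w(2)] by simp
    also have "\<dots> = (\<integral>x. - (1 / (z - complex_of_real x)\<^sup>2) - (1 / (w - complex_of_real x) - 1 / (z - complex_of_real x)) / (w - z) \<partial>M)"
      using integrable_Cauchy_kernel[OF z] integrable_Cauchy_kernel[OF w(2)] i2
      by (subst Bochner_Integration.integral_diff) auto
    also have "norm \<dots> \<le> ?C * norm (w - z)"
    proof (rule norm_integral_le)
      have "norm (- (1 / (z - complex_of_real x)\<^sup>2) - (1 / (w - complex_of_real x) - 1 / (z - complex_of_real x)) / (w - z))
         \<le> ?C * norm (w - z)" for x
      proof -
        let ?a = "z - complex_of_real x" and ?b = "w - complex_of_real x"
        have ab: "?a \<noteq> 0" "?b \<noteq> 0" using diff_of_real_nonzero[OF z] diff_of_real_nonzero[OF w(2)] by auto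
        have "1 / ?b - 1 / ?a = - (w - z) / (?a * ?b)"
          using ab by (simp add: divide_simps)
        then have "(1 / ?b - 1 / ?a) / (w - z) = - 1 / (?a * ?b)"
          using elim ab by (simp add: divide_simps)
        then have "- (1 / ?a\<^sup>2) - (1 / ?b - 1 / ?a) / (w - z) = 1 / (?a * ?b) - 1 / ?a\<^sup>2" by simp
        also have "\<dots> = - (w - z) * ((1 / ?a) * (1 / ?a) * (1 / ?b))"
          using ab by (simp add: divide_simps power2_eq_square)
        also have "norm \<dots> = norm (w - z) * (norm (1 / ?a) * norm (1 / ?a) * norm (1 / ?b))"
          by (simp only: norm_mult norm_minus_cancel)
        also have "\<dots> \<le> norm (w - z) * ((1 / ?y) * (1 / ?y) * (1 / (?y / 2)))"
        proof (intro mult_left_mono mult_mono norm_inverse_diff_le z)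
          have "norm (1 / ?b) \<le> 1 / Im w" by (rule norm_inverse_diff_le[OF w(2)])
          also have "\<dots> \<le> 1 / (?y / 2)" using w z by (intro divide_left_mono) auto
          finally show "norm (1 / ?b) \<le> 1 / (?y / 2)" .
        qed (use z in auto)
        finally show ?thesis by (simp add: mult.commute)
      qed
      then show "AE x in M. norm (- (1 / (z - complex_of_real x)\<^sup>2) - (1 / (w - complex_of_real x) - 1 / (z - complex_of_real x)) / (w - z))
         \<le> ?C * norm (w - z)" by simp
    qed auto
    finally show ?case .
  qed
  have "((\<lambda>w. ?C * norm (w - z)) \<longlongrightarrow> ?C * norm (z - z)) (at z)"
    by (intro tendsto_intros)
  then show "((\<lambda>w. ?C * norm (w - z)) \<longlongrightarrow> 0) (at z)" by simp
qed

lemma G_holomorphic: "G_transform M holomorphic_on upper_half_plane"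
  using G_has_derivative open_upper_half_plane
  by (auto simp: holomorphic_on_open upper_half_plane_def)

lemma F_holomorphic: "F_transform M holomorphic_on upper_half_plane"
  unfolding F_transform_def[abs_def]
  by (intro holomorphic_intros G_holomorphic G_nonzero upper_half_planeD)

lemma K_holomorphic: "K_transform M holomorphic_on upper_half_plane"
  unfolding K_transform_def[abs_def] by (intro holomorphic_intros F_holomorphic)

end

text \<open>
  Stieltjes inversion: \<open>b \<mapsto> \<integral> arctan ((b - t) / y) d\<mu>(t)\<close> is a primitive of \<open>- Im G(b + iy)\<close>, and as
  \<open>y\<close> tends to \<open>0\<close> it recovers the distribution function.  The increment is estimated quadratically to avoid
  differentiating under the integral.
\<close>

lemma arctan_increment:
  assumes y: "0 < y" and "a < b"
  shows "\<bar>arctan ((b - t) / y) - arctan ((a - t) / y) + (b - a) * Im (1 / (Complex a y - complex_of_real t))\<bar>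
    \<le> (b - a)\<^sup>2 / y\<^sup>2"
proof -
  let ?g = "\<lambda>s. 1 / (Complex s y - complex_of_real t)"
  have der: "((\<lambda>s. arctan ((s - t) / y)) has_real_derivative - Im (?g s)) (at s)" for s
  proof -
    have "(y\<^sup>2 + (s - t)\<^sup>2) \<noteq> 0" using y by (simp add: sum_power2_eq_zero_iff)
    then show ?thesis using y
      by (auto intro!: derivative_eq_intros simp: Im_divide divide_simps) (simp add: power2_eq_square mult_ac add_ac)
  qed
  obtain \<xi> where \<xi>: "a < \<xi>" "\<xi> < b" "arctan ((b - t) / y) - arctan ((a - t) / y) = (b - a) * - Im (?g \<xi>)"
    using MVT2[OF \<open>a < b\<close>, of "\<lambda>s. arctan ((s - t) / y)" "\<lambda>s. - Im (?g s)", OF der] by metis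
  have nz: "Complex s y - complex_of_real t \<noteq> 0" for s using y by (simp add: complex_eq_iff)
  have "\<bar>Im (?g a) - Im (?g \<xi>)\<bar> \<le> cmod (?g a - ?g \<xi>)"
    using abs_Im_le_cmod[of "?g a - ?g \<xi>"] by simp
  also have "?g a - ?g \<xi> = complex_of_real (\<xi> - a) * (?g a * ?g \<xi>)"
  proof -
    have "Complex \<xi> y - complex_of_real t - (Complex a y - complex_of_real t) = complex_of_real (\<xi> - a)"
      by (simp add: complex_eq_iff)
    moreover have "1 / u - 1 / v = (v - u) * (1 / u * (1 / v))" if "u \<noteq> 0" "v \<noteq> 0" for u v :: complex
      using that by (simp add: divide_simps)
    ultimately show ?thesis using nz by metis
  qed
  also have "cmod \<dots> = (\<xi> - a) * (cmod (?g a) * cmod (?g \<xi>))"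
    using \<xi> by (simp only: norm_mult norm_of_real)
  also have "\<dots> \<le> (b - a) * ((1 / y) * (1 / y))"
    using \<xi> y norm_inverse_diff_le[of "Complex a y" t] norm_inverse_diff_le[of "Complex \<xi> y" t]
    by (intro mult_mono mult_nonneg_nonneg norm_ge_zero) simp_all
  finally have *: "\<bar>Im (?g a) - Im (?g \<xi>)\<bar> \<le> (b - a) / y\<^sup>2"
    by (simp add: power2_eq_square)
  have "arctan ((b - t) / y) - arctan ((a - t) / y) + (b - a) * Im (?g a) = (b - a) * (Im (?g a) - Im (?g \<xi>))"
    unfolding \<xi>(3) by (simp add: algebra_simps)
  also have "\<bar>\<dots>\<bar> \<le> (b - a) * ((b - a) / y\<^sup>2)"
    using * \<open>a < b\<close> by (simp only: abs_mult) (intro mult_mono, auto)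
  finally show ?thesis by (simp add: power2_eq_square)
qed

context real_distribution
begin

lemma integrable_bounded: "f \<in> borel_measurable borel \<Longrightarrow> (\<And>x. norm (f x) \<le> B) \<Longrightarrow> integrable M (f :: real \<Rightarrow> real)"
  by (rule integrable_const_bound[of _ B]) auto

lemma abs_arctan_le: "norm (arctan x) \<le> 2"
  using arctan_lbound[of x] arctan_ubound[of x] pi_less_4 unfolding real_norm_def abs_le_iff by linarith

lemma integrable_arctan: "integrable M (\<lambda>t. arctan ((b - t) / y))"
  by (rule integrable_bounded[OF _ abs_arctan_le]) measurable

lemma arctan_integral_increment:
  assumes y: "0 < y" and "a < b"
  shows "\<bar>(\<integral>t. arctan ((b - t) / y) \<partial>M) - (\<integral>t. arctan ((a - t) / y) \<partial>M) + (b - a) * Im (G_transform M (Complex a y))\<bar>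
    \<le> (b - a)\<^sup>2 / y\<^sup>2"
proof -
  have ik: "integrable M (\<lambda>t. 1 / (Complex a y - complex_of_real t))"
    using y by (intro integrable_Cauchy_kernel) simp
  have i1: "integrable M (\<lambda>t. arctan ((b - t) / y) - arctan ((a - t) / y))"
    by (intro Bochner_Integration.integrable_diff integrable_arctan)
  have i2: "integrable M (\<lambda>t. (b - a) * Im (1 / (Complex a y - complex_of_real t)))"
    by (intro integrable_mult_right integrable_Im ik)
  let ?f = "\<lambda>t. arctan ((b - t) / y) - arctan ((a - t) / y) + (b - a) * Im (1 / (Complex a y - complex_of_real t))"
  have G: "Im (G_transform M (Complex a y)) = (\<integral>t. Im (1 / (Complex a y - complex_of_real t)) \<partial>M)"
    unfolding G_transform_def by (rule integral_Im[OF ik, symmetric])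
  have "(\<integral>t. ?f t \<partial>M) = (\<integral>t. arctan ((b - t) / y) \<partial>M) - (\<integral>t. arctan ((a - t) / y) \<partial>M) + (b - a) * Im (G_transform M (Complex a y))"
    unfolding G Bochner_Integration.integral_add[OF i1 i2]
      Bochner_Integration.integral_diff[OF integrable_arctan integrable_arctan] integral_mult_right_zero ..
  moreover have "\<bar>\<integral>t. ?f t \<partial>M\<bar> \<le> (\<integral>t. \<bar>?f t\<bar> \<partial>M)"
    by (rule integral_abs_bound)
  moreover have "(\<integral>t. \<bar>?f t\<bar> \<partial>M) \<le> (\<integral>t. (b - a)\<^sup>2 / y\<^sup>2 \<partial>M)"
  proof (rule integral_mono)
    show "integrable M (\<lambda>t. \<bar>?f t\<bar>)" by (intro integrable_abs Bochner_Integration.integrable_add i1 i2)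
    show "integrable M (\<lambda>t. (b - a)\<^sup>2 / y\<^sup>2)" by simp
    show "\<bar>?f t\<bar> \<le> (b - a)\<^sup>2 / y\<^sup>2" for t by (rule arctan_increment[OF assms])
  qed
  moreover have "(\<integral>t. (b - a)\<^sup>2 / y\<^sup>2 \<partial>M) = (b - a)\<^sup>2 / y\<^sup>2"
    by (simp add: prob_space[unfolded space_eq_univ])
  ultimately show ?thesis by (simp only:)
qed

text \<open>Fixes the additive constant of the primitive: its limit at minus infinity is the same
  for every probability measure.\<close>

lemma arctan_integral_at_bot:
  assumes y: "0 < y"
  shows "(\<lambda>n. \<integral>t. arctan ((- real n - t) / y) \<partial>M) \<longlonglongrightarrow> - (pi / 2)"
proof -
  have "(\<lambda>n. \<integral>t. arctan ((- real n - t) / y) \<partial>M) \<longlonglongrightarrow> (\<integral>t. - (pi / 2) \<partial>M)"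
  proof (rule integral_dominated_convergence[where w = "\<lambda>_. 2"])
    have "(\<lambda>n. arctan ((- real n - t) / y)) \<longlonglongrightarrow> - (pi / 2)" for t
    proof (rule filterlim_compose[OF tendsto_arctan_at_bot])
      show "LIM n sequentially. (- real n - t) / y :> at_bot" using y by real_asymp
    qed
    then show "AE t in M. (\<lambda>n. arctan ((- real n - t) / y)) \<longlonglongrightarrow> - (pi / 2)" by simp
  qed (use abs_arctan_le in auto)
  then show ?thesis by (simp add: prob_space[unfolded space_eq_univ])
qed

lemma arctan_integral_zero:
  "(\<lambda>n. \<integral>t. arctan ((b - t) / inverse (real (Suc n))) \<partial>M) \<longlonglongrightarrow> (\<integral>t. pi / 2 * sgn (b - t) \<partial>M)"
proof (rule integral_dominated_convergence[where w = "\<lambda>_. 2"])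
  have "(\<lambda>n. arctan ((b - t) / inverse (real (Suc n)))) \<longlonglongrightarrow> pi / 2 * sgn (b - t)" for t
  proof -
    consider "b - t = 0" | "0 < b - t" | "b - t < 0" by linarith
    then show ?thesis
    proof cases
      case 2
      then have "LIM n sequentially. (b - t) / inverse (real (Suc n)) :> at_top" by real_asymp
      from filterlim_compose[OF tendsto_arctan_at_top this] show ?thesis using 2 by simp
    next
      case 3
      then have "LIM n sequentially. (b - t) / inverse (real (Suc n)) :> at_bot" by real_asymp
      from filterlim_compose[OF tendsto_arctan_at_bot this] show ?thesis using 3 by simp
    qed simp
  qed
  then show "AE t in M. (\<lambda>n. arctan ((b - t) / inverse (real (Suc n)))) \<longlonglongrightarrow> pi / 2 * sgn (b - t)" by simp
qed (use abs_arctan_le in auto)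

text \<open>At an atom \<open>b\<close> the integral of \<open>sgn (b - t)\<close> only yields the
  mean of the one-sided values of the distribution function. Approaching \<open>b\<close> from the
  right counts the atom in full and gives \<open>cdf\<close>.\<close>

lemma sgn_integral_right:
  "(\<lambda>n. \<integral>t. sgn (b + inverse (real (Suc n)) - t) \<partial>M) \<longlonglongrightarrow> 2 * cdf M b - 1"
proof -
  have "(\<lambda>n. \<integral>t. sgn (b + inverse (real (Suc n)) - t) \<partial>M) \<longlonglongrightarrow> (\<integral>t. 2 * indicator {..b} t - 1 \<partial>M)"
  proof (rule integral_dominated_convergence[where w = "\<lambda>_. 1"])
    have "(\<lambda>n. sgn (b + inverse (real (Suc n)) - t)) \<longlonglongrightarrow> 2 * indicator {..b} t - 1" for t
    proof (cases "t \<le> b")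
      case True
      have "0 < b + inverse (real (Suc n)) - t" for n
        using True inverse_positive_iff_positive[of "real (Suc n)"] by linarith
      then show ?thesis using True by (simp add: sgn_1_pos)
    next
      case False
      have "(\<lambda>n. b + inverse (real (Suc n)) - t) \<longlonglongrightarrow> b - t" by real_asymp
      then have "\<forall>\<^sub>F n in sequentially. b + inverse (real (Suc n)) - t < 0"
        using False by (intro order_tendstoD(2)) auto
      then have "\<forall>\<^sub>F n in sequentially. sgn (b + inverse (real (Suc n)) - t) = -1"
        by eventually_elim (simp add: sgn_1_neg)
      then show ?thesis using False by (simp add: tendsto_eventually)
    qed
    then show "AE t in M. (\<lambda>n. sgn (b + inverse (real (Suc n)) - t)) \<longlonglongrightarrow> 2 * indicator {..b} t - 1" by simp
  qed (auto simp: sgn_if)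
  also have "(\<integral>t. 2 * indicator {..b} t - 1 \<partial>M) = 2 * cdf M b - 1"
    by (subst Bochner_Integration.integral_diff)
      (auto simp: cdf_def prob_space[unfolded space_eq_univ] integrable_indicator_iff emeasure_eq_measure)
  finally show ?thesis .
qed

end

theorem G_transform_inject:
  assumes "real_distribution \<mu>" "real_distribution \<nu>"
    and eq: "\<And>z. 0 < Im z \<Longrightarrow> G_transform \<mu> z = G_transform \<nu> z"
  shows "\<mu> = \<nu>"
proof -
  interpret \<mu>: real_distribution \<mu> by fact
  interpret \<nu>: real_distribution \<nu> by fact
  define \<phi> where "\<phi> M y b = (\<integral>t. arctan ((b - t) / y) \<partial>M)" for M :: "real measure" and y b
  have same: "\<phi> \<mu> y b = \<phi> \<nu> y b" if y: "0 < y" for y b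
  proof -
    define d where "d b = \<phi> \<mu> y b - \<phi> \<nu> y b" for b
    \<comment> \<open>The terms with the common Cauchy transform cancel in the two increments. What
      is left is quadratic in b - a, so \<open>d\<close> has derivative 0.\<close>
    have q: "\<bar>d b - d a\<bar> \<le> 2 / y\<^sup>2 * (b - a)\<^sup>2" if "a < b" for a b
    proof -
      have "G_transform \<mu> (Complex a y) = G_transform \<nu> (Complex a y)" using y by (intro eq) simp
      then have "\<bar>(\<integral>t. arctan ((b - t) / y) \<partial>\<nu>) - (\<integral>t. arctan ((a - t) / y) \<partial>\<nu>)
          + (b - a) * Im (G_transform \<mu> (Complex a y))\<bar> \<le> (b - a)\<^sup>2 / y\<^sup>2"
        using \<nu>.arctan_integral_increment[OF y that] by (simp only:)
      moreover have "\<bar>p - p' - (q - q')\<bar> \<le> 2 * c" if "\<bar>p - q + r\<bar> \<le> c" "\<bar>p' - q' + r\<bar> \<le> c" for p q p' q' r c :: real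
        using that by linarith
      ultimately show ?thesis
        using \<mu>.arctan_integral_increment[OF y that] unfolding d_def \<phi>_def times_divide_eq_left
        by (metis times_divide_eq_right)
    qed
    have quad: "\<bar>d b - d a\<bar> \<le> 2 / y\<^sup>2 * (b - a)\<^sup>2" for a b
    proof -
      consider "a < b" | "b < a" | "a = b" by linarith
      then show ?thesis
      proof cases
        case 2
        then show ?thesis using q[OF 2] by (simp only: abs_minus_commute[of "d b"] power2_commute[of b])
      qed (use q in auto)
    qed
    have "(d has_real_derivative 0) (at x)" for x
      unfolding has_field_derivative_iff
    proof (rule Lim_null_comparison)
      show "\<forall>\<^sub>F b in at x. norm ((d b - d x) / (b - x)) \<le> 2 / y\<^sup>2 * \<bar>b - x\<bar>"
        unfolding eventually_at_filter
      proof (intro always_eventually allI impI)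
        fix b assume "b \<noteq> x"
        then show "norm ((d b - d x) / (b - x)) \<le> 2 / y\<^sup>2 * \<bar>b - x\<bar>"
          using quad[of b x] by (simp add: divide_le_eq power2_eq_square abs_mult_self_eq mult.assoc)
      qed
      have "((\<lambda>b. 2 / y\<^sup>2 * \<bar>b - x\<bar>) \<longlongrightarrow> 2 / y\<^sup>2 * \<bar>x - x\<bar>) (at x)" by (intro tendsto_intros)
      then show "((\<lambda>b. 2 / y\<^sup>2 * \<bar>b - x\<bar>) \<longlongrightarrow> 0) (at x)" by simp
    qed
    then have const: "d a = d b" for a b using DERIV_isconst_all[of d] by blast
    have "(\<lambda>n. d (- real n)) \<longlonglongrightarrow> - (pi / 2) - - (pi / 2)"
      unfolding d_def \<phi>_def by (intro tendsto_diff \<mu>.arctan_integral_at_bot \<nu>.arctan_integral_at_bot y)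
    moreover have "(\<lambda>n. d (- real n)) = (\<lambda>n. d b)" using const by blast
    ultimately have "d b = 0" by (simp add: LIMSEQ_const_iff)
    then show ?thesis by (simp add: d_def)
  qed
  have "(\<integral>t. pi / 2 * sgn (b - t) \<partial>\<mu>) = (\<integral>t. pi / 2 * sgn (b - t) \<partial>\<nu>)" for b
  proof (rule LIMSEQ_unique[OF \<mu>.arctan_integral_zero])
    have "\<phi> \<mu> (inverse (real (Suc n))) b = \<phi> \<nu> (inverse (real (Suc n))) b" for n by (rule same) simp
    then show "(\<lambda>n. \<integral>t. arctan ((b - t) / inverse (real (Suc n))) \<partial>\<mu>) \<longlonglongrightarrow> (\<integral>t. pi / 2 * sgn (b - t) \<partial>\<nu>)"
      using \<nu>.arctan_integral_zero[of b] unfolding \<phi>_def by (simp only:)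
  qed
  then have sgn: "(\<integral>t. sgn (b - t) \<partial>\<mu>) = (\<integral>t. sgn (b - t) \<partial>\<nu>)" for b by simp
  have "2 * cdf \<mu> b - 1 = 2 * cdf \<nu> b - 1" for b
  proof (rule LIMSEQ_unique[OF \<mu>.sgn_integral_right])
    show "(\<lambda>n. \<integral>t. sgn (b + inverse (real (Suc n)) - t) \<partial>\<mu>) \<longlonglongrightarrow> 2 * cdf \<nu> b - 1"
      unfolding sgn by (rule \<nu>.sgn_integral_right)
  qed
  then have "cdf \<mu> = cdf \<nu>" by (auto simp: fun_eq_iff)
  then show ?thesis by (rule cdf_unique[OF assms(1,2)])
qed

section \<open>Behaviour of the transforms near infinity\<close>

lemma geometric_Cauchy_kernel:
  fixes w x :: complex
  assumes "w \<noteq> 0" "w - x \<noteq> 0"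
  shows "(\<Sum>n<N. x ^ n / w ^ Suc n) = 1 / (w - x) - (x / w) ^ N * (1 / (w - x))"
proof -
  have "(\<Sum>n<N. x ^ n / w ^ Suc n) = (\<Sum>n<N. (x / w) ^ n) / w"
    by (simp add: sum_divide_distrib power_divide mult.commute)
  also have "(\<Sum>n<N. (x / w) ^ n) = (1 - (x / w) ^ N) / (1 - x / w)"
    using assms by (simp add: sum_gp_strict)
  also have "\<dots> / w = (1 - (x / w) ^ N) * (1 / (w - x))"
    using assms by (simp add: field_simps)
  finally show ?thesis unfolding left_diff_distrib mult_1_left .
qed

context compact_distribution
begin

text \<open>The bridge from moments, through which \<open>has_distribution\<close> specifies a
  measure, to the Cauchy transform.\<close>

lemma G_sums:
  assumes w: "0 < Im w" "R < cmod w"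
  shows "(\<lambda>n. complex_of_real (\<integral>x. x ^ n \<partial>M) / w ^ Suc n) sums G_transform M w"
proof -
  have w0: "w \<noteq> 0" using w(1) by auto
  let ?k = "\<lambda>x. 1 / (w - complex_of_real x)"
  have cont: "continuous_on UNIV ?k"
    using diff_of_real_nonzero[OF w(1)] by (intro continuous_intros) auto
  have c2: "continuous_on UNIV (\<lambda>x. (complex_of_real x / w) ^ N)" for N
    using w0 by (intro continuous_intros) auto
  have int: "integrable M (\<lambda>x. complex_of_real x ^ n / w ^ Suc n)" for n
    using w0 by (intro integrable_continuous continuous_intros) auto
  have eq: "(\<Sum>n<N. complex_of_real (\<integral>x. x ^ n \<partial>M) / w ^ Suc n)
     = G_transform M w - (\<integral>x. (complex_of_real x / w) ^ N * ?k x \<partial>M)" for N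
  proof -
    have "(\<Sum>n<N. complex_of_real (\<integral>x. x ^ n \<partial>M) / w ^ Suc n) = (\<Sum>n<N. \<integral>x. complex_of_real x ^ n / w ^ Suc n \<partial>M)"
      by (simp add: integral_complex_of_real[symmetric] del: power_Suc)
    also have "\<dots> = (\<integral>x. (\<Sum>n<N. complex_of_real x ^ n / w ^ Suc n) \<partial>M)"
      by (rule Bochner_Integration.integral_sum[symmetric]) (rule int)
    also have "\<dots> = (\<integral>x. ?k x - (complex_of_real x / w) ^ N * ?k x \<partial>M)"
      using geometric_Cauchy_kernel[OF w0 diff_of_real_nonzero[OF w(1)]] by simp
    also have "\<dots> = G_transform M w - (\<integral>x. (complex_of_real x / w) ^ N * ?k x \<partial>M)"
      unfolding G_transform_def
      by (rule Bochner_Integration.integral_diff)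
        (intro integrable_continuous continuous_on_mult cont c2)+
    finally show ?thesis .
  qed
  have "(\<lambda>N. G_transform M w - (\<integral>x. (complex_of_real x / w) ^ N * ?k x \<partial>M)) \<longlonglongrightarrow> G_transform M w - 0"
  proof (rule tendsto_diff[OF tendsto_const], rule Lim_null_comparison)
    show "\<forall>\<^sub>F N in sequentially. norm (\<integral>x. (complex_of_real x / w) ^ N * ?k x \<partial>M) \<le> (R / cmod w) ^ N * (1 / Im w)"
    proof (rule always_eventually, rule allI, rule norm_integral_le)
      fix N
      show "AE x in M. norm ((complex_of_real x / w) ^ N * ?k x) \<le> (R / cmod w) ^ N * (1 / Im w)"
        using AE_R
      proof eventually_elim
        case (elim x)
        show ?case unfolding norm_mult norm_power
          using elim R_pos w by (intro mult_mono power_mono norm_inverse_diff_le) (auto simp: norm_divide divide_right_mono)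
      qed
    qed auto
    have "(\<lambda>N. (R / cmod w) ^ N * (1 / Im w)) \<longlonglongrightarrow> 0 * (1 / Im w)"
      using w R_pos by (intro tendsto_mult LIMSEQ_power_zero tendsto_const) (auto simp: divide_less_eq)
    then show "(\<lambda>N. (R / cmod w) ^ N * (1 / Im w)) \<longlonglongrightarrow> 0" by simp
  qed
  then show ?thesis unfolding sums_def eq by simp
qed

text \<open>K = w (wG - 1)/(wG), and wG - 1 is the integral of x/(w - x), of modulus at most R/(|w|
  - R) <= 1/3. Hence |wG| >= 2/3 and |K| <= (3/2) |w| R/(|w| - R) <= (3/2)(4/3) R = 2R.\<close>

lemma K_norm_le:
  assumes w: "0 < Im w" "4 * R \<le> cmod w"
  shows "cmod (K_transform M w) \<le> 2 * R"
proof -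
  let ?G = "G_transform M w"
  have w0: "w \<noteq> 0" using w(1) by auto
  have G0: "?G \<noteq> 0" by (rule G_nonzero[OF w(1)])
  have wR: "0 < cmod w - R" using w R_pos by linarith
  have "w * ?G - 1 = (\<integral>x. w * (1 / (w - complex_of_real x)) - 1 \<partial>M)"
    unfolding G_transform_def using integrable_Cauchy_kernel[OF w(1)]
    by (subst Bochner_Integration.integral_diff, (intro integrable_mult_right, assumption)[1])
      (simp_all only: integrable_const integral_mult_right_zero, simp add: prob_space[unfolded space_eq_univ])
  also have "norm \<dots> \<le> R / (cmod w - R)"
  proof (rule norm_integral_le)
    show "AE x in M. norm (w * (1 / (w - complex_of_real x)) - 1) \<le> R / (cmod w - R)"
      using AE_R
    proof eventually_elim
      case (elim x)
      have "w * (1 / (w - complex_of_real x)) - 1 = complex_of_real x / (w - complex_of_real x)"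
        using diff_of_real_nonzero[OF w(1), of x] by (simp add: field_simps)
      moreover have "cmod w - R \<le> cmod (w - complex_of_real x)"
        using norm_triangle_ineq2[of w "complex_of_real x"] elim by simp
      ultimately show ?case
        using elim wR R_pos by (auto simp: norm_divide intro!: frac_le)
    qed
  qed auto
  finally have d: "cmod (w * ?G - 1) \<le> R / (cmod w - R)" .
  have r: "R / (cmod w - R) \<le> 1 / 3" using w wR by (simp add: divide_simps)
  have "1 - cmod (w * ?G - 1) \<le> cmod (w * ?G)"
    using norm_triangle_ineq2[of 1 "1 - w * ?G"] by (simp add: norm_minus_commute)
  then have lower: "2 / 3 \<le> cmod (w * ?G)" using d r by linarith
  have "K_transform M w = w * ((w * ?G - 1) / (w * ?G))"
    unfolding K_transform_def F_transform_def using w0 G0 by (simp add: field_simps)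
  then have "cmod (K_transform M w) = cmod w * (cmod (w * ?G - 1) / cmod (w * ?G))"
    by (simp add: norm_mult norm_divide)
  also have "\<dots> \<le> cmod w * ((R / (cmod w - R)) / (2 / 3))"
    using d lower R_pos wR by (intro mult_left_mono frac_le) auto
  also have "\<dots> \<le> 2 * R"
  proof -
    have "cmod w * R * 3 \<le> 2 * R * (2 * (cmod w - R))"
      using mult_left_mono[of "cmod w * 3" "4 * (cmod w - R)" R] w R_pos by (simp add: algebra_simps)
    then show ?thesis using wR by (simp add: divide_simps) (simp add: algebra_simps)
  qed
  finally show ?thesis .
qed

text \<open>A disc of radius 4R around a point with Im w >= 8R stays at height at least 4R, where
  |K| <= 2R; Cauchy's inequality gives |K'| <= 2R/4R = 1/2.\<close>

lemma K_lipschitz: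
  assumes "8 * R \<le> Im u" "8 * R \<le> Im v"
  shows "cmod (K_transform M u - K_transform M v) \<le> 1 / 2 * cmod (u - v)"
proof (rule field_differentiable_bound[where S = "{w. 8 * R \<le> Im w}"])
  show "convex {w. 8 * R \<le> Im w}" using convex_halfspace_Im_ge[of "8 * R"] by (simp add: conj_commute)
  fix w assume "w \<in> {w. 8 * R \<le> Im w}"
  then have w: "8 * R \<le> Im w" by simp
  have sub: "Im x > 0 \<and> 4 * R \<le> cmod x" if "x \<in> cball w (4 * R)" for x
  proof -
    have "\<bar>Im w - Im x\<bar> \<le> 4 * R"
      using that abs_Im_le_cmod[of "w - x"] by (simp add: dist_norm)
    then show ?thesis using w R_pos abs_Im_le_cmod[of x] by linarith
  qed
  have hol: "K_transform M holomorphic_on cball w (4 * R)"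
    by (rule holomorphic_on_subset[OF K_holomorphic]) (use sub in \<open>auto simp: upper_half_plane_def\<close>)
  have "cmod ((deriv ^^ 1) (K_transform M) w) \<le> fact 1 * (2 * R) / (4 * R) ^ 1"
  proof (rule Cauchy_inequality)
    show "K_transform M holomorphic_on ball w (4 * R)" using hol by (rule holomorphic_on_subset) auto
    show "continuous_on (cball w (4 * R)) (K_transform M)" using hol by (rule holomorphic_on_imp_continuous_on)
    show "cmod (K_transform M x) \<le> 2 * R" if "cmod (w - x) = 4 * R" for x
      using sub[of x] that by (intro K_norm_le) (auto simp: dist_norm)
  qed (use R_pos in auto)
  then show "cmod (deriv (K_transform M) w) \<le> 1 / 2" using R_pos by simp
  have "0 < Im w" using w R_pos by linarith
  then have "(K_transform M has_field_derivative deriv (K_transform M) w) (at w)"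
    using K_holomorphic open_upper_half_plane by (intro holomorphic_derivI) (auto simp: upper_half_plane_def)
  then show "(K_transform M has_field_derivative deriv (K_transform M) w) (at w within {w. 8 * R \<le> Im w})"
    by (rule DERIV_subset) auto
qed (use assms in auto)

end

text \<open>Operator arguments give identities only far from the real axis; the identity theorem
  extends them to the whole half-plane.\<close>

lemma holomorphic_eq_upper_half_plane:
  assumes f: "f holomorphic_on upper_half_plane" and g: "g holomorphic_on upper_half_plane"
    and eq: "\<And>z. m < Im z \<Longrightarrow> f z = g z" and z: "0 < Im z"
  shows "f z = g z"
proof -
  let ?y = "\<bar>m\<bar> + 1"
  \<comment> \<open>With |m| in place of m this is a subset of the upper half-plane also when m is
    negative.\<close>
  define U where "U = {z. \<bar>m\<bar> < Im z}"
  have "f z - g z = 0"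
  proof (rule analytic_continuation_open[of U upper_half_plane "\<lambda>z. f z - g z" "\<lambda>_. 0"])
    show "open U" unfolding U_def by (rule open_halfspace_Im_gt)
    have "Complex 0 ?y \<in> U" by (simp add: U_def)
    then show "U \<noteq> {}" by blast
    show "connected upper_half_plane" by (rule convex_connected[OF convex_upper_half_plane])
  qed (use z eq in \<open>auto simp: U_def upper_half_plane_def open_halfspace_Im_gt intro!: holomorphic_intros f[unfolded upper_half_plane_def] g[unfolded upper_half_plane_def]\<close>)
  then show ?thesis by simp
qed

lemma real_distribution_eqI:
  assumes "real_distribution \<mu>" "real_distribution \<nu>"
    and "\<And>z. m < Im z \<Longrightarrow> G_transform \<mu> z = G_transform \<nu> z"
  shows "\<mu> = \<nu>"
  using assms holomorphic_eq_upper_half_plane[OF real_distribution.G_holomorphic real_distribution.G_holomorphic, of \<mu> \<nu> m]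
  by (intro G_transform_inject) auto

section \<open>Fibrewise operators on the free product\<close>

text \<open>The estimate behind \<open>summable_split\<close>, now with its bound kept, as operator
  norms are wanted and not just summability.\<close>

lemma split_sum_le:
  fixes g :: "'a word \<Rightarrow> 'a option ell2" and B :: real
  assumes B: "\<And>V. finite V \<Longrightarrow> (\<And>w. w \<in> V \<Longrightarrow> \<not> starts_with j w) \<Longrightarrow> (\<Sum>w\<in>V. (norm (g w))\<^sup>2) \<le> B"
    and A: "finite A"
  shows "(\<Sum>w\<in>A. (cmod (if alternating w then coord (g (snd (split_word j w))) (fst (split_word j w)) else 0))\<^sup>2) \<le> B"
proof -
  let ?A = "{w \<in> A. alternating w}"
  let ?K = "fst ` split_word j ` ?A" and ?V = "snd ` split_word j ` ?A"
  have "(\<Sum>w\<in>A. (cmod (if alternating w then coord (g (snd (split_word j w))) (fst (split_word j w)) else 0))\<^sup>2)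
      = (\<Sum>w\<in>?A. (cmod (coord (g (snd (split_word j w))) (fst (split_word j w))))\<^sup>2)"
    using A by (intro sum.mono_neutral_cong_right) auto
  also have "\<dots> = (\<Sum>(k, w)\<in>split_word j ` ?A. (cmod (coord (g w) k))\<^sup>2)"
    by (subst sum.reindex) (auto simp: case_prod_unfold intro: inj_on_subset[OF inj_on_split])
  also have "\<dots> \<le> (\<Sum>(k, w)\<in>?K \<times> ?V. (cmod (coord (g w) k))\<^sup>2)"
    by (rule sum_mono2[OF _ subset_fst_snd]) (use A in auto)
  also have "\<dots> = (\<Sum>w\<in>?V. \<Sum>k\<in>?K. (cmod (coord (g w) k))\<^sup>2)"
    by (subst sum.swap) (simp add: sum.cartesian_product)
  also have "\<dots> \<le> (\<Sum>w\<in>?V. (norm (g w))\<^sup>2)"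
    using A by (intro sum_mono norm_ell2_sum_le) auto
  also have "\<dots> \<le> B"
    using A by (intro B) (auto simp: not_starts_with_split)
  finally show ?thesis .
qed

text \<open>As \<^const>\<open>free_rep\<close>, but the operator may depend on the word that is left untouched.\<close>

definition fiber_op ::
  "side \<Rightarrow> ('a word \<Rightarrow> 'a option ell2 \<Rightarrow> 'a option ell2) \<Rightarrow> 'a word ell2 \<Rightarrow> 'a word ell2" where
  "fiber_op j a f = Abs_ell2 (\<lambda>w. if alternating w
     then coord (a (snd (split_word j w)) (slice j f (snd (split_word j w)))) (fst (split_word j w)) else 0)"

definition fibers :: "side \<Rightarrow> 'a word set" where
  "fibers j = {w. alternating w \<and> \<not> starts_with j w}"

lemma alternating_glue: "w \<in> fibers j \<Longrightarrow> alternating (glue_word j k w)"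
  by (cases k; cases w) (auto simp: fibers_def alternating_def starts_with_def)

lemma bij_glue: "bij_betw (\<lambda>(w, k). glue_word j k w) (fibers j \<times> UNIV) {w. alternating w}"
proof (rule bij_betwI[where g = "\<lambda>w. (snd (split_word j w), fst (split_word j w))"])
  show "(\<lambda>w. (snd (split_word j w), fst (split_word j w))) \<in> {w. alternating w} \<rightarrow> fibers j \<times> UNIV"
    by (auto simp: fibers_def not_starts_with_split alternating_split)
qed (auto simp: alternating_glue glue_split split_glue fibers_def)

text \<open>Gluing is a bijection between alternating words and pairs of a fibre and a letter or
  \<open>None\<close>; this is the identification of the free product with a tensor product that has
  the factor \<open>j\<close> on the left.\<close>

lemma cinner_slices:
  assumes f: "\<And>w. \<not> alternating w \<Longrightarrow> coord f w = 0"
  shows "cinner f g = (\<Sum>\<^sub>\<infinity>w\<in>fibers j. cinner (slice j f w) (slice j g w))"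
proof -
  let ?F = "\<lambda>w. coord f w * cnj (coord g w)"
  have S: "?F summable_on {w. alternating w}"
    by (rule summable_on_subset_banach[OF cinner_summable]) simp
  have S': "(\<lambda>(w, k). ?F (glue_word j k w)) summable_on fibers j \<times> UNIV"
    using summable_on_reindex_bij_betw[OF bij_glue[of j], of ?F] S by (simp add: case_prod_unfold)
  have "cinner f g = infsum ?F {w. alternating w}"
    unfolding cinner.rep_eq by (rule infsum_cong_neutral) (auto simp: f)
  also have "\<dots> = (\<Sum>\<^sub>\<infinity>(w, k)\<in>fibers j \<times> UNIV. ?F (glue_word j k w))"
    using infsum_reindex_bij_betw[OF bij_glue[of j], of ?F] by (simp add: case_prod_unfold)
  also have "\<dots> = (\<Sum>\<^sub>\<infinity>w\<in>fibers j. \<Sum>\<^sub>\<infinity>k. ?F (glue_word j k w))"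
    using infsum_Sigma'_banach[OF S'] by simp
  finally show ?thesis by (simp add: cinner.rep_eq slice.rep_eq)
qed

lemma slice_add: "slice j (f + g) w = slice j f w + slice j g w"
  and slice_scaleC: "slice j (c *\<^sub>C f) w = c *\<^sub>C slice j f w"
  by (rule ell2_eqI; simp add: slice.rep_eq)+

context
  fixes a :: "'a word \<Rightarrow> 'a option ell2 \<Rightarrow> 'a option ell2" and C :: real
  assumes a: "\<And>w. selfadjoint (a w)" and C: "\<And>w v. norm (a w v) \<le> norm v * C"
begin

lemma fiber_op_sum_le:
  assumes "finite A"
  shows "(\<Sum>w\<in>A. (cmod (if alternating w then coord (a (snd (split_word j w)) (slice j f (snd (split_word j w)))) (fst (split_word j w)) else 0))\<^sup>2) \<le> (norm f * C)\<^sup>2"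
proof (rule split_sum_le[where g = "\<lambda>w. a w (slice j f w)", OF _ assms])
  fix V :: "'a word set" assume V: "finite V" "\<And>w. w \<in> V \<Longrightarrow> \<not> starts_with j w"
  have "(\<Sum>w\<in>V. (norm (a w (slice j f w)))\<^sup>2) \<le> (\<Sum>w\<in>V. (norm (slice j f w))\<^sup>2 * C\<^sup>2)"
    unfolding power_mult_distrib[symmetric] by (intro sum_mono power_mono C) auto
  also have "\<dots> \<le> (norm f)\<^sup>2 * C\<^sup>2"
    unfolding sum_distrib_right[symmetric] by (intro mult_right_mono slices_bound V) auto
  finally show "(\<Sum>w\<in>V. (norm (a w (slice j f w)))\<^sup>2) \<le> (norm f * C)\<^sup>2"
    by (simp add: power_mult_distrib)
qed

lemma coord_fiber_op: "coord (fiber_op j a f) w = (if alternating w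
     then coord (a (snd (split_word j w)) (slice j f (snd (split_word j w)))) (fst (split_word j w)) else 0)"
  unfolding fiber_op_def by (subst coord_Abs_ell2[OF fiber_op_sum_le]) auto

lemma norm_fiber_op: "0 \<le> C \<Longrightarrow> norm (fiber_op j a f) \<le> norm f * C"
  by (rule norm_ell2_leI) (simp_all add: coord_fiber_op fiber_op_sum_le)

lemma slice_fiber_op: "w \<in> fibers j \<Longrightarrow> slice j (fiber_op j a f) w = a w (slice j f w)"
  by (rule ell2_eqI)
    (simp add: slice.rep_eq coord_fiber_op alternating_glue, simp add: split_glue fibers_def)

lemma selfadjoint_fiber_op:
  assumes "0 \<le> C"
  shows "selfadjoint (fiber_op j a)"
proof -
  have lin: "a w (u + v) = a w u + a w v" "a w (c *\<^sub>C u) = c *\<^sub>C a w u" for w u v c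
    using a[of w] by (auto simp: selfadjoint_def bounded_clinear_def linear_simps)
  have "bounded_clinear (fiber_op j a)"
    by (rule bounded_clinearI[where C = C])
      (auto intro!: ell2_eqI norm_fiber_op assms simp: coord_fiber_op slice_add slice_scaleC lin)
  moreover have "cinner (fiber_op j a u) v = cinner u (fiber_op j a v)" for u v
  proof -
    have *: "cinner (fiber_op j a f) g = (\<Sum>\<^sub>\<infinity>w\<in>fibers j. cinner (a w (slice j f w)) (slice j g w))" for f g
      by (subst cinner_slices[where j = j]) (auto simp: coord_fiber_op slice_fiber_op intro!: infsum_cong)
    have "cinner u (fiber_op j a v) = cnj (cinner (fiber_op j a v) u)" by (rule cinner_commute)
    also have "\<dots> = (\<Sum>\<^sub>\<infinity>w\<in>fibers j. cnj (cinner (a w (slice j v w)) (slice j u w)))"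
      unfolding * by (rule infsum_cnj[symmetric])
    also have "\<dots> = (\<Sum>\<^sub>\<infinity>w\<in>fibers j. cinner (a w (slice j u w)) (slice j v w))"
      unfolding cinner_commute[symmetric] using a by (simp add: selfadjoint_def)
    finally show ?thesis unfolding * by simp
  qed
  ultimately show ?thesis by (simp add: selfadjoint_def)
qed

end

section \<open>Coordinate projections and the series of compressions\<close>

definition restr :: "'a set \<Rightarrow> 'a ell2 \<Rightarrow> 'a ell2" where
  "restr A f = Abs_ell2 (\<lambda>w. if w \<in> A then coord f w else 0)"

lemma coord_restr: "coord (restr A f) w = (if w \<in> A then coord f w else 0)"
proof -
  have "(\<Sum>w\<in>B. (cmod (if w \<in> A then coord f w else 0))\<^sup>2) \<le> (norm f)\<^sup>2" if "finite B" for B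
    by (rule order_trans[OF _ norm_ell2_sum_le[OF that]]) (rule sum_mono, simp)
  then show ?thesis unfolding restr_def by (subst coord_Abs_ell2) auto
qed

text \<open>A finite set X of indices carries all but (e/2)^2 of the squared norm, and X is
  eventually contained in \<open>A n\<close>.\<close>

lemma restr_tendsto:
  assumes "\<And>w. \<forall>\<^sub>F n in sequentially. w \<in> A n"
  shows "(\<lambda>n. restr (A n) f) \<longlonglongrightarrow> f"
proof (rule tendstoI)
  fix e :: real assume e: "0 < e"
  have "((\<lambda>i. (cmod (coord f i))\<^sup>2) has_sum (norm f)\<^sup>2) UNIV"
    unfolding norm_ell2_squared by (rule has_sum_infsum[OF summable_ell2])
  then have "\<forall>\<^sub>F X in finite_subsets_at_top UNIV. dist (\<Sum>i\<in>X. (cmod (coord f i))\<^sup>2) ((norm f)\<^sup>2) < (e / 2)\<^sup>2"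
    unfolding has_sum_def using e by (intro tendstoD) auto
  then obtain X where X: "finite X" "dist (\<Sum>i\<in>X. (cmod (coord f i))\<^sup>2) ((norm f)\<^sup>2) < (e / 2)\<^sup>2"
    unfolding eventually_finite_subsets_at_top by blast
  have "\<forall>\<^sub>F n in sequentially. \<forall>w\<in>X. w \<in> A n"
    using X(1) assms by (simp add: eventually_ball_finite)
  then show "\<forall>\<^sub>F n in sequentially. dist (restr (A n) f) f < e"
  proof eventually_elim
    case (elim n)
    have "norm (restr (A n) f - f) \<le> e / 2"
    proof (rule norm_ell2_leI)
      fix B :: "'a set" assume B: "finite B"
      have "(\<Sum>i\<in>B. (cmod (coord (restr (A n) f - f) i))\<^sup>2) \<le> (\<Sum>i\<in>B - X. (cmod (coord f i))\<^sup>2)"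
      proof -
        have "(\<Sum>i\<in>B. (cmod (coord (restr (A n) f - f) i))\<^sup>2) = (\<Sum>i\<in>B - X. (cmod (coord (restr (A n) f - f) i))\<^sup>2)"
          using B elim by (intro sum.mono_neutral_right) (auto simp: coord_restr)
        also have "\<dots> \<le> (\<Sum>i\<in>B - X. (cmod (coord f i))\<^sup>2)"
          by (rule sum_mono) (simp add: coord_restr)
        finally show ?thesis .
      qed
      moreover have "(\<Sum>i\<in>B - X. (cmod (coord f i))\<^sup>2) + (\<Sum>i\<in>X. (cmod (coord f i))\<^sup>2) \<le> (norm f)\<^sup>2"
        using norm_ell2_sum_le[of "(B - X) \<union> X" f] B X(1) by (subst sum.union_disjoint[symmetric]) auto
      ultimately show "(\<Sum>i\<in>B. (cmod (coord (restr (A n) f - f) i))\<^sup>2) \<le> (e / 2)\<^sup>2"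
        using X(2) by (simp add: dist_real_def abs_less_iff)
    qed (use e in simp)
    then show ?case using e by (simp add: dist_norm)
  qed
qed

text \<open>That no other vector qualifies is seen by testing against \<open>ket w\<close> for
  \<open>w\<close> in \<open>B\<close>.\<close>

lemma orth_proj_restr:
  assumes S: "S = {f. \<forall>w. coord f w \<noteq> 0 \<longrightarrow> w \<in> B}"
  shows "orth_proj S v = restr B v"
  unfolding orth_proj_def
proof (rule the_equality, rule conjI)
  show "restr B v \<in> S" by (simp add: S coord_restr)
  show "\<forall>s\<in>S. cinner (v - restr B v) s = 0"
  proof
    fix s assume s: "s \<in> S"
    have "coord (v - restr B v) i * cnj (coord s i) = 0" for i
      using s by (auto simp: S coord_restr)
    then show "cinner (v - restr B v) s = 0" unfolding cinner.rep_eq by (intro infsum_0) (simp only:)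
  qed
next
  fix u assume u: "u \<in> S \<and> (\<forall>s\<in>S. cinner (v - u) s = 0)"
  show "u = restr B v"
  proof (rule ell2_eqI)
    fix w
    show "coord u w = coord (restr B v) w"
    proof (cases "w \<in> B")
      case True
      then have "ket w \<in> S" by (simp add: S coord_ket)
      then have "cinner (v - u) (ket w) = 0" using u by blast
      then show ?thesis using True by (simp add: cinner_ket coord_restr)
    next
      case False
      then show ?thesis using u by (auto simp: S coord_restr)
    qed
  qed
qed

text \<open>Sorted by the length of the part that the factor \<open>j\<close> leaves untouched, the
  two summands in the range of \<open>P_proj j (m + 1)\<close> become one set: \<open>m\<close>
  letters not starting in \<open>j\<close>, or such a word with one letter of \<open>j\<close> in
  front. Note the shift of the index by one.\<close>

definition layer :: "side \<Rightarrow> nat \<Rightarrow> 'a word set" where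
  "layer j m = {w. alternating w \<and> length (snd (split_word j w)) = m}"

lemma layer_cases:
  "w \<in> layer j m \<longleftrightarrow> alternating w \<and> (length w = m \<and> \<not> starts_with j w \<or> length w = Suc m \<and> \<not> starts_with (other j) w)"
proof (cases w)
  case (Cons p w')
  obtain k i where p: "p = (k, i)" by (cases p)
  show ?thesis unfolding Cons p
    by (cases j; cases k) (auto simp: layer_def starts_with_def)
qed (auto simp: layer_def starts_with_def)

lemma P_proj_restr: "P_proj j (Suc m) = restr (layer j m)"
proof
  fix v :: "'a word ell2"
  have "{u + v | u v. u \<in> level (Suc m - 1) j \<and> v \<in> level (Suc m) (other j)}
      = {f. \<forall>w. coord f w \<noteq> 0 \<longrightarrow> w \<in> (layer j m :: 'a word set)}" (is "?L = ?R")
  proof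
    show "?L \<subseteq> ?R" by (auto simp: level_def layer_cases) (metis add_0)+
    show "?R \<subseteq> ?L"
    proof
      fix f :: "'a word ell2" assume f: "f \<in> ?R"
      have "f = restr {w. length w = m} f + restr {w. length w = Suc m} f"
        using f by (intro ell2_eqI) (auto simp: coord_restr layer_cases)
      moreover have "restr {w. length w = m} f \<in> level (Suc m - 1) j"
        "restr {w. length w = Suc m} f \<in> level (Suc m) (other j)"
        using f by (auto simp: level_def coord_restr layer_cases)
      ultimately show "f \<in> ?L" by blast
    qed
  qed
  then show "P_proj j (Suc m) v = restr (layer j m) v"
    unfolding P_proj_def by (rule orth_proj_restr)
qed

text \<open>A layer is a union of whole slices, so projecting beforehand does not change the slices
  that the representation acts on. The compression is thus \<open>free_rep\<close> cut down to one
  layer.\<close>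

lemma coord_compression:
  assumes a: "bounded_clinear a"
  shows "coord (compression j a (Suc m) f) w = (if w \<in> layer j m
     then coord (a (slice j f (snd (split_word j w)))) (fst (split_word j w)) else 0)"
proof (cases "w \<in> layer j m")
  case True
  let ?w = "snd (split_word j w)"
  have w: "alternating w" using True by (simp add: layer_def)
  have fib: "?w \<in> fibers j" using w by (simp add: fibers_def not_starts_with_split alternating_split)
  have "slice j (restr (layer j m) f) ?w = slice j f ?w"
  proof (rule ell2_eqI)
    fix k
    have "glue_word j k ?w \<in> layer j m"
      using True alternating_glue[OF fib, of k] split_glue[OF not_starts_with_split[OF w], of j k] by (simp add: layer_def)
    then show "coord (slice j (restr (layer j m) f) ?w) k = coord (slice j f ?w) k"
      by (simp add: slice.rep_eq coord_restr)
  qed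
  then show ?thesis
    using True w by (simp add: compression_def P_proj_restr coord_restr coord_free_rep[OF a])
qed (simp add: compression_def P_proj_restr coord_restr)

text \<open>Different compressions act on disjoint layers, so a partial sum is the full fibrewise
  operator with the layers from \<open>N\<close> on erased; strong convergence is then
  \<open>restr_tendsto\<close>.\<close>

lemma compression_sums:
  assumes a: "selfadjoint a" and inj: "inj r" and D: "D = range r"
  shows "(\<lambda>n. compression j a (Suc (r n)) f) sums fiber_op j (\<lambda>w. if length w \<in> D then a else (\<lambda>_. 0)) f"
    (is "_ sums ?F")
proof -
  have bl: "bounded_clinear a" using a by (simp add: selfadjoint_def)
  obtain C where C: "0 < C" "\<And>v. norm (a v) \<le> norm v * C"
    using bounded_linear.pos_bounded[OF selfadjoint_bounded_linear[OF a]] by blast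
  have cF: "coord ?F w = (if alternating w \<and> length (snd (split_word j w)) \<in> D then coord (a (slice j f (snd (split_word j w)))) (fst (split_word j w)) else 0)" for w
    by (subst coord_fiber_op[where C = C]) (use a selfadjoint_zero C in auto)
  have "(\<Sum>n<N. compression j a (Suc (r n)) f) = restr {w. length (snd (split_word j w)) \<notin> r ` {N..}} ?F" for N
  proof (rule ell2_eqI)
    fix w :: "'a word"
    let ?m = "length (snd (split_word j w))"
    show "coord (\<Sum>n<N. compression j a (Suc (r n)) f) w = coord (restr {w. length (snd (split_word j w)) \<notin> r ` {N..}} ?F) w"
    proof (cases "alternating w \<and> ?m \<in> D")
      case True
      then obtain k where k: "?m = r k" using D by blast
      have lr: "w \<in> layer j (r n) \<longleftrightarrow> n = k" for n
        using True k by (auto simp: layer_def inj_eq[OF inj])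
      have lN: "?m \<notin> r ` {N..} \<longleftrightarrow> k < N"
        unfolding k by (simp add: inj_image_mem_iff[OF inj] not_le)
      have "coord (\<Sum>n<N. compression j a (Suc (r n)) f) w
          = (\<Sum>n<N. if n = k then coord (a (slice j f (snd (split_word j w)))) (fst (split_word j w)) else 0)"
        unfolding coord_sum coord_compression[OF bl] lr ..
      also have "\<dots> = (if k < N then coord (a (slice j f (snd (split_word j w)))) (fst (split_word j w)) else 0)"
        by simp
      also have "\<dots> = coord (restr {w. length (snd (split_word j w)) \<notin> r ` {N..}} ?F) w"
        unfolding coord_restr cF mem_Collect_eq lN using True by simp
      finally show ?thesis .
    next
      case False
      then have "w \<notin> layer j (r n)" for n using D by (auto simp: layer_def)
      then show ?thesis
        unfolding coord_restr cF coord_sum coord_compression[OF bl] using False by auto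
    qed
  qed
  moreover have "(\<lambda>N. restr {w. length (snd (split_word j w)) \<notin> r ` {N..}} ?F) \<longlonglongrightarrow> ?F"
  proof (rule restr_tendsto)
    fix w :: "'a word"
    let ?m = "length (snd (split_word j w))"
    show "\<forall>\<^sub>F N in sequentially. w \<in> {w. length (snd (split_word j w)) \<notin> r ` {N..}}"
    proof (cases "?m \<in> range r")
      case True
      then obtain k where k: "?m = r k" by blast
      have "?m \<notin> r ` {N..} \<longleftrightarrow> k < N" for N
        unfolding k by (simp add: inj_image_mem_iff[OF inj] not_le)
      then show ?thesis by (simp add: eventually_gt_at_top)
    next
      case False
      then have "?m \<notin> r ` {N..}" for N by blast
      then show ?thesis by simp
    qed
  qed
  ultimately show ?thesis by (simp add: sums_def)
qed

text \<open>
  On the words that can be reached from the vacuum, the \<open>n\<close>-th operator acts between the words of length \<open>n\<close>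
  and those of length \<open>n + 1\<close>.  Alternating two operators gives the s-free operator; keeping only the
  first two operators gives an operator whose distribution is the orthogonal convolution.
\<close>

definition tower :: "(nat \<Rightarrow> 'a option ell2 \<Rightarrow> 'a option ell2) \<Rightarrow> 'a word ell2 \<Rightarrow> 'a word ell2" where
  "tower a f = fiber_op First (\<lambda>w. if even (length w) then a (length w) else (\<lambda>_. 0)) f
     + fiber_op Second (\<lambda>w. if odd (length w) then a (length w) else (\<lambda>_. 0)) f"

lemma sfree_op_tower:
  assumes "selfadjoint x1" "selfadjoint x2"
  shows "sfree_op x1 x2 = tower (\<lambda>n. if even n then x1 else x2)"
proof
  fix v :: "'a word ell2"
  \<comment> \<open>Because of the index shift x1(2r+1) lives on the layer 2r and x2(2r+2) on the
    layer 2r+1, so the parity of the untouched length selects the operator.\<close>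
  have "(\<lambda>r. compression First x1 (Suc (2 * r)) v) sums fiber_op First (\<lambda>w. if length w \<in> {n. even n} then x1 else (\<lambda>_. 0)) v"
    by (rule compression_sums[OF assms(1)]) (auto simp: inj_on_def elim!: evenE)
  moreover have "(\<lambda>r. compression Second x2 (Suc (2 * r + 1)) v) sums fiber_op Second (\<lambda>w. if length w \<in> {n. odd n} then x2 else (\<lambda>_. 0)) v"
    by (rule compression_sums[OF assms(2)]) (auto simp: inj_on_def elim!: oddE)
  moreover have "(\<lambda>w::'a word. if even (length w) then if even (length w) then x1 else x2 else (\<lambda>_. 0))
      = (\<lambda>w. if length w \<in> {n. even n} then x1 else (\<lambda>_. 0))"
    "(\<lambda>w::'a word. if odd (length w) then if even (length w) then x1 else x2 else (\<lambda>_. 0))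
      = (\<lambda>w. if length w \<in> {n. odd n} then x2 else (\<lambda>_. 0))"
    by auto
  ultimately show "sfree_op x1 x2 v = tower (\<lambda>n. if even n then x1 else x2) v"
    unfolding sfree_op_def tower_def by (simp add: sums_iff)
qed

context
  fixes a :: "nat \<Rightarrow> 'a option ell2 \<Rightarrow> 'a option ell2" and C :: real
  assumes a: "\<And>n. selfadjoint (a n)" and C: "\<And>n v. norm (a n v) \<le> norm v * C" "0 \<le> C"
begin

lemma tower_summand: "selfadjoint (if P then a n else (\<lambda>_. 0))" "norm ((if P then a n else (\<lambda>_. 0)) v) \<le> norm v * C"
  using a C selfadjoint_zero by auto

lemma selfadjoint_tower: "selfadjoint (tower a)"
  unfolding tower_def[abs_def]
  by (intro selfadjoint_add selfadjoint_fiber_op[where C = C] tower_summand C)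

lemma norm_tower: "norm (tower a f) \<le> norm f * (2 * C)"
proof -
  have "norm (tower a f) \<le> norm f * C + norm f * C"
    unfolding tower_def by (intro norm_triangle_le add_mono norm_fiber_op tower_summand C)
  then show ?thesis by (simp only: mult.left_commute mult.assoc mult_2 distrib_left)
qed

lemma coord_tower:
  "coord (tower a f) w = (if alternating w then
     (if even (length (snd (split_word First w))) then coord (a (length (snd (split_word First w))) (slice First f (snd (split_word First w)))) (fst (split_word First w)) else 0)
   + (if odd (length (snd (split_word Second w))) then coord (a (length (snd (split_word Second w))) (slice Second f (snd (split_word Second w)))) (fst (split_word Second w)) else 0) else 0)"
  unfolding tower_def by (simp add: coord_fiber_op[where C = C, OF tower_summand])

end

section \<open>The resolvent of a tower\<close>

text \<open>The factor of a letter that has \<open>n\<close> letters to its right. Counting from the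
  right is natural because the operators add and remove letters on the left.\<close>

definition side_of :: "nat \<Rightarrow> side" where
  "side_of n = (if even n then First else Second)"

lemma side_of_Suc: "side_of (Suc n) = other (side_of n)"
  by (simp add: side_of_def)

lemma other_neq [simp]: "other j \<noteq> j" "j \<noteq> other j"
  by (cases j; simp)+

lemma neq_iff_other: "i \<noteq> j \<longleftrightarrow> i = other j"
  by (cases i; cases j; simp)

lemma side_of_eq [simp]: "side_of n = First \<longleftrightarrow> even n" "side_of n = Second \<longleftrightarrow> odd n"
  "First = side_of n \<longleftrightarrow> even n" "Second = side_of n \<longleftrightarrow> odd n"
  by (auto simp: side_of_def)

text \<open>The empty word and the alternating words whose last letter is in \<open>First\<close>.
  By \<open>coord_tower_nonreach\<close> a tower takes its values in their span.\<close>

primrec reach :: "'a word \<Rightarrow> bool" where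
  "reach [] = True"
| "reach (p # w) = (fst p = side_of (length w) \<and> reach w)"

lemma alternating_Cons: "alternating (p # w) \<longleftrightarrow> (w = [] \<or> fst p \<noteq> fst (hd w)) \<and> alternating w"
  by (cases w) (auto simp: alternating_def)

lemma reach_alternating: "reach w \<Longrightarrow> alternating w"
proof (induction w)
  case (Cons p w)
  then show ?case
    by (cases w) (auto simp: alternating_Cons side_of_Suc)
qed (simp add: alternating_def)

lemma reachI: "alternating w \<Longrightarrow> w = [] \<or> fst (hd w) = side_of (length w - 1) \<Longrightarrow> reach w"
proof (induction w)
  case (Cons p w)
  have "w = [] \<or> fst (hd w) = side_of (length w - 1)"
  proof (cases w)
    case (Cons q w')
    then have "fst q \<noteq> side_of (Suc (length w'))"
      using Cons.prems by (auto simp: alternating_Cons)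
    then show ?thesis unfolding side_of_Suc neq_iff_other Cons
      by (cases "side_of (length w')") (auto simp: neq_iff_other)
  qed simp
  then show ?case using Cons by (auto simp: alternating_Cons)
qed simp

text \<open>A factor \<open>j\<close> is active only on layers of its own parity, and words in such
  layers are reachable. The contrapositive shows that neither factor contributes at an unreachable
  word.\<close>

lemma reach_split:
  assumes "alternating w" "side_of (length (snd (split_word j w))) = j"
  shows "reach w"
proof (rule reachI[OF assms(1)], cases w)
  case (Cons p w')
  obtain k i where p: "p = (k, i)" by (cases p)
  show "w = [] \<or> fst (hd w) = side_of (length w - 1)"
  proof (cases "k = j")
    case False
    then have "other (side_of (length w')) = j" "k = other j"
      using assms(2) unfolding Cons p by (auto simp: side_of_Suc neq_iff_other)
    then show ?thesis unfolding Cons p by (cases "side_of (length w')"; cases j) auto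
  qed (use assms(2) in \<open>simp add: Cons p\<close>)
qed simp

lemma split_reach_None: "reach w \<Longrightarrow> split_word (side_of (length w)) w = (None, w)"
  by (cases w; cases "hd w") (auto simp: side_of_Suc)

lemma split_reach_Some: "reach (p # w) \<Longrightarrow> split_word (side_of (length w)) (p # w) = (Some (snd p), w)"
  by (cases p) auto

lemma bounded_clinear_funpow:
  fixes A :: "'a ell2 \<Rightarrow> 'a ell2"
  shows "bounded_clinear A \<Longrightarrow> (A ^^ n) (u + v) = (A ^^ n) u + (A ^^ n) v \<and> (A ^^ n) (c *\<^sub>C v) = c *\<^sub>C (A ^^ n) v"
  by (induction n) (auto simp: bounded_clinear_def linear_simps)

lemma norm_funpow_le:
  fixes A :: "'a::real_normed_vector \<Rightarrow> 'a"
  assumes "\<And>v. norm (A v) \<le> norm v * C" "0 \<le> C"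
  shows "norm ((A ^^ n) v) \<le> norm v * C ^ n"
proof (induction n)
  case (Suc n)
  have "norm (A ((A ^^ n) v)) \<le> norm ((A ^^ n) v) * C" by (rule assms)
  also have "\<dots> \<le> (norm v * C ^ n) * C" by (intro mult_right_mono Suc assms)
  finally show ?case by (simp add: mult_ac)
qed simp

text \<open>
  If \<open>T u = z u - c \<xi>\<close> and the \<open>\<xi>\<close>-coordinate of \<open>u\<close> is \<open>1\<close>, then \<open>u\<close> is \<open>c\<close> times
  the resolvent of \<open>T\<close> at \<open>z\<close> applied to \<open>\<xi>\<close>.
\<close>

lemma G_transform_from_solution:
  assumes T: "bounded_clinear T" "\<And>v. norm (T v) \<le> norm v * B" "0 \<le> B"
    and d: "has_distribution T (ket i) \<rho>" and R: "compact_distribution \<rho> R"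
    and z: "0 < Im z" "R < cmod z" "B < cmod z"
    and u: "T u = z *\<^sub>C u - c *\<^sub>C ket i" "coord u i = 1"
  shows "c * G_transform \<rho> z = 1"
proof -
  interpret compact_distribution \<rho> R by (rule R)
  have z0: "z \<noteq> 0" using z(1) by auto
  have mom: "coord ((T ^^ n) (ket i)) i = complex_of_real (\<integral>x. x ^ n \<partial>\<rho>)" for n
    using d by (simp add: has_distribution_def cinner_ket)
  have step: "z * coord ((T ^^ n) u) i = coord ((T ^^ Suc n) u) i + c * coord ((T ^^ n) (ket i)) i" for n
  proof -
    have "z *\<^sub>C u = T u + c *\<^sub>C ket i" unfolding u(1) by simp
    then have "(T ^^ n) (z *\<^sub>C u) = (T ^^ n) (T u + c *\<^sub>C ket i)" by simp
    then have "z *\<^sub>C (T ^^ n) u = (T ^^ n) (T u) + c *\<^sub>C (T ^^ n) (ket i)"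
      unfolding bounded_clinear_funpow[OF T(1), THEN conjunct1] bounded_clinear_funpow[OF T(1), THEN conjunct2] .
    then have "coord (z *\<^sub>C (T ^^ n) u) i = coord ((T ^^ n) (T u) + c *\<^sub>C (T ^^ n) (ket i)) i" by simp
    then show ?thesis by (simp add: funpow_swap1)
  qed
  \<comment> \<open>By \<open>step\<close> the moment series telescopes; the remainder decays like
    (B/|z|)^N.\<close>
  have eq: "c * (\<Sum>n<N. complex_of_real (\<integral>x. x ^ n \<partial>\<rho>) / z ^ Suc n) = 1 - coord ((T ^^ N) u) i / z ^ N" for N
  proof (induction N)
    case (Suc N)
    have "coord ((T ^^ N) u) i / z ^ N = (z * coord ((T ^^ N) u) i) / z ^ Suc N"
      using z0 by simp
    also have "\<dots> = coord ((T ^^ Suc N) u) i / z ^ Suc N + c * (complex_of_real (\<integral>x. x ^ N \<partial>\<rho>) / z ^ Suc N)"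
      unfolding step mom by (simp add: add_divide_distrib)
    finally show ?case using Suc by (simp add: distrib_left algebra_simps)
  qed (simp add: u(2))
  have "(\<lambda>N. 1 - coord ((T ^^ N) u) i / z ^ N) \<longlonglongrightarrow> 1 - 0"
  proof (rule tendsto_diff[OF tendsto_const], rule Lim_null_comparison)
    show "\<forall>\<^sub>F N in sequentially. norm (coord ((T ^^ N) u) i / z ^ N) \<le> norm u * (B / cmod z) ^ N"
    proof (intro always_eventually allI)
      fix N
      have "norm (coord ((T ^^ N) u) i) \<le> norm u * B ^ N"
        by (rule order_trans[OF norm_coord_le norm_funpow_le[OF T(2,3)]])
      then show "norm (coord ((T ^^ N) u) i / z ^ N) \<le> norm u * (B / cmod z) ^ N"
        by (simp add: norm_divide norm_power power_divide divide_right_mono)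
    qed
    have "(\<lambda>N. norm u * (B / cmod z) ^ N) \<longlonglongrightarrow> norm u * 0"
      using z T(3) by (intro tendsto_mult LIMSEQ_power_zero tendsto_const) (auto simp: divide_less_eq)
    then show "(\<lambda>N. norm u * (B / cmod z) ^ N) \<longlonglongrightarrow> 0" by simp
  qed
  moreover have "(\<lambda>N. c * (\<Sum>n<N. complex_of_real (\<integral>x. x ^ n \<partial>\<rho>) / z ^ Suc n)) \<longlonglongrightarrow> c * G_transform \<rho> z"
    using G_sums[OF z(1,2)] unfolding sums_def by (intro tendsto_mult tendsto_const)
  ultimately have "1 - 0 = c * G_transform \<rho> z" unfolding eq by (rule LIMSEQ_unique)
  then show ?thesis by simp
qed

lemma bounded_linear_coord: "bounded_linear (\<lambda>f. coord f i)"
  by (rule bounded_linear_intro[where K = 1]) (simp_all add: norm_coord_le scaleR_conv_of_real)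

lemma bounded_linear_scaleC: "bounded_linear (\<lambda>f. c *\<^sub>C f)"
  by (rule bounded_linear_intro[where K = "cmod c"])
    (auto intro!: ell2_eqI simp: norm_scaleC_ell2 algebra_simps)

text \<open>\<open>h\<close> is the Neumann series s of the resolvent at the unit vector, divided by
  its coordinate G. With q the norm of s, |w| q <= 1 + Cq and 1 <= |w||G| + Cq; as 12 C <= |w|, this
  gives q <= (6/5)|G|, and 36/25 < 3/2. The value 3/2 leaves 1/2 for the coordinates other than
  \<open>None\<close>.\<close>

lemma resolvent_vector:
  assumes x: "selfadjoint x" "\<And>v. norm (x v) \<le> norm v * C" "0 < C"
    and d: "has_distribution x (ket i) \<mu>" and R: "compact_distribution \<mu> R"
    and w: "0 < Im w" "R < cmod w" "12 * C \<le> cmod w"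
  obtains h where "x h = w *\<^sub>C h - F_transform \<mu> w *\<^sub>C ket i" "coord h i = 1" "(norm h)\<^sup>2 \<le> 3 / 2"
proof -
  interpret compact_distribution \<mu> R by (rule R)
  let ?G = "G_transform \<mu> w"
  have w0: "w \<noteq> 0" using w(1) by auto
  have G0: "?G \<noteq> 0" by (rule G_nonzero[OF w(1)])
  have lin: "x (c *\<^sub>C v) = c *\<^sub>C x v" for c v using x(1) by (simp add: selfadjoint_def bounded_clinear_def)
  define f where "f n = (1 / w ^ Suc n) *\<^sub>C (x ^^ n) (ket i)" for n
  have "summable f"
  proof (rule summable_comparison_test')
    show "summable (\<lambda>n. 1 / cmod w * (C / cmod w) ^ n)"
      using w x(3) by (intro summable_mult summable_geometric) (auto simp: divide_less_eq)
    show "norm (f n) \<le> 1 / cmod w * (C / cmod w) ^ n" for n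
    proof -
      have "norm ((x ^^ n) (ket i)) \<le> C ^ n" using norm_funpow_le[OF x(2), of n "ket i"] x(3) by (simp add: norm_ket)
      then show ?thesis
        by (simp add: f_def norm_scaleC_ell2 norm_divide norm_mult norm_power power_divide divide_right_mono)
    qed
  qed
  then obtain s where s: "f sums s" unfolding summable_def by blast
  have f0: "w *\<^sub>C f 0 = ket i" using w0 by (intro ell2_eqI) (simp add: f_def)
  have fS: "x (f n) = w *\<^sub>C f (Suc n)" for n
    using w0 by (intro ell2_eqI) (simp add: f_def lin)
  have "(\<lambda>n. x (f n)) sums x s"
    by (rule bounded_linear.sums[OF selfadjoint_bounded_linear[OF x(1)] s])
  moreover have "(\<lambda>n. w *\<^sub>C f (Suc n)) sums (w *\<^sub>C (s - f 0))"
    using s by (intro bounded_linear.sums[OF bounded_linear_scaleC]) (simp add: sums_Suc_iff)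
  ultimately have "x s = w *\<^sub>C (s - f 0)" unfolding fS by (rule sums_unique2)
  also have "\<dots> = w *\<^sub>C s - ket i"
    unfolding f0[symmetric] by (rule ell2_eqI) (simp add: right_diff_distrib)
  finally have xs: "x s = w *\<^sub>C s - ket i" .
  have "(\<lambda>n. coord (f n) i) sums coord s i"
    by (rule bounded_linear.sums[OF bounded_linear_coord s])
  moreover have "coord (f n) i = complex_of_real (\<integral>x. x ^ n \<partial>\<mu>) / w ^ Suc n" for n
    using d by (simp add: f_def has_distribution_def cinner_ket)
  ultimately have si: "coord s i = ?G"
    using G_sums[OF w(1,2)] by (simp add: sums_unique2)
  define h where "h = (1 / ?G) *\<^sub>C s"
  have "x h = w *\<^sub>C h - F_transform \<mu> w *\<^sub>C ket i"
    unfolding h_def lin xs F_transform_def by (rule ell2_eqI) (simp add: right_diff_distrib)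
  moreover have "coord h i = 1" using G0 by (simp add: h_def si)
  moreover have "(norm h)\<^sup>2 \<le> 3 / 2"
  proof -
    let ?q = "norm s"
    have 1: "cmod w * ?q \<le> 1 + C * ?q"
    proof -
      have "w *\<^sub>C s = x s + ket i" unfolding xs by simp
      then have "norm (w *\<^sub>C s) \<le> norm (x s) + norm (ket i)" by (simp only: norm_triangle_ineq)
      then show ?thesis using x(2)[of s] by (simp add: norm_scaleC_ell2 norm_ket mult.commute)
    qed
    have 2: "1 \<le> cmod w * cmod ?G + C * ?q"
    proof -
      have "w * ?G = coord (x s) i + 1" unfolding xs by (simp add: si coord_ket)
      then have "1 = w * ?G - coord (x s) i" by simp
      then have "cmod 1 \<le> cmod (w * ?G) + cmod (coord (x s) i)"
        using norm_triangle_ineq4[of "w * ?G" "coord (x s) i"] by simp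
      also have "cmod (coord (x s) i) \<le> ?q * C" by (rule order_trans[OF norm_coord_le x(2)])
      finally show ?thesis by (simp add: norm_mult mult.commute)
    qed
    have "12 * (C * ?q) \<le> cmod w * ?q" using mult_right_mono[OF w(3), of ?q] by simp
    then have "cmod w * ?q \<le> 6 / 5 * (cmod w * cmod ?G)" using 1 2 by linarith
    then have "cmod w * ?q \<le> cmod w * (6 / 5 * cmod ?G)" by simp
    then have "?q \<le> 6 / 5 * cmod ?G" using w0 by (subst (asm) mult_le_cancel_left_pos) auto
    then have "norm h \<le> 6 / 5" using G0 by (simp add: h_def norm_scaleC_ell2 norm_divide divide_le_eq)
    then have "(norm h)\<^sup>2 \<le> (6 / 5)\<^sup>2" by (rule power_mono) simp
    then show ?thesis by (simp add: power2_eq_square)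
  qed
  ultimately show thesis by (rule that)
qed

text \<open>
  The equation \<open>(z - T) u = c \<xi>\<close> for a tower \<open>T\<close> has a product solution: the letter at height \<open>n\<close>
  contributes a coordinate of the vector \<open>h\<^sub>n\<close> with \<open>a\<^sub>n h\<^sub>n = W\<^sub>n h\<^sub>n - F\<^sub>n \<xi>\<^sub>n\<close> and \<open>\<xi>\<^sub>n\<close>-coordinate \<open>1\<close>.
\<close>

primrec word_prod :: "(nat \<Rightarrow> 'a option ell2) \<Rightarrow> 'a word \<Rightarrow> complex" where
  "word_prod h [] = 1"
| "word_prod h (p # w) = (if fst p = side_of (length w) then word_prod h w * coord (h (length w)) (Some (snd p)) else 0)"

lemma word_prod_nonreach: "\<not> reach w \<Longrightarrow> word_prod h w = 0"
  by (induction w) auto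

context
  fixes h :: "nat \<Rightarrow> 'a option ell2"
  assumes h1: "\<And>n. coord (h n) None = 1" and hn: "\<And>n. (norm (h n))\<^sup>2 \<le> 3 / 2"
begin

lemma unit_tail_sum: "finite B \<Longrightarrow> (\<Sum>b\<in>B. (cmod (coord (h n) (Some b)))\<^sup>2) \<le> 1 / 2"
proof -
  assume B: "finite B"
  have "(\<Sum>k\<in>insert None (Some ` B). (cmod (coord (h n) k))\<^sup>2) \<le> 3 / 2"
    using norm_ell2_sum_le[of "insert None (Some ` B)" "h n"] B hn[of n] by simp
  then show ?thesis using B h1 by (simp add: sum.reindex)
qed

text \<open>Enlarging the set of words to a rectangle of first letters and tails makes the sum
  factor; the letters contribute at most 1/2 by \<open>unit_tail_sum\<close>.\<close>

lemma word_prod_length_sum: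
  "finite A \<Longrightarrow> (\<And>w. w \<in> A \<Longrightarrow> length w = n) \<Longrightarrow> (\<Sum>w\<in>A. (cmod (word_prod h w))\<^sup>2) \<le> (1 / 2) ^ n"
proof (induction n arbitrary: A)
  case 0
  then have "A \<subseteq> {[]}" by auto
  then show ?case by (auto simp: subset_singleton_iff)
next
  case (Suc n)
  let ?A = "{w \<in> A. fst (hd w) = side_of n}"
  let ?B = "(\<lambda>w. snd (hd w)) ` A" and ?A' = "tl ` A"
  let ?\<phi> = "\<lambda>w. (snd (hd w), tl w)"
  have decomp: "w = (side_of n, snd (hd w)) # tl w \<and> length (tl w) = n" if "w \<in> ?A" for w
    using that Suc.prems(2)[of w] by (cases w) auto
  have "(\<Sum>w\<in>A. (cmod (word_prod h w))\<^sup>2) = (\<Sum>w\<in>?A. (cmod (word_prod h w))\<^sup>2)"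
  proof (rule sum.mono_neutral_right)
    show "\<forall>w\<in>A - ?A. (cmod (word_prod h w))\<^sup>2 = 0"
    proof
      fix w assume "w \<in> A - ?A"
      then show "(cmod (word_prod h w))\<^sup>2 = 0" using Suc.prems(2)[of w] by (cases w) auto
    qed
  qed (use Suc.prems in auto)
  also have "\<dots> = (\<Sum>w\<in>?A. (cmod (coord (h n) (Some (snd (hd w)))))\<^sup>2 * (cmod (word_prod h (tl w)))\<^sup>2)"
  proof (rule sum.cong[OF refl])
    fix w assume w: "w \<in> ?A"
    have "word_prod h w = word_prod h (tl w) * coord (h n) (Some (snd (hd w)))"
      using decomp[OF w] by (metis fst_conv snd_conv word_prod.simps(2))
    then show "(cmod (word_prod h w))\<^sup>2 = (cmod (coord (h n) (Some (snd (hd w)))))\<^sup>2 * (cmod (word_prod h (tl w)))\<^sup>2"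
      by (simp add: norm_mult power_mult_distrib mult.commute)
  qed
  also have "\<dots> = (\<Sum>(b, w)\<in>?\<phi> ` ?A. (cmod (coord (h n) (Some b)))\<^sup>2 * (cmod (word_prod h w))\<^sup>2)"
  proof (subst sum.reindex)
    show "inj_on ?\<phi> ?A" using decomp by (auto intro!: inj_onI) metis
  qed simp
  also have "\<dots> \<le> (\<Sum>(b, w)\<in>?B \<times> ?A'. (cmod (coord (h n) (Some b)))\<^sup>2 * (cmod (word_prod h w))\<^sup>2)"
    by (rule sum_mono2) (use Suc.prems in auto)
  also have "\<dots> = (\<Sum>b\<in>?B. (cmod (coord (h n) (Some b)))\<^sup>2) * (\<Sum>w\<in>?A'. (cmod (word_prod h w))\<^sup>2)"
    by (simp add: sum_product sum.cartesian_product)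
  also have "\<dots> \<le> (1 / 2) * (1 / 2) ^ n"
    using Suc.prems by (intro mult_mono unit_tail_sum Suc.IH) (auto intro: sum_nonneg)
  finally show ?case by simp
qed

lemma word_prod_sum:
  assumes "finite A"
  shows "(\<Sum>w\<in>A. (cmod (word_prod h w))\<^sup>2) \<le> 2"
proof -
  have "(\<Sum>w\<in>A. (cmod (word_prod h w))\<^sup>2) = (\<Sum>n\<in>length ` A. \<Sum>w\<in>{w \<in> A. length w = n}. (cmod (word_prod h w))\<^sup>2)"
    by (rule sum.group[symmetric]) (use assms in auto)
  also have "\<dots> \<le> (\<Sum>n\<in>length ` A. (1 / 2) ^ n)"
    using assms by (intro sum_mono word_prod_length_sum) auto
  also have "\<dots> \<le> (\<Sum>n. (1 / 2 :: real) ^ n)"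
    using assms by (intro sum_le_suminf summable_geometric) auto
  also have "\<dots> = 2" by (subst suminf_geometric) auto
  finally show ?thesis .
qed

definition word_vec :: "'a word ell2" where "word_vec = Abs_ell2 (word_prod h)"

lemma coord_word_vec: "coord word_vec w = word_prod h w"
  unfolding word_vec_def by (subst coord_Abs_ell2[OF word_prod_sum]) auto

text \<open>The reason for the product form: each slice is a multiple of one vector
  \<open>h n\<close>, on which the operator at that height is understood. The normalisation
  \<open>h1\<close> accounts for the entry at \<open>None\<close>.\<close>

lemma slice_word_vec: "slice (side_of (length w)) word_vec w = word_prod h w *\<^sub>C h (length w)"
proof (rule ell2_eqI)
  show "coord (slice (side_of (length w)) word_vec w) k = coord (word_prod h w *\<^sub>C h (length w)) k" for k
    by (cases k) (simp_all add: slice.rep_eq coord_word_vec h1)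
qed

end

text \<open>Two fibres meet in a reachable word: in one the whole word is untouched and the unit
  vector is read off, in the other its tail is untouched and the first letter is read off.\<close>

lemma coord_tower_reach:
  assumes a: "\<And>n. selfadjoint (a n)" "\<And>n v. norm (a n v) \<le> norm v * C" "0 \<le> C" and w: "reach w"
  shows "coord (tower a f) w = coord (a (length w) (slice (side_of (length w)) f w)) None
     + (case w of [] \<Rightarrow> 0 | p # w' \<Rightarrow> coord (a (length w') (slice (side_of (length w')) f w')) (Some (snd p)))"
proof (cases w)
  case Nil
  then show ?thesis
    using w unfolding coord_tower[where C = C, OF a] by (simp add: side_of_def alternating_def)
next
  case (Cons p w')
  note s = split_reach_None[OF w] split_reach_Some[OF w[unfolded Cons]]
  show ?thesis
  proof (cases "even (length w')")
    case True
    then have sd: "side_of (length w') = First" "side_of (Suc (length w')) = Second" by simp_all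
    show ?thesis using reach_alternating[OF w] True s[unfolded Cons length_Cons sd]
      unfolding coord_tower[where C = C, OF a] Cons length_Cons list.case sd by simp
  next
    case False
    then have sd: "side_of (length w') = Second" "side_of (Suc (length w')) = First" by simp_all
    show ?thesis using reach_alternating[OF w] False s[unfolded Cons length_Cons sd]
      unfolding coord_tower[where C = C, OF a] Cons length_Cons list.case sd by simp
  qed
qed

lemma coord_tower_nonreach:
  assumes a: "\<And>n. selfadjoint (a n)" "\<And>n v. norm (a n v) \<le> norm v * C" "0 \<le> C" and w: "\<not> reach w"
  shows "coord (tower a f) w = 0"
proof (cases "alternating w")
  case True
  then have "side_of (length (snd (split_word j w))) \<noteq> j" for j
    using reach_split w by blast
  from this[of First] this[of Second] show ?thesis
    unfolding coord_tower[where C = C, OF a] by simp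
qed (simp add: coord_tower[where C = C, OF a])

text \<open>At a word of length \<open>n + 1\<close> the operator acting on the first letter
  contributes the factor \<open>W n\<close>, the one above it \<open>W (Suc n) - F (Suc n)\<close>;
  \<open>rec\<close> makes their sum z. The empty word has only the factor \<open>W 0 - F 0\<close>,
  and its defect against z is the multiple of the vacuum.\<close>

theorem tower_G_transform:
  assumes a: "\<And>n. selfadjoint (a n)" "\<And>n v. norm (a n v) \<le> norm v * C" "0 \<le> C"
    and h: "\<And>n. a n (h n) = W n *\<^sub>C h n - F n *\<^sub>C ket None" "\<And>n. coord (h n) None = 1"
      "\<And>n. (norm (h n))\<^sup>2 \<le> 3 / 2"
    and rec: "\<And>n. W n + (W (Suc n) - F (Suc n)) = z"
    and d: "has_distribution (tower a) vacuum \<rho>" and R: "compact_distribution \<rho> R"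
    and z: "0 < Im z" "R < cmod z" "2 * C < cmod z"
  shows "F_transform \<rho> z = z - (W 0 - F 0)"
proof -
  let ?u = "word_vec h"
  note cu = coord_word_vec[of h, OF h(2,3)]
  have sl: "a (length w) (slice (side_of (length w)) ?u w)
      = word_prod h w *\<^sub>C (W (length w) *\<^sub>C h (length w) - F (length w) *\<^sub>C ket None)" for w
    unfolding slice_word_vec[of h, OF h(2,3)] using a(1)[of "length w"]
    by (simp add: selfadjoint_def bounded_clinear_def h(1))
  have "tower a ?u = z *\<^sub>C ?u - (z - (W 0 - F 0)) *\<^sub>C ket []"
  proof (rule ell2_eqI)
    fix w
    show "coord (tower a ?u) w = coord (z *\<^sub>C ?u - (z - (W 0 - F 0)) *\<^sub>C ket []) w"
    proof (cases "reach w")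
      case False
      then have "w \<noteq> []" by auto
      then show ?thesis
        using False by (simp add: coord_tower_nonreach[OF a] cu word_prod_nonreach coord_ket)
    next
      case True
      show ?thesis
      proof (cases w)
        case Nil
        then show ?thesis
          by (simp add: coord_tower_reach[OF a] sl[of "[]", simplified] cu coord_ket h(2))
      next
        case (Cons p w')
        have p: "fst p = side_of (length w')" using True by (simp add: Cons)
        have "coord (tower a ?u) w = word_prod h w * (W (Suc (length w')) - F (Suc (length w')))
            + word_prod h w' * (W (length w') * coord (h (length w')) (Some (snd p)))"
          unfolding coord_tower_reach[OF a True] sl by (simp add: Cons sl h(2) coord_ket)
        also have "\<dots> = word_prod h w * (W (length w') + (W (Suc (length w')) - F (Suc (length w'))))"
          by (simp add: Cons p algebra_simps)
        also have "\<dots> = word_prod h w * z" unfolding rec ..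
        finally show ?thesis by (simp add: cu coord_ket Cons mult.commute)
      qed
    qed
  qed
  then have "(z - (W 0 - F 0)) * G_transform \<rho> z = 1"
    using selfadjoint_tower[OF a] norm_tower[OF a] a(3) d z
    by (intro G_transform_from_solution[where T = "tower a" and B = "2 * C" and i = "[]" and u = ?u and R = R, OF _ _ _ _ R])
      (auto simp: selfadjoint_def vacuum_def cu)
  then show ?thesis
    unfolding F_transform_def by (metis mult_zero_right nonzero_eq_divide_eq zero_neq_one)
qed

section \<open>Orthogonal and s-free convolution\<close>

lemma realisation_exists:
  assumes "real_distribution \<mu>" "compactly_supported \<mu>"
  obtains x :: "nat option ell2 \<Rightarrow> nat option ell2" where "selfadjoint x" "has_distribution x (ket None) \<mu>"
proof -
  obtain R where "compact_distribution \<mu> R" using compact_distributionI[OF assms] by blast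
  from compact_distribution.realisation[OF this] show thesis using that by blast
qed

lemma selfadjoint_norm_bound:
  assumes "selfadjoint x" "selfadjoint y"
  obtains C where "0 < C" "\<And>v. norm (x v) \<le> norm v * C" "\<And>v. norm (y v) \<le> norm v * C"
proof -
  obtain A B where AB: "0 < A" "\<And>v. norm (x v) \<le> norm v * A" "0 < B" "\<And>v. norm (y v) \<le> norm v * B"
    using bounded_linear.pos_bounded[OF selfadjoint_bounded_linear[OF assms(1)]]
      bounded_linear.pos_bounded[OF selfadjoint_bounded_linear[OF assms(2)]] by metis
  have "norm (x v) \<le> norm v * max A B" for v
    by (rule order_trans[OF AB(2)]) (simp add: mult_left_mono)
  moreover have "norm (y v) \<le> norm v * max A B" for v
    by (rule order_trans[OF AB(4)]) (simp add: mult_left_mono)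
  ultimately show thesis using that[of "max A B"] AB by simp
qed

lemma compact_distribution_mono: "compact_distribution \<mu> R \<Longrightarrow> R \<le> S \<Longrightarrow> compact_distribution \<mu> S"
  unfolding compact_distribution_def compact_distribution_axioms_def
  by (auto elim!: eventually_mono)

lemma F_nonzero: "real_distribution \<mu> \<Longrightarrow> 0 < Im z \<Longrightarrow> F_transform \<mu> z \<noteq> 0"
  using real_distribution.Im_F_pos by fastforce

lemma G_eq_inverse_F: "G_transform \<mu> z = 1 / F_transform \<mu> z"
  by (simp add: F_transform_def)

lemma F_eq_K: "F_transform \<mu> z = z - K_transform \<mu> z"
  by (simp add: K_transform_def)

lemma Im_le_cmod: "Im z \<le> cmod z"
  using abs_Im_le_cmod[of z] by linarith

section \<open>Existence and uniqueness of the orthogonal convolution\<close>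

definition orth_conv_rel :: "real measure \<Rightarrow> real measure \<Rightarrow> real measure \<Rightarrow> bool" where
  "orth_conv_rel \<mu> \<nu> \<rho> \<longleftrightarrow> real_distribution \<rho> \<and>
     (\<forall>z\<in>upper_half_plane. F_transform \<rho> z = F_transform \<mu> (F_transform \<nu> z) - F_transform \<nu> z + z)"

text \<open>The measure is the distribution of the tower x, y, 0, 0, ... Compact support is part of
  the conclusion because the next iteration has to realise the result by a bounded operator
  again.\<close>

lemma orth_conv_exists:
  assumes \<mu>: "real_distribution \<mu>" "compactly_supported \<mu>" and \<nu>: "real_distribution \<nu>" "compactly_supported \<nu>"
  shows "\<exists>\<rho>. orth_conv_rel \<mu> \<nu> \<rho> \<and> compactly_supported \<rho>"
proof -
  interpret \<mu>: real_distribution \<mu> by fact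
  interpret \<nu>: real_distribution \<nu> by fact
  obtain R1 where R1: "compact_distribution \<mu> R1" using compact_distributionI[OF \<mu>] by blast
  obtain R2 where R2: "compact_distribution \<nu> R2" using compact_distributionI[OF \<nu>] by blast
  obtain x :: "nat option ell2 \<Rightarrow> nat option ell2" where x: "selfadjoint x" "has_distribution x (ket None) \<mu>"
    using realisation_exists[OF \<mu>] by blast
  obtain y :: "nat option ell2 \<Rightarrow> nat option ell2" where y: "selfadjoint y" "has_distribution y (ket None) \<nu>"
    using realisation_exists[OF \<nu>] by blast
  obtain C where C: "0 < C" "\<And>v. norm (x v) \<le> norm v * C" "\<And>v. norm (y v) \<le> norm v * C"
    using selfadjoint_norm_bound[OF x(1) y(1)] by blast
  define a where "a n = (if n = 0 then x else if n = 1 then y else (\<lambda>_. 0))" for n :: nat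
  have a: "selfadjoint (a n)" "norm (a n v) \<le> norm v * C" for n v
    using x y C selfadjoint_zero by (auto simp: a_def)
  obtain \<rho> where \<rho>: "has_distribution (tower a) vacuum \<rho>"
    using has_distribution_exists[OF selfadjoint_tower[where C = C and a = a], of vacuum] a C
    by (auto simp: vacuum_def norm_ket)
  then have rd: "real_distribution \<rho>" "compactly_supported \<rho>" by (simp_all add: has_distribution_def)
  interpret \<rho>: real_distribution \<rho> by fact
  obtain R3 where R3: "compact_distribution \<rho> R3" using compact_distributionI[OF rd] by blast
  have pos: "0 < R1" "0 < R2" "0 < R3"
    using compact_distribution.R_pos R1 R2 R3 by auto
  \<comment> \<open>Passing from z to \<open>F_transform \<nu> z\<close> costs at most 2 R2 in
    modulus, valid from 4 R2 on; R1 and 12 C must remain for the resolvent of x there, and R3 serves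
    the expansion of the transform of \<open>\<rho>\<close>.\<close>
  define m where "m = R1 + 4 * R2 + R3 + 12 * C"
  have large: "F_transform \<rho> z = F_transform \<mu> (F_transform \<nu> z) - F_transform \<nu> z + z" if z: "m < Im z" for z
  proof -
    have zm: "m < cmod z" "0 < Im z" using z Im_le_cmod[of z] pos C(1) by (auto simp: m_def)
    let ?w = "F_transform \<nu> z"
    have "cmod (K_transform \<nu> z) \<le> 2 * R2"
      using zm pos C(1) by (intro compact_distribution.K_norm_le[OF R2]) (auto simp: m_def)
    then have w: "cmod z - 2 * R2 \<le> cmod ?w"
      using norm_triangle_ineq2[of z "K_transform \<nu> z"] unfolding F_eq_K by linarith
    obtain h0 where h0: "x h0 = ?w *\<^sub>C h0 - F_transform \<mu> ?w *\<^sub>C ket None" "coord h0 None = 1" "(norm h0)\<^sup>2 \<le> 3 / 2"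
    proof (rule resolvent_vector[OF x(1) C(2,1) x(2) R1])
      show "0 < Im ?w" by (rule \<nu>.Im_F_pos[OF zm(2)])
      show "R1 < cmod ?w" "12 * C \<le> cmod ?w" using zm w pos C(1) by (auto simp: m_def)
    qed
    obtain h1 where h1: "y h1 = z *\<^sub>C h1 - F_transform \<nu> z *\<^sub>C ket None" "coord h1 None = 1" "(norm h1)\<^sup>2 \<le> 3 / 2"
      by (rule resolvent_vector[OF y(1) C(3,1) y(2) R2 zm(2)]) (use zm pos C(1) in \<open>auto simp: m_def\<close>)
    \<comment> \<open>From height 2 on the operator is 0, and \<open>ket None\<close> with
      \<open>W n = F n = z\<close> solves the level equation; the product vector therefore vanishes
      on words of more than two letters.\<close>
    define h where "h n = (if n = 0 then h0 else if n = 1 then h1 else ket None)" for n :: nat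
    define W where "W n = (if n = 0 then ?w else z)" for n :: nat
    define F where "F n = (if n = 0 then F_transform \<mu> ?w else if n = 1 then ?w else z)" for n :: nat
    have "F_transform \<rho> z = z - (W 0 - F 0)"
    proof (rule tower_G_transform[where a = a and h = h and W = W and F = F and C = C and R = R3])
      show "a n (h n) = W n *\<^sub>C h n - F n *\<^sub>C ket None" for n
        using h0(1) h1(1) by (auto simp: a_def h_def W_def F_def)
      show "coord (h n) None = 1" "(norm (h n))\<^sup>2 \<le> 3 / 2" for n
        using h0 h1 by (auto simp: h_def coord_ket norm_ket)
      show "W n + (W (Suc n) - F (Suc n)) = z" for n by (simp add: W_def F_def)
    qed (use a C \<rho> R3 zm pos in \<open>auto simp: m_def\<close>)
    then show ?thesis by (simp add: W_def F_def)
  qed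
  have "F_transform \<rho> z = F_transform \<mu> (F_transform \<nu> z) - F_transform \<nu> z + z" if "0 < Im z" for z
  proof (rule holomorphic_eq_upper_half_plane[where m = m, OF \<rho>.F_holomorphic _ large that])
    have "(F_transform \<mu> \<circ> F_transform \<nu>) holomorphic_on upper_half_plane"
      by (rule holomorphic_on_compose_gen[OF \<nu>.F_holomorphic \<mu>.F_holomorphic])
        (auto simp: upper_half_plane_def \<nu>.Im_F_pos)
    then show "(\<lambda>z. F_transform \<mu> (F_transform \<nu> z) - F_transform \<nu> z + z) holomorphic_on upper_half_plane"
      unfolding o_def by (intro holomorphic_intros \<nu>.F_holomorphic)
  qed
  then show ?thesis using rd by (auto simp: orth_conv_rel_def upper_half_plane_def)
qed

lemma orth_conv:
  assumes "real_distribution \<mu>" "compactly_supported \<mu>" "real_distribution \<nu>" "compactly_supported \<nu>"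
  shows "real_distribution (orth_conv \<mu> \<nu>)" "compactly_supported (orth_conv \<mu> \<nu>)"
    "0 < Im z \<Longrightarrow> K_transform (orth_conv \<mu> \<nu>) z = K_transform \<mu> (z - K_transform \<nu> z)"
proof -
  obtain \<rho> where \<rho>: "orth_conv_rel \<mu> \<nu> \<rho>" "compactly_supported \<rho>"
    using orth_conv_exists[OF assms] by blast
  have "orth_conv \<mu> \<nu> = \<rho>"
    unfolding orth_conv_def orth_conv_rel_def[symmetric]
  proof (rule the_equality)
    show "orth_conv_rel \<mu> \<nu> \<rho>" by (rule \<rho>(1))
  next
    fix \<sigma> assume "orth_conv_rel \<mu> \<nu> \<sigma>"
    then show "\<sigma> = \<rho>" using \<rho>(1) unfolding orth_conv_rel_def
      by (intro G_transform_inject) (auto simp: G_eq_inverse_F upper_half_plane_def)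
  qed
  then show "real_distribution (orth_conv \<mu> \<nu>)" "compactly_supported (orth_conv \<mu> \<nu>)"
    "0 < Im z \<Longrightarrow> K_transform (orth_conv \<mu> \<nu>) z = K_transform \<mu> (z - K_transform \<nu> z)"
    using \<rho> by (auto simp: orth_conv_rel_def upper_half_plane_def K_transform_def)
qed

lemma orth_conv_iter_distribution:
  assumes "real_distribution \<mu>" "compactly_supported \<mu>" "real_distribution \<nu>" "compactly_supported \<nu>"
  shows "real_distribution (orth_conv_iter n \<mu> \<nu>) \<and> compactly_supported (orth_conv_iter n \<mu> \<nu>)"
  using assms by (induction n arbitrary: \<mu> \<nu>) (auto intro!: orth_conv)

lemma K_orth_conv_iter_Suc:
  assumes "real_distribution \<mu>" "compactly_supported \<mu>" "real_distribution \<nu>" "compactly_supported \<nu>" "0 < Im z"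
  shows "K_transform (orth_conv_iter (Suc n) \<mu> \<nu>) z = K_transform \<mu> (z - K_transform (orth_conv_iter n \<nu> \<mu>) z)"
  using orth_conv_iter_distribution[OF assms(3,4,1,2), of n] assms by (simp add: orth_conv(3))

text \<open>Both transforms map the disc of radius 2R around 0, shifted by z, back into that disc
  with Lipschitz constant 1/2, so their composition contracts by 1/4.\<close>

lemma K_fixed_point:
  assumes \<mu>: "real_distribution \<mu>" "compactly_supported \<mu>" "compact_distribution \<mu> R"
    and \<nu>: "real_distribution \<nu>" "compactly_supported \<nu>" "compact_distribution \<nu> R"
    and z: "10 * R \<le> Im z"
  obtains k l where "cmod k \<le> 2 * R" "cmod l \<le> 2 * R" "k = K_transform \<mu> (z - l)" "l = K_transform \<nu> (z - k)"
    "(\<lambda>n. K_transform (orth_conv_iter n \<mu> \<nu>) z) \<longlonglongrightarrow> k"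
proof -
  interpret \<mu>: compact_distribution \<mu> R by fact
  interpret \<nu>: compact_distribution \<nu> R by fact
  have R: "0 < R" by (rule \<mu>.R_pos)
  have z0: "0 < Im z" using z R by linarith
  \<comment> \<open>10 R = 8 R + 2 R: subtracting a point of the disc leaves z in the region of
    \<open>K_lipschitz\<close>.\<close>
  have Im: "8 * R \<le> Im (z - a)" if "cmod a \<le> 2 * R" for a
    using Im_le_cmod[of a] that z by simp
  have bd: "cmod (K_transform \<mu> (z - a)) \<le> 2 * R" "cmod (K_transform \<nu> (z - a)) \<le> 2 * R" if "cmod a \<le> 2 * R" for a
    using Im[OF that] Im_le_cmod[of "z - a"] R
    by (auto intro!: \<mu>.K_norm_le \<nu>.K_norm_le simp del: minus_complex.sel)
  have lip: "cmod (K_transform \<mu> (z - a) - K_transform \<mu> (z - b)) \<le> 1 / 2 * cmod (a - b)"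
    "cmod (K_transform \<nu> (z - a) - K_transform \<nu> (z - b)) \<le> 1 / 2 * cmod (a - b)"
    if "cmod a \<le> 2 * R" "cmod b \<le> 2 * R" for a b
    using \<mu>.K_lipschitz[OF Im Im, OF that] \<nu>.K_lipschitz[OF Im Im, OF that] by (simp_all add: norm_minus_commute)
  let ?\<Phi> = "\<lambda>a. K_transform \<mu> (z - K_transform \<nu> (z - a))"
  have "\<exists>!k. k \<in> cball 0 (2 * R) \<and> ?\<Phi> k = k"
  proof (rule Banach_fix[where c = "1 / 4", OF complete_eq_closed[THEN iffD2, OF closed_cball]])
    show "cball (0::complex) (2 * R) \<noteq> {}" using R by simp
  next
    show "?\<Phi> ` cball 0 (2 * R) \<subseteq> cball 0 (2 * R)" using bd by auto
    fix a b :: complex assume ab: "a \<in> cball 0 (2 * R)" "b \<in> cball 0 (2 * R)"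
    then have "cmod (?\<Phi> a - ?\<Phi> b) \<le> 1 / 2 * (1 / 2 * cmod (a - b))"
      by (intro order_trans[OF lip(1)] mult_left_mono lip(2) bd) auto
    then show "dist (?\<Phi> a) (?\<Phi> b) \<le> 1 / 4 * dist a b" by (simp add: dist_norm)
  qed auto
  then obtain k where k: "cmod k \<le> 2 * R" "?\<Phi> k = k" by auto
  define l where "l = K_transform \<nu> (z - k)"
  have l: "cmod l \<le> 2 * R" "k = K_transform \<mu> (z - l)" using bd k by (auto simp: l_def)
  let ?A = "\<lambda>n. K_transform (orth_conv_iter n \<mu> \<nu>) z" and ?B = "\<lambda>n. K_transform (orth_conv_iter n \<nu> \<mu>) z"
  \<comment> \<open>The recursion exchanges the two measures, so both sequences are followed
    together. The value at \<open>n = 0\<close> is K at z - 0, already in the disc, and 4R is the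
    diameter of the disc.\<close>
  have est: "cmod (?A n) \<le> 2 * R \<and> cmod (?B n) \<le> 2 * R \<and> cmod (?A n - k) \<le> 4 * R * (1 / 2) ^ n \<and> cmod (?B n - l) \<le> 4 * R * (1 / 2) ^ n" for n
  proof (induction n)
    case 0
    have "cmod (?A 0) \<le> 2 * R" "cmod (?B 0) \<le> 2 * R" using bd[of 0] R by auto
    then show ?case
      using k(1) l(1) norm_triangle_ineq4[of "?A 0" k] norm_triangle_ineq4[of "?B 0" l] by simp
  next
    case (Suc n)
    have eq: "?A (Suc n) = K_transform \<mu> (z - ?B n)" "?B (Suc n) = K_transform \<nu> (z - ?A n)"
      by (rule K_orth_conv_iter_Suc[OF \<mu>(1,2) \<nu>(1,2) z0], rule K_orth_conv_iter_Suc[OF \<nu>(1,2) \<mu>(1,2) z0])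
    have "cmod (?A (Suc n) - k) \<le> 1 / 2 * cmod (?B n - l)"
      unfolding eq by (subst l(2)) (intro lip Suc[THEN conjunct2, THEN conjunct1] l(1))
    moreover have "cmod (?B (Suc n) - l) \<le> 1 / 2 * cmod (?A n - k)"
      unfolding eq l_def by (intro lip Suc[THEN conjunct1] k(1))
    ultimately show ?case using Suc bd[of "?A n"] bd[of "?B n"] unfolding eq by auto
  qed
  have "(\<lambda>n. ?A n - k) \<longlonglongrightarrow> 0"
  proof (rule Lim_null_comparison)
    show "\<forall>\<^sub>F n in sequentially. norm (?A n - k) \<le> 4 * R * (1 / 2) ^ n" using est by simp
    have "(\<lambda>n. 4 * R * (1 / 2) ^ n) \<longlonglongrightarrow> 4 * R * 0"
      by (intro tendsto_mult tendsto_const LIMSEQ_power_zero) simp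
    then show "(\<lambda>n. 4 * R * (1 / 2) ^ n) \<longlonglongrightarrow> 0" by simp
  qed
  then have "?A \<longlonglongrightarrow> k" by (simp add: LIM_zero_iff)
  then show thesis using that k(1) l l_def by blast
qed

text \<open>The s-free tower has period 2, and so has its solution: with \<open>W n\<close>
  alternating between z - l and z - k, the compatibility condition of
  \<open>tower_G_transform\<close> is exactly the fixed point equation.\<close>

lemma sfree_op_K_limit:
  fixes x y :: "'a option ell2 \<Rightarrow> 'a option ell2"
  assumes \<mu>: "real_distribution \<mu>" "compactly_supported \<mu>" and \<nu>: "real_distribution \<nu>" "compactly_supported \<nu>"
    and x: "selfadjoint x" "has_distribution x (ket None) \<mu>" and y: "selfadjoint y" "has_distribution y (ket None) \<nu>"
    and \<rho>: "has_distribution (sfree_op x y) vacuum \<rho>"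
  shows "\<exists>m. \<forall>z. m < Im z \<longrightarrow> (\<lambda>n. K_transform (orth_conv_iter n \<mu> \<nu>) z) \<longlonglongrightarrow> K_transform \<rho> z"
proof -
  obtain R1 where R1: "compact_distribution \<mu> R1" using compact_distributionI[OF \<mu>] by blast
  obtain R2 where R2: "compact_distribution \<nu> R2" using compact_distributionI[OF \<nu>] by blast
  define R where "R = max R1 R2"
  have R\<mu>: "compact_distribution \<mu> R" and R\<nu>: "compact_distribution \<nu> R"
    using compact_distribution_mono[OF R1] compact_distribution_mono[OF R2] by (simp_all add: R_def)
  obtain C where C: "0 < C" "\<And>v. norm (x v) \<le> norm v * C" "\<And>v. norm (y v) \<le> norm v * C"
    using selfadjoint_norm_bound[OF x(1) y(1)] by blast
  define a where "a n = (if even n then x else y)" for n :: nat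
  have a: "selfadjoint (a n)" "norm (a n v) \<le> norm v * C" for n v
    using x y C by (auto simp: a_def)
  have d: "has_distribution (tower a) vacuum \<rho>"
    using \<rho> unfolding sfree_op_tower[OF x(1) y(1)] a_def .
  then have rd: "real_distribution \<rho>" "compactly_supported \<rho>" by (simp_all add: has_distribution_def)
  obtain R3 where R3: "compact_distribution \<rho> R3" using compact_distributionI[OF rd] by blast
  have pos: "0 < R" "0 < R3" using compact_distribution.R_pos R\<mu> R3 by auto
  have "(\<lambda>n. K_transform (orth_conv_iter n \<mu> \<nu>) z) \<longlonglongrightarrow> K_transform \<rho> z" if z: "10 * R + R3 + 12 * C < Im z" for z
  proof -
    obtain k l where kl: "cmod k \<le> 2 * R" "cmod l \<le> 2 * R" "k = K_transform \<mu> (z - l)" "l = K_transform \<nu> (z - k)"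
      and lim: "(\<lambda>n. K_transform (orth_conv_iter n \<mu> \<nu>) z) \<longlonglongrightarrow> k"
    proof (rule K_fixed_point[OF \<mu> R\<mu> \<nu> R\<nu>])
      show "10 * R \<le> Im z" using z pos C(1) by linarith
    qed
    have big: "0 < Im (z - c)" "R < cmod (z - c)" "12 * C \<le> cmod (z - c)" if "cmod c \<le> 2 * R" for c
    proof -
      have "8 * R + R3 + 12 * C < Im (z - c)" using that z Im_le_cmod[of c] by simp
      then show "0 < Im (z - c)" "R < cmod (z - c)" "12 * C \<le> cmod (z - c)"
        using pos C(1) Im_le_cmod[of "z - c"] by linarith+
    qed
    obtain h0 where h0: "x h0 = (z - l) *\<^sub>C h0 - F_transform \<mu> (z - l) *\<^sub>C ket None" "coord h0 None = 1" "(norm h0)\<^sup>2 \<le> 3 / 2"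
      by (rule resolvent_vector[OF x(1) C(2,1) x(2) R\<mu> big[OF kl(2)]])
    obtain h1 where h1: "y h1 = (z - k) *\<^sub>C h1 - F_transform \<nu> (z - k) *\<^sub>C ket None" "coord h1 None = 1" "(norm h1)\<^sup>2 \<le> 3 / 2"
      by (rule resolvent_vector[OF y(1) C(3,1) y(2) R\<nu> big[OF kl(1)]])
    define W where "W n = (if even n then z - l else z - k)" for n :: nat
    define F where "F n = (if even n then F_transform \<mu> (z - l) else F_transform \<nu> (z - k))" for n :: nat
    have WF: "W n - F n = (if even n then k else l)" for n
      using kl(3,4) by (simp add: W_def F_def K_transform_def)
    have "F_transform \<rho> z = z - (W 0 - F 0)"
    proof (rule tower_G_transform[where a = a and h = "\<lambda>n. if even n then h0 else h1" and W = W and F = F and C = C and R = R3])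
      show "a n (if even n then h0 else h1) = W n *\<^sub>C (if even n then h0 else h1) - F n *\<^sub>C ket None" for n
        using h0(1) h1(1) by (auto simp: a_def W_def F_def)
      show "coord (if even n then h0 else h1) None = 1" "(norm (if even n then h0 else h1))\<^sup>2 \<le> 3 / 2" for n
        using h0 h1 by auto
      show "W n + (W (Suc n) - F (Suc n)) = z" for n unfolding WF by (simp add: W_def)
      show "R3 < cmod z" "2 * C < cmod z" "0 < Im z" using z pos C(1) Im_le_cmod[of z] by linarith+
    qed (use a C d R3 in auto)
    then have "K_transform \<rho> z = k" unfolding WF by (simp add: K_transform_def)
    then show ?thesis using lim by simp
  qed
  then show ?thesis by blast
qed

text \<open>The limit in \<open>sfree_op_K_limit\<close> does not involve the operators. Hence any
  two candidates, from whatever realisations, have the same transform for large Im z and coincide,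
  which makes the description well defined.\<close>

lemma sfree_conv:
  assumes \<mu>: "real_distribution \<mu>" "compactly_supported \<mu>" and \<nu>: "real_distribution \<nu>" "compactly_supported \<nu>"
  shows "real_distribution (sfree_conv \<mu> \<nu>) \<and>
    (\<exists>m. \<forall>z. m < Im z \<longrightarrow> (\<lambda>n. K_transform (orth_conv_iter n \<mu> \<nu>) z) \<longlonglongrightarrow> K_transform (sfree_conv \<mu> \<nu>) z)"
proof -
  let ?P = "\<lambda>\<rho>. \<exists>x1 x2 :: nat option ell2 \<Rightarrow> nat option ell2.
     selfadjoint x1 \<and> has_distribution x1 (ket None) \<mu> \<and> selfadjoint x2 \<and> has_distribution x2 (ket None) \<nu> \<and>
     has_distribution (sfree_op x1 x2) vacuum \<rho>"
  have lim: "real_distribution \<rho> \<and> (\<exists>m. \<forall>z. m < Im z \<longrightarrow> (\<lambda>n. K_transform (orth_conv_iter n \<mu> \<nu>) z) \<longlonglongrightarrow> K_transform \<rho> z)"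
    if "?P \<rho>" for \<rho>
    using that sfree_op_K_limit[OF \<mu> \<nu>] unfolding has_distribution_def by blast
  obtain x :: "nat option ell2 \<Rightarrow> nat option ell2" where x: "selfadjoint x" "has_distribution x (ket None) \<mu>"
    using realisation_exists[OF \<mu>] by blast
  obtain y :: "nat option ell2 \<Rightarrow> nat option ell2" where y: "selfadjoint y" "has_distribution y (ket None) \<nu>"
    using realisation_exists[OF \<nu>] by blast
  obtain C where C: "0 < C" "\<And>v. norm (x v) \<le> norm v * C" "\<And>v. norm (y v) \<le> norm v * C"
    using selfadjoint_norm_bound[OF x(1) y(1)] by blast
  have "selfadjoint (sfree_op x y)"
    unfolding sfree_op_tower[OF x(1) y(1)] using x y C by (intro selfadjoint_tower[where C = C]) auto
  then obtain \<rho> where "has_distribution (sfree_op x y) vacuum \<rho>"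
    using has_distribution_exists[of "sfree_op x y" vacuum] by (auto simp: vacuum_def norm_ket)
  then have P: "?P \<rho>" using x y by blast
  have "?P (sfree_conv \<mu> \<nu>)"
    unfolding sfree_conv_def
  proof (rule theI[where P = ?P, OF P])
    fix \<sigma> assume "?P \<sigma>"
    obtain m where m: "\<And>z. m < Im z \<Longrightarrow> (\<lambda>n. K_transform (orth_conv_iter n \<mu> \<nu>) z) \<longlonglongrightarrow> K_transform \<rho> z"
      using lim[OF P] by blast
    obtain m' where m': "\<And>z. m' < Im z \<Longrightarrow> (\<lambda>n. K_transform (orth_conv_iter n \<mu> \<nu>) z) \<longlonglongrightarrow> K_transform \<sigma> z"
      using lim[OF \<open>?P \<sigma>\<close>] by blast
    have "K_transform \<sigma> z = K_transform \<rho> z" if "max m m' < Im z" for z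
      by (rule LIMSEQ_unique[OF m' m]) (use that in auto)
    then show "\<sigma> = \<rho>"
      using lim[OF P] lim[OF \<open>?P \<sigma>\<close>]
      by (intro real_distribution_eqI[where m = "max m m'"]) (simp_all add: G_eq_inverse_F F_eq_K)
  qed
  then show ?thesis by (rule lim)
qed

text \<open>If convergence failed on C, some subsequence would stay at distance e from g. The bound
  makes the family normal, so Montel extracts a further subsequence converging locally uniformly,
  whose limit must be g.\<close>

lemma vitali_upper_half_plane:
  assumes f: "\<And>n. f n holomorphic_on upper_half_plane" and g: "g holomorphic_on upper_half_plane"
    and bound: "\<And>n z. 0 < Im z \<Longrightarrow> cmod (f n z) \<le> 1 / Im z"
    and lim: "\<And>z. m < Im z \<Longrightarrow> (\<lambda>n. f n z) \<longlonglongrightarrow> g z"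
    and C: "compact C" "C \<subseteq> upper_half_plane"
  shows "uniform_limit C f g sequentially"
proof (rule ccontr)
  assume "\<not> uniform_limit C f g sequentially"
  then obtain e where e: "0 < e" "\<not> (\<forall>\<^sub>F n in sequentially. \<forall>z\<in>C. dist (f n z) (g z) < e)"
    unfolding uniform_limit_iff by blast
  then have "\<exists>\<^sub>F n in cofinite. \<not> (\<forall>z\<in>C. dist (f n z) (g z) < e)"
    by (simp add: frequently_def cofinite_eq_sequentially)
  then have "infinite {n. \<not> (\<forall>z\<in>C. dist (f n z) (g z) < e)}"
    by (simp add: frequently_cofinite)
  from infinite_enumerate[OF this]
  obtain r :: "nat \<Rightarrow> nat" where r: "strict_mono r" "\<forall>n. r n \<in> {n. \<not> (\<forall>z\<in>C. dist (f n z) (g z) < e)}"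
    by blast
  obtain g' s where g': "g' holomorphic_on upper_half_plane" and s: "strict_mono (s :: nat \<Rightarrow> nat)"
    and pt: "\<And>z. z \<in> upper_half_plane \<Longrightarrow> (\<lambda>n. f (r (s n)) z) \<longlonglongrightarrow> g' z"
    and ul: "\<And>K. compact K \<Longrightarrow> K \<subseteq> upper_half_plane \<Longrightarrow> uniform_limit K ((\<lambda>n. f (r n)) \<circ> s) g' sequentially"
  proof (rule Montel[of upper_half_plane "range f" "\<lambda>n. f (r n)"])
    show "\<exists>B. \<forall>h\<in>range f. \<forall>z\<in>K. cmod (h z) \<le> B" if K: "compact K" "K \<subseteq> upper_half_plane" for K
    proof -
      have "continuous_on K (\<lambda>z. 1 / Im z)"
        using K(2) by (intro continuous_intros) (auto simp: upper_half_plane_def)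
      then have "bounded ((\<lambda>z. 1 / Im z) ` K)"
        by (intro compact_imp_bounded compact_continuous_image K(1))
      then obtain B where B: "\<forall>y\<in>(\<lambda>z. 1 / Im z) ` K. norm y \<le> B" unfolding bounded_iff by blast
      have "cmod (f n z) \<le> B" if "z \<in> K" for n z
      proof -
        have "cmod (f n z) \<le> 1 / Im z" using K(2) that by (intro bound) (auto simp: upper_half_plane_def)
        also have "\<dots> \<le> norm (1 / Im z)" unfolding real_norm_def by (rule abs_ge_self)
        also have "\<dots> \<le> B" using B that by blast
        finally show ?thesis .
      qed
      then show ?thesis by blast
    qed
  qed (use f open_upper_half_plane in auto)
  \<comment> \<open>The limits agree for large Im z by pointwise convergence, hence everywhere by
    the identity theorem.\<close>
  have "g' z = g z" if "0 < Im z" for z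
  proof (rule holomorphic_eq_upper_half_plane[OF g' g _ that])
    fix z assume z: "\<bar>m\<bar> < Im z"
    then have "(\<lambda>n. f n z) \<longlonglongrightarrow> g z" by (intro lim) simp
    from LIMSEQ_subseq_LIMSEQ[OF LIMSEQ_subseq_LIMSEQ[OF this r(1)] s]
    have "(\<lambda>n. f (r (s n)) z) \<longlonglongrightarrow> g z" by (simp only: o_def)
    moreover have "z \<in> upper_half_plane" using z by (simp add: upper_half_plane_def)
    ultimately show "g' z = g z" using LIMSEQ_unique[OF pt] by blast
  qed
  then have gg: "g' z = g z" if "z \<in> C" for z
    using C(2) that by (auto simp: upper_half_plane_def)
  have "\<forall>\<^sub>F n in sequentially. \<forall>z\<in>C. dist (f (r (s n)) z) (g' z) < e"
    using ul[OF C] e(1) unfolding uniform_limit_iff o_def by blast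
  then obtain n where "\<forall>z\<in>C. dist (f (r (s n)) z) (g' z) < e"
    unfolding eventually_sequentially by blast
  then show False using r(2)[rule_format, of "s n"] gg by simp
qed

theorem theorem8p4:
  fixes \<mu> \<nu> :: "real measure"
  assumes "real_distribution \<mu>" and "compactly_supported \<mu>"
    and "real_distribution \<nu>" and "compactly_supported \<nu>"
  shows "\<forall>C. compact C \<and> C \<subseteq> upper_half_plane \<longrightarrow>
    uniform_limit C (\<lambda>m. K_transform (orth_conv_iter m \<mu> \<nu>))
      (K_transform (sfree_conv \<mu> \<nu>)) sequentially"
proof (intro allI impI)
  fix C assume C: "compact C \<and> C \<subseteq> upper_half_plane"
  let ?\<rho> = "\<lambda>n. orth_conv_iter n \<mu> \<nu>" and ?\<sigma> = "sfree_conv \<mu> \<nu>"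
  have \<rho>: "real_distribution (?\<rho> n)" for n using orth_conv_iter_distribution[OF assms] by blast
  have \<sigma>: "real_distribution ?\<sigma>" using sfree_conv[OF assms] by blast
  obtain m where m: "\<And>z. m < Im z \<Longrightarrow> (\<lambda>n. K_transform (?\<rho> n) z) \<longlonglongrightarrow> K_transform ?\<sigma> z"
    using sfree_conv[OF assms] by blast
  have "(\<lambda>n. G_transform (?\<rho> n) z) \<longlonglongrightarrow> G_transform ?\<sigma> z" if "\<bar>m\<bar> < Im z" for z
    using F_nonzero[OF \<sigma>, of z] m[of z] that unfolding G_eq_inverse_F F_eq_K
    by (intro tendsto_divide tendsto_diff tendsto_const) auto
  then have G: "uniform_limit C (\<lambda>n. G_transform (?\<rho> n)) (G_transform ?\<sigma>) sequentially"
    using C \<rho> \<sigma> by (intro vitali_upper_half_plane[where m = "\<bar>m\<bar>"])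
      (auto intro: real_distribution.G_holomorphic real_distribution.norm_G_le)
  \<comment> \<open>Inversion preserves uniform convergence only if the limit is bounded away from
    0; on the compact set C this holds because the Cauchy transform is continuous without
    zeros.\<close>
  have "\<exists>b>0. \<forall>z\<in>C. b \<le> cmod (G_transform ?\<sigma> z)"
  proof (cases "C = {}")
    case False
    have "continuous_on C (\<lambda>z. cmod (G_transform ?\<sigma> z))"
      using holomorphic_on_imp_continuous_on[OF real_distribution.G_holomorphic[OF \<sigma>]] C
      by (intro continuous_on_norm) (auto intro: continuous_on_subset)
    then obtain z0 where z0: "z0 \<in> C" "\<And>z. z \<in> C \<Longrightarrow> cmod (G_transform ?\<sigma> z0) \<le> cmod (G_transform ?\<sigma> z)"
      using continuous_attains_inf[of C] C False by blast
    have "0 < cmod (G_transform ?\<sigma> z0)"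
      using z0(1) C real_distribution.G_nonzero[OF \<sigma>] by (auto simp: upper_half_plane_def)
    then show ?thesis using z0(2) by blast
  qed (auto intro: exI[of _ 1])
  then obtain b where b: "0 < b" "\<And>z. z \<in> C \<Longrightarrow> b \<le> cmod (G_transform ?\<sigma> z)" by blast
  have "uniform_limit C (\<lambda>n z. z - inverse (G_transform (?\<rho> n) z)) (\<lambda>z. z - (inverse \<circ> G_transform ?\<sigma>) z) sequentially"
    by (intro uniform_limit_minus uniform_limit_const uniform_lim_inverse[OF G b(2,1)])
  then show "uniform_limit C (\<lambda>m. K_transform (?\<rho> m)) (K_transform ?\<sigma>) sequentially"
    by (simp add: K_transform_def[abs_def] F_transform_def inverse_eq_divide)
qed

end
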